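(* Let $p$ be a prime, and let $r$ and $n$ be integers such that $0 \leq r \leq n$. Let $J$ be a nilpotent ring of cardinality $p^r$. The number of isomorphism classes of rings $R$ of cardinality $p^n$ with $J(R)\cong J$ is at most $n\, p^{7n^2+9n+2}=p^{O(n^2)}$.
   Context: Rings are associative but are not assumed to have a multiplicative identity (nor to be commutative). $J(R)$ denotes the Jacobson radical of the ring $R$ (in the sense appropriate for rings without identity; for a finite ring it is the largest nilpotent two-sided ideal). A ring is nilpotent if for some $m\ge 1$ all products of $m$ of its elements vanish.
   Formalization: The case n = 0 (hence r = 0) is excluded: there the stated bound equals 0, although the zero ring is exactly one ring of cardinality 1 and its radical is isomorphic to J; so n ≥ 1 is assumed. *)

theory Defs
  imports "HOL-Algebra.Ideal" "HOL-Algebra.Coset" "HOL-Computational_Algebra.Primes" Complex_Main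
begin

text \<open>
  Associative rings without the assumption of an identity (nor of commutativity), on the
  ring records of HOL-Algebra. The field \<open>one\<close> of the record carries no meaning here: nothing
  is assumed about it, and isomorphisms do not look at it.
\<close>

locale rng = abelian_group R for R (structure) +
  assumes rng_m_closed: "\<lbrakk> x \<in> carrier R; y \<in> carrier R \<rbrakk> \<Longrightarrow> x \<otimes> y \<in> carrier R"
    and rng_m_assoc: "\<lbrakk> x \<in> carrier R; y \<in> carrier R; z \<in> carrier R \<rbrakk>
      \<Longrightarrow> (x \<otimes> y) \<otimes> z = x \<otimes> (y \<otimes> z)"
    and rng_l_distr: "\<lbrakk> x \<in> carrier R; y \<in> carrier R; z \<in> carrier R \<rbrakk>
      \<Longrightarrow> (x \<oplus> y) \<otimes> z = x \<otimes> z \<oplus> y \<otimes> z"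
    and rng_r_distr: "\<lbrakk> x \<in> carrier R; y \<in> carrier R; z \<in> carrier R \<rbrakk>
      \<Longrightarrow> z \<otimes> (x \<oplus> y) = z \<otimes> x \<oplus> z \<otimes> y"

definition rng_iso :: "('a, 'm) ring_scheme \<Rightarrow> ('b, 'n) ring_scheme \<Rightarrow> ('a \<Rightarrow> 'b) set" where
  "rng_iso R S = {h. h \<in> hom R S \<and> h \<in> hom (add_monoid R) (add_monoid S)
                     \<and> bij_betw h (carrier R) (carrier S)}"

definition rng_isomorphic :: "('a, 'm) ring_scheme \<Rightarrow> ('b, 'n) ring_scheme \<Rightarrow> bool" where
  "rng_isomorphic R S \<longleftrightarrow> rng_iso R S \<noteq> {}"

text \<open>
  A product of \<open>m \<ge> 1\<close> factors is written \<open>foldl (\<otimes>) x xs\<close> with first factor \<open>x\<close>, because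
  there is no identity to start the fold from.
\<close>

definition nilpotent_rng :: "('a, 'm) ring_scheme \<Rightarrow> bool" where
  "nilpotent_rng R \<longleftrightarrow>
     (\<exists>m\<ge>1. \<forall>x xs. set (x # xs) \<subseteq> carrier R \<and> length (x # xs) = m
        \<longrightarrow> foldl (\<otimes>\<^bsub>R\<^esub>) x xs = \<zero>\<^bsub>R\<^esub>)"

definition left_ideal :: "'a set \<Rightarrow> ('a, 'm) ring_scheme \<Rightarrow> bool" where
  "left_ideal I R \<longleftrightarrow>
     additive_subgroup I R \<and> (\<forall>a\<in>carrier R. \<forall>x\<in>I. a \<otimes>\<^bsub>R\<^esub> x \<in> I)"

definition maximal_left_ideal :: "'a set \<Rightarrow> ('a, 'm) ring_scheme \<Rightarrow> bool" where
  "maximal_left_ideal I R \<longleftrightarrow>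
     left_ideal I R \<and> I \<noteq> carrier R
     \<and> (\<forall>K. left_ideal K R \<and> I \<subseteq> K \<longrightarrow> K = I \<or> K = carrier R)"

text \<open>Modular (also called regular) left ideals: those having a right identity modulo \<open>I\<close>.\<close>

definition modular_left_ideal :: "'a set \<Rightarrow> ('a, 'm) ring_scheme \<Rightarrow> bool" where
  "modular_left_ideal I R \<longleftrightarrow>
     left_ideal I R \<and> (\<exists>e\<in>carrier R. \<forall>a\<in>carrier R. a \<ominus>\<^bsub>R\<^esub> (a \<otimes>\<^bsub>R\<^esub> e) \<in> I)"

text \<open>
  The Jacobson radical of a ring that need not have an identity is the intersection of its
  modular maximal left ideals. If there are none, as in a nilpotent ring, it is the whole ring.
\<close>

definition jacobson_radical :: "('a, 'm) ring_scheme \<Rightarrow> 'a set" where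
  "jacobson_radical R =
     carrier R \<inter> \<Inter> {I. maximal_left_ideal I R \<and> modular_left_ideal I R}"

definition jacobson_radical_rng :: "('a, 'm) ring_scheme \<Rightarrow> ('a, 'm) ring_scheme" where
  "jacobson_radical_rng R = R \<lparr> carrier := jacobson_radical R \<rparr>"

text \<open>
  Rings are taken with carrier inside a type \<open>'a\<close>. Whenever \<open>'a\<close> is infinite (for instance
  \<open>nat\<close>), every finite ring has an isomorphic copy there, so that the classes below are then
  exactly all the isomorphism classes of the rings in question.
\<close>

definition rngs_with_radical :: "nat \<Rightarrow> ('b, 'm) ring_scheme \<Rightarrow> 'a ring set" where
  "rngs_with_radical N J =
     {R. rng R \<and> finite (carrier R) \<and> order R = N \<and> rng_isomorphic (jacobson_radical_rng R) J}"

definition rng_iso_classes :: "'a ring set \<Rightarrow> 'a ring set set" where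
  "rng_iso_classes \<R> = \<R> // {(R, S). R \<in> \<R> \<and> S \<in> \<R> \<and> rng_isomorphic R S}"

end

theory Submission
  imports Defs "HOL-Algebra.Subrings" "HOL-Algebra.Multiplicative_Group" "HOL-Algebra.QuotRing"
begin

text \<open>
  In a finite ring \<open>R\<close> with nilpotent radical \<open>J\<close>, choose a maximal set \<open>E\<close> of orthogonal
  idempotents. The corners \<open>e R e\<close> are local, and a finite division ring is generated by two
  elements, so \<open>R\<close> is generated modulo \<open>J\<close> by \<open>E\<close> and two further elements \<open>b, c\<close>. As an
  abelian group, \<open>R\<close> has generators \<open>g\<^sub>1, \<dots>, g\<^sub>n\<close>, of which \<open>r\<close> lie in \<open>J\<close> and the other
  \<open>n - r\<close> generate \<open>R\<close> over \<open>J\<close>, and all of them may be taken in Peirce components of \<open>E\<close>.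
  Then \<open>R\<close> is determined up to isomorphism by the elements \<open>p g\<^sub>i\<close> of \<open>J\<close>, by the \<open>g\<^sub>i\<close> lying in \<open>J\<close>,
  by the left and right Peirce labels of all \<open>g\<^sub>i\<close>, by \<open>b\<close> and \<open>c\<close>, and by the products of \<open>b\<close> and \<open>c\<close>
  with all \<open>g\<^sub>i\<close> from both sides. This amounts to at most
  \<open>r (n - r) + r\<^sup>2 + 2 n\<^sup>2 + 2 n + 4 n\<^sup>2\<close> digits in base \<open>p\<close>.
\<close>

section \<open>Finite division rings are generated by two elements\<close>

text \<open>A full multiplication table of \<open>n\<close> additive generators would need about
  \<open>n^3\<close> digits. Associativity saves a factor \<open>n\<close>: the elements whose
  products with everything are recorded correctly form a subring, so products with a bounded number
  of ring generators suffice, products inside the radical being known from \<open>J\<close>.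
  Idempotents cannot be recorded this way, since there may be as many as \<open>n\<close> of them.
  But each acts on a Peirce-homogeneous generator as identity or as zero, so one label per generator
  and side, itself a ring element, records them all. A ring element costs \<open>n\<close> digits:
  \<open>n - r\<close> digits below \<open>p\<close> and one of the \<open>p^r\<close> elements of
  \<open>J\<close>. As \<open>r (n - r) + r^2 = r n\<close> is at most \<open>n^2\<close>, the
  exponent stays below \<open>7 n^2 + 2 n\<close>, up to equality. A second obstacle is the radical:
  its definition directly yields only a left ideal, while a two-sided one is needed. It is therefore
  identified with a left-right symmetric nil condition on single elements, using the nilpotency of
  \<open>J\<close>.\<close>

definition subrng :: "'a set \<Rightarrow> ('a, 'm) ring_scheme \<Rightarrow> bool" where
  "subrng T R \<longleftrightarrow> additive_subgroup T R \<and> (\<forall>x\<in>T. \<forall>y\<in>T. x \<otimes>\<^bsub>R\<^esub> y \<in> T)"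

lemma (in abelian_group) additive_subgroup_finsum:
  assumes "additive_subgroup H G" and "f \<in> A \<rightarrow> H"
  shows "finsum G f A \<in> H"
proof -
  interpret additive_subgroup H G by fact
  show ?thesis using assms(2)
  proof (induct A rule: infinite_finite_induct)
    case (insert x F)
    then have "f \<in> F \<rightarrow> carrier G" "f x \<in> carrier G" using a_subset by auto
    with insert show ?case by (simp add: a_closed Pi_iff)
  qed (auto simp: zero_closed)
qed

lemma (in abelian_group) additive_subgroup_minus:
  assumes "additive_subgroup H G" "x \<in> H" "y \<in> H"
  shows "x \<ominus> y \<in> H"
  using assms additive_subgroup.a_closed additive_subgroup.a_inv_closed
  by (metis a_minus_def abelian_group_axioms)

lemma (in abelian_group) additive_subgroupI':
  assumes "H \<subseteq> carrier G" "\<zero> \<in> H" "\<And>x y. x \<in> H \<Longrightarrow> y \<in> H \<Longrightarrow> x \<ominus> y \<in> H"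
  shows "additive_subgroup H G"
proof -
  have m: "\<ominus> x \<in> H" if "x \<in> H" for x
    using assms(3)[OF assms(2) that] assms(1) that by (auto simp: a_minus_def)
  have "x \<oplus> y \<in> H" if "x \<in> H" "y \<in> H" for x y
    using assms(3)[OF that(1) m[OF that(2)]] assms(1) that by (auto simp: a_minus_def subset_iff)
  then show ?thesis using assms m
    by (auto intro!: additive_subgroup.intro subgroup.intro simp: a_inv_def[symmetric])
qed

locale finite_division_ring = ring +
  assumes fin: "finite (carrier R)"
    and nonzero_Units: "Units R = carrier R - {\<zero>}"
begin

lemma one_neq_zero: "\<one> \<noteq> \<zero>"
  using Units_one_closed nonzero_Units by blast

lemma inv_cancel:
  assumes "x \<in> Units R" "y \<in> carrier R"
  shows "inv x \<otimes> (x \<otimes> y) = y" "x \<otimes> (inv x \<otimes> y) = y"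
  using assms by (simp_all add: m_assoc[symmetric] Units_closed)

lemma division_cancel:
  assumes "x \<in> carrier R" "y \<in> carrier R" "x \<otimes> y = \<zero>" "x \<noteq> \<zero>"
  shows "y = \<zero>"
proof -
  have "x \<in> Units R" using assms nonzero_Units by blast
  then have "inv x \<otimes> (x \<otimes> y) = y" using assms(2) by (simp add: inv_cancel)
  then show ?thesis using assms \<open>x \<in> Units R\<close> by simp
qed

text \<open>In a maximal set \<open>K\<close> of pairwise commuting elements, whatever commutes with
  all of \<open>K\<close> already belongs to \<open>K\<close>. Being its own centralizer,
  \<open>K\<close> is closed under sums, products and inverses.\<close>

lemma maximal_commuting_subset:
  obtains K where "subfield K R" "\<And>x. x \<in> carrier R \<Longrightarrow> \<forall>k\<in>K. x \<otimes> k = k \<otimes> x \<Longrightarrow> x \<in> K"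
proof -
  let ?F = "{K. K \<subseteq> carrier R \<and> (\<forall>x\<in>K. \<forall>y\<in>K. x \<otimes> y = y \<otimes> x)}"
  have "finite ?F" using fin by simp
  moreover have "{} \<in> ?F" by simp
  ultimately obtain K where K: "K \<in> ?F" and max: "\<And>L. L \<in> ?F \<Longrightarrow> K \<subseteq> L \<Longrightarrow> K = L"
    using finite_has_maximal[of ?F] by (metis (lifting) empty_iff)
  have cent: "x \<in> K" if "x \<in> carrier R" "\<forall>k\<in>K. x \<otimes> k = k \<otimes> x" for x
  proof -
    have "insert x K \<in> ?F" using K that by auto
    with max[of "insert x K"] show ?thesis by blast
  qed
  have Kc: "\<And>k. k \<in> K \<Longrightarrow> k \<in> carrier R" and com: "\<And>x y. x \<in> K \<Longrightarrow> y \<in> K \<Longrightarrow> x \<otimes> y = y \<otimes> x"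
    using K by auto
  have "subring K R"
  proof (rule subringI)
    show "K \<subseteq> carrier R" "\<one> \<in> K" using Kc by (auto intro: cent)
    show "\<ominus> h \<in> K" if "h \<in> K" for h
      using that Kc com by (intro cent) (auto simp: l_minus r_minus)
    show "x \<otimes> y \<in> K" if "x \<in> K" "y \<in> K" for x y
    proof (rule cent)
      show "\<forall>k\<in>K. x \<otimes> y \<otimes> k = k \<otimes> (x \<otimes> y)"
        using that Kc com by (metis m_assoc)
    qed (use that Kc in auto)
    show "x \<oplus> y \<in> K" if "x \<in> K" "y \<in> K" for x y
      using that Kc com by (intro cent) (auto simp: l_distr r_distr)
  qed
  then have "subcring K R" using com by (rule subcringI)
  moreover have "Units (R\<lparr>carrier := K\<rparr>) = K - {\<zero>}"
  proof
    show "Units (R\<lparr>carrier := K\<rparr>) \<subseteq> K - {\<zero>}"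
      using Kc one_neq_zero by (fastforce simp: Units_def)
    show "K - {\<zero>} \<subseteq> Units (R\<lparr>carrier := K\<rparr>)"
    proof
      fix x assume x: "x \<in> K - {\<zero>}"
      then have u: "x \<in> Units R" using Kc nonzero_Units by auto
      have "inv x \<in> K"
      proof (rule cent)
        show "\<forall>k\<in>K. inv x \<otimes> k = k \<otimes> inv x"
        proof
          fix k assume k: "k \<in> K"
          have "inv x \<otimes> k = inv x \<otimes> (k \<otimes> x) \<otimes> inv x"
            using u Kc k by (simp add: m_assoc Units_closed)
          also have "k \<otimes> x = x \<otimes> k" using com k x by auto
          also have "inv x \<otimes> (x \<otimes> k) \<otimes> inv x = k \<otimes> inv x"
            using u Kc k by (simp add: m_assoc Units_closed inv_cancel)
          finally show "inv x \<otimes> k = k \<otimes> inv x" .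
        qed
      qed (use u in auto)
      then show "x \<in> Units (R\<lparr>carrier := K\<rparr>)"
        using x Units_l_inv[OF u] Units_r_inv[OF u] unfolding Units_def[of "R\<lparr>carrier := K\<rparr>"] by auto
    qed
  qed
  ultimately have "subfield K R" by (rule subfieldI)
  then show thesis using cent that by blast
qed

text \<open>
  Let \<open>K\<close> be a maximal subfield, \<open>N = card (K - {\<zero>})\<close>. Conjugation by \<open>K - {\<zero>}\<close> splits the division
  ring into the eigenspaces \<open>{y. \<forall>s. s\<^sup>j y s = y}\<close>, \<open>j < N\<close>, each of which is a line over \<open>K\<close>;
  the sums over \<open>t\<close> below are, up to the factor \<open>N = -1\<close>, the projections onto them. So a
  generator of the cyclic group \<open>K - {\<zero>}\<close> and the sum of one vector from each nonzero
  eigenspace generate the division ring.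
\<close>

lemma two_generated:
  "\<exists>a\<in>carrier R. \<exists>b\<in>carrier R. \<forall>T. subrng T R \<and> a \<in> T \<and> b \<in> T \<longrightarrow> carrier R \<subseteq> T"
proof -
  obtain K where K: "subfield K R"
    and cent: "\<And>x. x \<in> carrier R \<Longrightarrow> \<forall>k\<in>K. x \<otimes> k = k \<otimes> x \<Longrightarrow> x \<in> K"
    using maximal_commuting_subset by blast
  define Ks where "Ks = K - {\<zero>}"
  define N where "N = card Ks"
  have Kc: "K \<subseteq> carrier R" using subfieldE(3)[OF K] .
  have Ksc: "\<And>t. t \<in> Ks \<Longrightarrow> t \<in> carrier R" using Kc Ks_def by auto
  have finK: "finite K" "finite Ks" using Kc fin Ks_def finite_subset by auto
  have com: "\<And>x y. x \<in> K \<Longrightarrow> y \<in> K \<Longrightarrow> x \<otimes> y = y \<otimes> x" using subfieldE(4)[OF K] .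
  have U: "\<And>t. t \<in> Ks \<Longrightarrow> t \<in> Units R" using nonzero_Units Kc Ks_def by auto
  note Ksub = subringE[OF subfieldE(1)[OF K]]
  interpret F: field "R\<lparr>carrier := K\<rparr>" using subfield_iff(2)[OF K] .
  have pw: "x [^]\<^bsub>R\<lparr>carrier := K\<rparr>\<^esub> (i::nat) = x [^] i" for x i
    by (simp add: nat_pow_def)
  have "carrier (mult_of (R\<lparr>carrier := K\<rparr>)) = Ks" by (simp add: Ks_def)
  then have "\<exists>a\<in>Ks. Ks = {a [^] i |i::nat. i \<in> UNIV}"
    using F.finite_field_mult_group_has_gen finK by (simp add: pw del: carrier_mult_of)
  then obtain a where a: "a \<in> Ks" and gen: "Ks = {a [^] i |i::nat. i \<in> UNIV}" by blast
  interpret M: group "mult_of (R\<lparr>carrier := K\<rparr>)"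
    rewrites "([^]\<^bsub>mult_of (R\<lparr>carrier := K\<rparr>)\<^esub>) = (([^]) :: _ \<Rightarrow> nat \<Rightarrow> _)"
      and "\<one>\<^bsub>mult_of (R\<lparr>carrier := K\<rparr>)\<^esub> = \<one>" and "carrier (mult_of (R\<lparr>carrier := K\<rparr>)) = Ks"
      and "monoid.mult (mult_of (R\<lparr>carrier := K\<rparr>)) = monoid.mult R"
    by (rule F.field_mult_group) (simp_all add: fun_eq_iff nat_pow_def Ks_def)
  have powN: "t [^] N = \<one>" if "t \<in> Ks" for t
    using M.pow_order_eq_1[OF that] by (simp add: N_def order_def Ks_def)
  have N0: "N > 0" using a finK by (auto simp: N_def card_gt_0_iff)
  \<comment> \<open>The powers of \<open>a\<close> fill \<open>Ks\<close>, which has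
    \<open>N\<close> elements, so the first \<open>N\<close> of them are distinct. This tells two
    eigenspaces apart at \<open>s = a\<close>.\<close>
  have inja: "inj_on (\<lambda>i. a [^] i) {..<N}"
  proof (rule eq_card_imp_inj_on)
    have "a [^] i \<in> (\<lambda>i. a [^] i) ` {..<N}" for i :: nat
    proof -
      have "a [^] i = a [^] (N * (i div N) + i mod N)" by simp
      also have "\<dots> = (a [^] N) [^] (i div N) \<otimes> a [^] (i mod N)"
        using Ksc a by (simp add: nat_pow_mult nat_pow_pow)
      also have "\<dots> = a [^] (i mod N)" using powN[OF a] Ksc a by simp
      finally show ?thesis using N0 by (intro image_eqI[where x = "i mod N"]) auto
    qed
    then have "(\<lambda>i. a [^] i) ` {..<N} = Ks" unfolding gen by auto
    then show "card ((\<lambda>i. a [^] i) ` {..<N}) = card {..<N}" by (simp add: N_def)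
  qed simp
  have Kpow: "t [^] i \<in> Ks" if "t \<in> Ks" for t and i :: nat
    using M.nat_pow_closed[OF that] by simp
  \<comment> \<open>By Lagrange in the additive group of \<open>K\<close>, the number
    \<open>N + 1 = card K\<close> kills \<open>\<one>\<close>. So multiplication by \<open>N\<close>
    is negation and can be undone inside any additive subgroup.\<close>
  have qx: "[N] \<cdot> x \<oplus> x = \<zero>" if x: "x \<in> carrier R" for x
  proof -
    have "\<one> [^]\<^bsub>add_monoid (R\<lparr>carrier := K\<rparr>)\<^esub> card K = \<zero>"
      using group.pow_order_eq_1[OF F.a_group, of \<one>] Ksub(3) by (simp add: order_def)
    then have "[card K] \<cdot> \<one> = \<zero>" by (simp only: add_pow_def nat_pow_def) simp
    moreover have "card K = Suc N"
      unfolding N_def Ks_def by (rule card.remove[OF finK(1) Ksub(2)])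
    ultimately have "[Suc N] \<cdot> \<one> = \<zero>" by simp
    then have "[Suc N] \<cdot> x = \<zero>" using add_pow_ldistr[of \<one> x "Suc N"] x by simp
    then show ?thesis using x by simp
  qed
  define Q where "Q j x = (\<Oplus>t\<in>Ks. t [^] (j::nat) \<otimes> x \<otimes> t)" for j x
  \<comment> \<open>The condition amounts to \<open>s^-1 y s = s^(-j-1) y\<close>. Neither this form
    nor that of \<open>Q\<close> contains inverses, so a subring containing \<open>Ks\<close> and
    \<open>x\<close> contains \<open>Q j x\<close>.\<close>
  define V where "V j = {y \<in> carrier R. \<forall>s\<in>Ks. s [^] (j::nat) \<otimes> y \<otimes> s = y}" for j
  have Qc: "Q j x \<in> carrier R" if "x \<in> carrier R" for j x
    unfolding Q_def using Ksc that by (intro finsum_closed) auto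
  have pull: "u \<otimes> Q j x \<otimes> v = (\<Oplus>t\<in>Ks. u \<otimes> (t [^] j \<otimes> x \<otimes> t) \<otimes> v)"
    if "x \<in> carrier R" "u \<in> carrier R" "v \<in> carrier R" for u v j x
    unfolding Q_def using that Ksc finK
    by (simp add: finsum_rdistr finsum_ldistr Pi_iff)
  have QV: "Q j x \<in> V j" if x: "x \<in> carrier R" for j x
    unfolding V_def
  proof (intro CollectI conjI ballI)
    fix s assume s: "s \<in> Ks"
    have "s [^] j \<otimes> (t [^] j \<otimes> x \<otimes> t) \<otimes> s = (s \<otimes> t) [^] j \<otimes> x \<otimes> (s \<otimes> t)" if t: "t \<in> Ks" for t
    proof -
      have "t \<otimes> s = s \<otimes> t" using com s t by (auto simp: Ks_def)
      moreover have "(s \<otimes> t) [^] j = s [^] j \<otimes> t [^] j"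
        using \<open>t \<otimes> s = s \<otimes> t\<close> s t Ksc by (intro pow_mult_distrib) auto
      ultimately show ?thesis using s t Ksc x by (simp add: m_assoc)
    qed
    then have "s [^] j \<otimes> Q j x \<otimes> s = (\<Oplus>t\<in>Ks. (s \<otimes> t) [^] j \<otimes> x \<otimes> (s \<otimes> t))"
      using x s Ksc unfolding pull[OF x nat_pow_closed[OF Ksc[OF s]] Ksc[OF s]]
      by (intro finsum_cong') auto
    also have "\<dots> = (\<Oplus>t\<in>(\<lambda>t. s \<otimes> t) ` Ks. t [^] j \<otimes> x \<otimes> t)"
      using x s M.m_closed Ksc
      by (intro finsum_reindex[symmetric]) (auto intro!: inj_onI simp: U Units_l_cancel)
    also have "(\<lambda>t. s \<otimes> t) ` Ks = Ks" using M.surj_const_mult s by simp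
    finally show "s [^] j \<otimes> Q j x \<otimes> s = Q j x" by (simp add: Q_def)
  qed (rule Qc[OF x])
  have VV: "z = \<zero>" if "z \<in> V j" "z \<in> V l" "j < N" "l < N" "j \<noteq> l" for z j l
  proof (rule ccontr)
    assume nz: "z \<noteq> \<zero>"
    have z: "z \<in> carrier R" using that V_def by auto
    have "a [^] j \<otimes> z \<otimes> a = a [^] l \<otimes> z \<otimes> a" using that a by (auto simp: V_def)
    then have "a [^] j \<otimes> (z \<otimes> a) = a [^] l \<otimes> (z \<otimes> a)" using z a Ksc by (simp add: m_assoc)
    moreover have "z \<otimes> a \<in> Units R" using z nz U a nonzero_Units by (intro Units_m_closed) auto
    ultimately have "a [^] j = a [^] l" using a Ksc
      by (metis Units_closed Units_inv_closed Units_r_inv m_assoc nat_pow_closed r_one)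
    then show False using inja that by (auto simp: inj_on_def)
  qed
  have QVl: "Q j y \<in> V l" if y: "y \<in> V l" for j l y
    unfolding V_def
  proof (intro CollectI conjI ballI)
    have yc: "y \<in> carrier R" using y V_def by auto
    then show "Q j y \<in> carrier R" by (rule Qc)
    fix s assume s: "s \<in> Ks"
    have "s [^] l \<otimes> (t [^] j \<otimes> y \<otimes> t) \<otimes> s = t [^] j \<otimes> y \<otimes> t" if t: "t \<in> Ks" for t
    proof -
      have 1: "s [^] l \<otimes> t [^] j = t [^] j \<otimes> s [^] l"
        using com Kpow[OF s] Kpow[OF t] by (auto simp: Ks_def)
      have 2: "t \<otimes> s = s \<otimes> t" using com s t by (auto simp: Ks_def)
      have "s [^] l \<otimes> (t [^] j \<otimes> y \<otimes> t) \<otimes> s = (s [^] l \<otimes> t [^] j) \<otimes> y \<otimes> (t \<otimes> s)"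
        using s t Ksc yc by (simp add: m_assoc)
      also have "\<dots> = t [^] j \<otimes> (s [^] l \<otimes> y \<otimes> s) \<otimes> t"
        unfolding 1 2 using s t Ksc yc by (simp add: m_assoc)
      finally show ?thesis using y s by (simp add: V_def)
    qed
    then have "(\<Oplus>t\<in>Ks. s [^] l \<otimes> (t [^] j \<otimes> y \<otimes> t) \<otimes> s) = Q j y"
      unfolding Q_def using yc Ksc by (intro finsum_cong') auto
    then show "s [^] l \<otimes> Q j y \<otimes> s = Q j y"
      using pull yc s Ksc by simp
  qed
  have Qdiag: "Q j y = [N] \<cdot> y" if "y \<in> V j" for j y
  proof -
    have "Q j y = (\<Oplus>t\<in>Ks. y)"
      unfolding Q_def using that by (intro finsum_cong') (auto simp: V_def)
    also have "\<dots> = [N] \<cdot> y" using that by (simp add: V_def N_def add.finprod_const)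
    finally show ?thesis .
  qed
  \<comment> \<open>Telescoping: \<open>t - \<one>\<close> times the sum is
    \<open>t^N - \<one> = \<zero>\<close>, and a nonzero \<open>t - \<one>\<close> can be
    cancelled.\<close>
  have geom: "(\<Oplus>j\<in>{..<N}. t [^] j) = (if t = \<one> then [N] \<cdot> \<one> else \<zero>)" if t: "t \<in> Ks" for t
  proof (cases "t = \<one>")
    case True
    then show ?thesis by (simp add: add.finprod_const)
  next
    case False
    have tc: "t \<in> carrier R" using Ksc t by auto
    have "t \<otimes> (\<Oplus>j\<in>{..<n}. t [^] j) \<oplus> \<one> = (\<Oplus>j\<in>{..<n}. t [^] j) \<oplus> t [^] n" for n :: nat
    proof (induct n)
      case (Suc n)
      have c: "(\<Oplus>j\<in>{..<n}. t [^] j) \<in> carrier R" using tc by (intro finsum_closed) auto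
      have "t \<otimes> (\<Oplus>j\<in>{..<Suc n}. t [^] j) \<oplus> \<one>
          = t \<otimes> t [^] n \<oplus> (t \<otimes> (\<Oplus>j\<in>{..<n}. t [^] j) \<oplus> \<one>)"
        using c tc by (simp add: lessThan_Suc r_distr Pi_iff a_ac)
      also have "\<dots> = (\<Oplus>j\<in>{..<Suc n}. t [^] j) \<oplus> t [^] Suc n"
        unfolding Suc using c tc by (simp add: lessThan_Suc Pi_iff a_ac nat_pow_comm pow_mult_distrib
          nat_pow_Suc2[symmetric] del: nat_pow_Suc)
      finally show ?case .
    qed (use tc in simp)
    from this[of N] have e: "t \<otimes> (\<Oplus>j\<in>{..<N}. t [^] j) = (\<Oplus>j\<in>{..<N}. t [^] j)" (is "t \<otimes> ?s = ?s")
      using powN[OF t] tc by (simp add: finsum_closed)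
    have sc: "?s \<in> carrier R" using tc by (intro finsum_closed) auto
    have "(t \<ominus> \<one>) \<otimes> ?s = \<zero>" using e sc tc by (simp add: a_minus_def l_distr l_minus r_neg)
    moreover have "t \<ominus> \<one> \<noteq> \<zero>" using False tc by simp
    ultimately show ?thesis using False division_cancel[of "t \<ominus> \<one>" ?s] tc sc by simp
  qed
  \<comment> \<open>Exchanging the two summations leaves the geometric sums as coefficients, and
    only the term \<open>t = \<one>\<close> survives.\<close>
  have Qsum: "(\<Oplus>j\<in>{..<N}. Q j x) = [N] \<cdot> x" if x: "x \<in> carrier R" for x
  proof -
    have "(\<Oplus>j\<in>{..<n}. Q j x) = (\<Oplus>t\<in>Ks. (\<Oplus>j\<in>{..<n}. t [^] j) \<otimes> x \<otimes> t)" for n :: nat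
    proof (induct n)
      case 0
      have "(\<Oplus>t\<in>Ks. \<zero> \<otimes> x \<otimes> t) = (\<Oplus>t\<in>Ks. \<zero>)"
        using x Ksc by (intro finsum_cong') auto
      then show ?case by simp
    next
      case (Suc n)
      have c: "(\<Oplus>j\<in>{..<n}. t [^] j) \<in> carrier R" if "t \<in> Ks" for t
        using Ksc that by (intro finsum_closed) auto
      have "(\<Oplus>j\<in>{..<Suc n}. Q j x) = Q n x \<oplus> (\<Oplus>j\<in>{..<n}. Q j x)"
        using Qc x by (simp add: lessThan_Suc Pi_iff)
      also have "\<dots> = (\<Oplus>t\<in>Ks. t [^] n \<otimes> x \<otimes> t \<oplus> (\<Oplus>j\<in>{..<n}. t [^] j) \<otimes> x \<otimes> t)"
        unfolding Suc unfolding Q_def using x Ksc c by (intro finsum_addf[symmetric]) auto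
      also have "\<dots> = (\<Oplus>t\<in>Ks. (\<Oplus>j\<in>{..<Suc n}. t [^] j) \<otimes> x \<otimes> t)"
        using x Ksc c by (intro finsum_cong') (auto simp: lessThan_Suc Pi_iff l_distr)
      finally show ?case .
    qed
    also have "(\<Oplus>t\<in>Ks. (\<Oplus>j\<in>{..<N}. t [^] j) \<otimes> x \<otimes> t) = (\<Oplus>t\<in>Ks. if t = \<one> then [N] \<cdot> x else \<zero>)"
      using x Ksc by (intro finsum_cong') (auto simp: geom add_pow_ldistr)
    also have "\<dots> = (\<Oplus>t\<in>Ks. if \<one> = t then [N] \<cdot> x else \<zero>)" by (intro finsum_cong') (use x in auto)
    also have "\<dots> = [N] \<cdot> x"
      using add.finprod_singleton[of \<one> Ks "\<lambda>_. [N] \<cdot> x"] finK M.one_closed x by simp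
    finally show ?thesis .
  qed
  \<comment> \<open>The default \<open>\<zero>\<close> for a trivial eigenspace adds nothing to
    \<open>b\<close>; in that case \<open>Q j x\<close> vanishes as well.\<close>
  define y where "y j = (if V j = {\<zero>} then \<zero> else SOME v. v \<in> V j \<and> v \<noteq> \<zero>)" for j
  have V0: "\<zero> \<in> V j" for j using Ksc by (auto simp: V_def)
  have y: "y j \<in> V j" "V j \<noteq> {\<zero>} \<Longrightarrow> y j \<noteq> \<zero>" for j
  proof -
    have "\<exists>v. v \<in> V j \<and> v \<noteq> \<zero>" if "V j \<noteq> {\<zero>}" using that V0[of j] by blast
    from someI_ex[OF this] show "y j \<in> V j" "V j \<noteq> {\<zero>} \<Longrightarrow> y j \<noteq> \<zero>"
      using V0 by (auto simp: y_def)
  qed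
  then have yc: "y j \<in> carrier R" for j by (auto simp: V_def)
  define b where "b = (\<Oplus>j\<in>{..<N}. y j)"
  have bc: "b \<in> carrier R" unfolding b_def using yc by (intro finsum_closed) auto
  have Qb: "Q j b = [N] \<cdot> y j" if j: "j < N" for j
  proof -
    have "Q j (\<Oplus>l\<in>{..<n}. y l) = (\<Oplus>l\<in>{..<n}. Q j (y l))" for n :: nat
    proof (induct n)
      case 0
      have "(\<Oplus>t\<in>Ks. t [^] j \<otimes> \<zero> \<otimes> t) = (\<Oplus>t\<in>Ks. \<zero>)"
        using Ksc by (intro finsum_cong') auto
      then show ?case by (simp add: Q_def)
    next
      case (Suc n)
      have c: "(\<Oplus>l\<in>{..<n}. y l) \<in> carrier R" using yc by (intro finsum_closed) auto
      have "Q j (y n \<oplus> (\<Oplus>l\<in>{..<n}. y l))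
          = (\<Oplus>t\<in>Ks. t [^] j \<otimes> y n \<otimes> t \<oplus> t [^] j \<otimes> (\<Oplus>l\<in>{..<n}. y l) \<otimes> t)"
        unfolding Q_def using c yc Ksc by (intro finsum_cong') (auto simp: l_distr r_distr)
      also have "\<dots> = Q j (y n) \<oplus> Q j (\<Oplus>l\<in>{..<n}. y l)"
        unfolding Q_def using c yc Ksc by (intro finsum_addf) auto
      finally show ?case using Suc yc Qc by (simp add: lessThan_Suc Pi_iff)
    qed
    from this[of N] have "Q j b = (\<Oplus>l\<in>{..<N}. Q j (y l))" by (simp add: b_def)
    also have "\<dots> = (\<Oplus>l\<in>{..<N}. if j = l then [N] \<cdot> y l else \<zero>)"
    proof (intro finsum_cong')
      fix l assume l: "l \<in> {..<N}"
      show "Q j (y l) = (if j = l then [N] \<cdot> y l else \<zero>)"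
        using Qdiag[OF y(1)] VV[OF QV[OF yc] QVl[OF y(1)] j, of l] l by auto
    qed (use yc in auto)
    also have "\<dots> = [N] \<cdot> y j"
      using add.finprod_singleton[of j "{..<N}" "\<lambda>l. [N] \<cdot> y l"] j yc by simp
    finally show ?thesis .
  qed
  have "carrier R \<subseteq> T" if T: "subrng T R" and aT: "a \<in> T" and bT: "b \<in> T" for T
  proof
    fix x assume x: "x \<in> carrier R"
    have addT: "additive_subgroup T R" and mT: "\<And>u v. u \<in> T \<Longrightarrow> v \<in> T \<Longrightarrow> u \<otimes> v \<in> T"
      using T by (auto simp: subrng_def)
    interpret T: additive_subgroup T R by fact
    have aS: "a [^] Suc i \<in> T" for i
      using aT mT by (induct i) (use a Ksc in \<open>auto\<close>)
    have KsT: "Ks \<subseteq> T"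
    proof
      fix t assume "t \<in> Ks"
      then obtain i :: nat where i: "t = a [^] i" using gen by auto
      \<comment> \<open>\<open>T\<close> is not assumed to contain \<open>\<one>\<close>, so
        \<open>aS\<close> starts at exponent 1. Adding \<open>N\<close> to the exponent makes it
        positive without changing the power.\<close>
      have "a [^] i = a [^] (Suc (i + (N - 1)))"
        using N0 powN[OF a] a Ksc nat_pow_mult[of a i N] by simp
      then show "t \<in> T" using aS i by metis
    qed
    then have KT: "K \<subseteq> T" using T.zero_closed by (auto simp: Ks_def)
    have tp: "t [^] (j::nat) \<in> T" if "t \<in> Ks" for t j using Kpow[OF that] KsT by blast
    have QT: "Q j v \<in> T" if "v \<in> T" for j v
      unfolding Q_def using that tp KsT by (intro additive_subgroup_finsum[OF addT]) (auto intro!: mT)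
    have NT: "v \<in> T" if "v \<in> carrier R" "[N] \<cdot> v \<in> T" for v
    proof -
      have "v = \<ominus> ([N] \<cdot> v)" using qx[OF that(1)] that(1)
        by (metis add.inv_comm add.inv_equality add.nat_pow_closed)
      then show ?thesis using that(2) T.a_inv_closed by metis
    qed
    have yT: "y j \<in> T" if "j < N" for j
      using NT[OF yc] QT[OF bT] Qb[OF that] by metis
    have "Q j x \<in> T" if j: "j < N" for j
    proof (cases "V j = {\<zero>}")
      case True
      then show ?thesis using QV[OF x, of j] T.zero_closed by auto
    next
      case False
      then have u: "y j \<in> Units R" using y yc nonzero_Units by auto
      have w: "Q j x \<in> V j" "Q j x \<in> carrier R" using QV Qc x by auto
      \<comment> \<open>Two elements of one eigenspace obey the same commutation rule with
        \<open>K\<close>, so their quotient commutes with \<open>K\<close> and lies in it.\<close>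
      have "inv (y j) \<otimes> Q j x \<in> K"
      proof (rule cent)
        show "\<forall>k\<in>K. inv (y j) \<otimes> Q j x \<otimes> k = k \<otimes> (inv (y j) \<otimes> Q j x)"
        proof
          fix k assume k: "k \<in> K"
          show "inv (y j) \<otimes> Q j x \<otimes> k = k \<otimes> (inv (y j) \<otimes> Q j x)"
          proof (cases "k = \<zero>")
            case True
            then show ?thesis using u w by simp
          next
            case False
            then have kK: "k \<in> Ks" using k by (simp add: Ks_def)
            note kc = Ksc[OF kK] and ku = U[OF kK]
            have k1: "k [^] j \<otimes> y j \<otimes> k = y j" "k [^] j \<otimes> Q j x \<otimes> k = Q j x"
              using y(1)[of j] w kK by (auto simp: V_def)
            have ju: "k [^] j \<in> Units R" using U[OF Kpow[OF kK]] .
            \<comment> \<open>Multiplying on the right by the unit \<open>v\<close> reduces equation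
              \<open>e\<close> below to the eigenvector equation of \<open>y j\<close>.\<close>
            define v where "v = y j \<otimes> k"
            have vu: "v \<in> Units R" using u ku by (simp add: v_def)
            have "k \<otimes> inv (y j) \<otimes> k [^] j \<otimes> v = k \<otimes> (inv (y j) \<otimes> (k [^] j \<otimes> y j \<otimes> k))"
              using u kc yc by (simp add: m_assoc v_def)
            also have "\<dots> = inv (y j) \<otimes> v"
              unfolding k1 using u kc yc by (simp add: v_def inv_cancel)
            finally have "k \<otimes> inv (y j) \<otimes> k [^] j \<otimes> v \<otimes> inv v = inv (y j) \<otimes> v \<otimes> inv v"
              by simp
            then have e: "k \<otimes> inv (y j) \<otimes> k [^] j = inv (y j)"
              using vu u kc yc by (simp add: m_assoc Units_closed)
            have "k \<otimes> (inv (y j) \<otimes> Q j x) = k \<otimes> inv (y j) \<otimes> (k [^] j \<otimes> Q j x \<otimes> k)"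
              unfolding k1 using u kc w by (simp add: m_assoc)
            also have "\<dots> = k \<otimes> inv (y j) \<otimes> k [^] j \<otimes> Q j x \<otimes> k"
              using u kc w by (simp add: m_assoc)
            finally show ?thesis unfolding e by simp
          qed
        qed
      qed (use u w in auto)
      then have "y j \<otimes> (inv (y j) \<otimes> Q j x) \<in> T" using KT mT yT[OF j] by blast
      then show ?thesis using u w by (simp add: inv_cancel)
    qed
    then have "(\<Oplus>j\<in>{..<N}. Q j x) \<in> T"
      by (intro additive_subgroup_finsum[OF addT] funcsetI) simp
    then have "[N] \<cdot> x \<in> T" unfolding Qsum[OF x] .
    then show "x \<in> T" by (rule NT[OF x])
  qed
  then show ?thesis using Ksc[OF a] bc by blast
qed

end

section \<open>The radical as the largest nil ideal\<close>

text \<open>The exponent is shifted: \<open>npow R x k\<close> is the power \<open>x^(k+1)\<close>,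
  because without an identity there is no zeroth power.\<close>

primrec npow :: "('a, 'm) ring_scheme \<Rightarrow> 'a \<Rightarrow> nat \<Rightarrow> 'a" where
  "npow R x 0 = x"
| "npow R x (Suc k) = npow R x k \<otimes>\<^bsub>R\<^esub> x"

definition nilp :: "('a, 'm) ring_scheme \<Rightarrow> 'a \<Rightarrow> bool" where
  "nilp R x \<longleftrightarrow> (\<exists>k. npow R x k = \<zero>\<^bsub>R\<^esub>)"

text \<open>A condition that is left-right symmetric by \<open>nilp_swap\<close>. It describes the
  Jacobson radical as soon as the latter consists of nilpotent elements.\<close>

definition nil_radical :: "('a, 'm) ring_scheme \<Rightarrow> 'a set" where
  "nil_radical R = {x \<in> carrier R. \<forall>r\<in>carrier R. nilp R (r \<otimes>\<^bsub>R\<^esub> x)}"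

lemma npow_foldl: "npow R x k = foldl (\<otimes>\<^bsub>R\<^esub>) x (replicate k x)"
proof (induct k)
  case (Suc k)
  have "replicate (Suc k) x = replicate k x @ [x]" by (simp add: replicate_append_same)
  then show ?case using Suc by (simp del: replicate_Suc)
qed simp

section \<open>Arithmetic without an identity, nilpotent elements and the radical\<close>

context rng
begin

lemma rng_l_null [simp]: "x \<in> carrier R \<Longrightarrow> \<zero> \<otimes> x = \<zero>"
proof -
  assume x: "x \<in> carrier R"
  have "\<zero> \<otimes> x \<oplus> \<zero> \<otimes> x = \<zero> \<otimes> x \<oplus> \<zero>"
    using x rng_l_distr[of \<zero> \<zero> x] rng_m_closed[of \<zero> x] by simp
  then show ?thesis using x rng_m_closed by (simp del: r_zero)
qed

lemma rng_r_null [simp]: "x \<in> carrier R \<Longrightarrow> x \<otimes> \<zero> = \<zero>"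
proof -
  assume x: "x \<in> carrier R"
  have "x \<otimes> \<zero> \<oplus> x \<otimes> \<zero> = x \<otimes> \<zero> \<oplus> \<zero>"
    using x rng_r_distr[of \<zero> \<zero> x] rng_m_closed[of x \<zero>] by simp
  then show ?thesis using x rng_m_closed by (simp del: r_zero)
qed

lemma rng_l_minus:
  assumes "x \<in> carrier R" "y \<in> carrier R"
  shows "\<ominus> x \<otimes> y = \<ominus> (x \<otimes> y)"
proof -
  have "\<ominus> x \<otimes> y \<oplus> x \<otimes> y = \<zero>"
    using assms rng_l_distr[of "\<ominus> x" x y] by (simp add: l_neg)
  then show ?thesis using assms rng_m_closed by (simp add: minus_equality)
qed

lemma rng_r_minus:
  assumes "x \<in> carrier R" "y \<in> carrier R"
  shows "x \<otimes> \<ominus> y = \<ominus> (x \<otimes> y)"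
proof -
  have "x \<otimes> \<ominus> y \<oplus> x \<otimes> y = \<zero>"
    using assms rng_r_distr[of "\<ominus> y" y x] by (simp add: l_neg)
  then show ?thesis using assms rng_m_closed by (simp add: minus_equality)
qed

lemma rng_l_diff:
  assumes "x \<in> carrier R" "y \<in> carrier R" "z \<in> carrier R"
  shows "(x \<ominus> y) \<otimes> z = x \<otimes> z \<ominus> y \<otimes> z"
  using assms by (simp add: a_minus_def rng_l_distr rng_l_minus)

lemma rng_r_diff:
  assumes "x \<in> carrier R" "y \<in> carrier R" "z \<in> carrier R"
  shows "z \<otimes> (x \<ominus> y) = z \<otimes> x \<ominus> z \<otimes> y"
  using assms by (simp add: a_minus_def rng_r_distr rng_r_minus)

lemma diff_eq_zero: "x \<in> carrier R \<Longrightarrow> y \<in> carrier R \<Longrightarrow> x \<ominus> y = \<zero> \<longleftrightarrow> x = y"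
  by (metis a_minus_def add.inv_closed minus_equality minus_minus r_neg)

lemma diff_zero [simp]: "x \<in> carrier R \<Longrightarrow> x \<ominus> \<zero> = x"
  by (simp add: a_minus_def)

lemma diff_self [simp]: "x \<in> carrier R \<Longrightarrow> x \<ominus> x = \<zero>"
  by (simp add: diff_eq_zero)

lemma diff_add_cancel: "x \<in> carrier R \<Longrightarrow> y \<in> carrier R \<Longrightarrow> (x \<ominus> y) \<oplus> y = x"
  by (simp add: a_minus_def a_assoc l_neg)

lemma npow_closed [simp]: "x \<in> carrier R \<Longrightarrow> npow R x k \<in> carrier R"
  by (induct k) (auto intro: rng_m_closed)

lemma npow_mult:
  "x \<in> carrier R \<Longrightarrow> npow R x k \<otimes> npow R x l = npow R x (Suc (k + l))"
  by (induct l) (auto simp: rng_m_assoc[symmetric])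

text \<open>Regrouping of the alternating product \<open>r x r x ... r x\<close>. It relates
  nilpotency of \<open>r x\<close> and of \<open>x r\<close>, which makes \<open>nil_radical\<close>
  two-sided.\<close>

lemma npow_swap:
  assumes "x \<in> carrier R" "r \<in> carrier R"
  shows "npow R (r \<otimes> x) (Suc k) = r \<otimes> npow R (x \<otimes> r) k \<otimes> x"
  using assms by (induct k) (simp_all add: rng_m_assoc rng_m_closed)

lemma nilp_swap:
  assumes "x \<in> carrier R" "r \<in> carrier R" "nilp R (x \<otimes> r)"
  shows "nilp R (r \<otimes> x)"
proof -
  obtain k where "npow R (x \<otimes> r) k = \<zero>" using assms nilp_def by metis
  then have "npow R (r \<otimes> x) (Suc k) = \<zero>" using npow_swap[of x r k] assms by simp
  then show ?thesis using nilp_def by metis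
qed

lemma npow_l: "e \<in> carrier R \<Longrightarrow> x \<in> carrier R \<Longrightarrow> e \<otimes> x = x \<Longrightarrow> e \<otimes> npow R x k = npow R x k"
  by (induct k) (auto simp: rng_m_assoc[symmetric])

lemma npow_r: "e \<in> carrier R \<Longrightarrow> x \<in> carrier R \<Longrightarrow> x \<otimes> e = x \<Longrightarrow> npow R x k \<otimes> e = npow R x k"
  by (induct k) (auto simp: rng_m_assoc)

lemma npow_l0: "e \<in> carrier R \<Longrightarrow> x \<in> carrier R \<Longrightarrow> e \<otimes> x = \<zero> \<Longrightarrow> e \<otimes> npow R x k = \<zero>"
  by (induct k) (auto simp: rng_m_assoc[symmetric])

lemma npow_r0: "e \<in> carrier R \<Longrightarrow> x \<in> carrier R \<Longrightarrow> x \<otimes> e = \<zero> \<Longrightarrow> npow R x k \<otimes> e = \<zero>"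
  by (induct k) (auto simp: rng_m_assoc)

text \<open>Take \<open>r = x\<close>: the powers of \<open>x x\<close> are even powers of
  \<open>x\<close>, and \<open>2 k + 1\<close> is the shifted exponent of
  \<open>x^(2 k + 2)\<close>.\<close>

lemma nil_radical_nilp:
  assumes "x \<in> nil_radical R"
  shows "nilp R x"
proof -
  have x: "x \<in> carrier R" using assms by (simp add: nil_radical_def)
  then obtain k where "npow R (x \<otimes> x) k = \<zero>" using assms by (auto simp: nil_radical_def nilp_def)
  moreover have "npow R (x \<otimes> x) k = npow R x (Suc (2 * k))"
  proof (induct k)
    case (Suc k)
    then show ?case using x by (simp add: rng_m_assoc rng_m_closed)
  qed simp
  ultimately show ?thesis unfolding nilp_def by metis
qed

lemma nil_radical_iff:
  "x \<in> nil_radical R \<longleftrightarrow> x \<in> carrier R \<and> (\<forall>r\<in>carrier R. nilp R (x \<otimes> r))"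
  using nilp_swap by (auto simp: nil_radical_def)

lemma nil_radical_r: "x \<in> nil_radical R \<Longrightarrow> s \<in> carrier R \<Longrightarrow> x \<otimes> s \<in> nil_radical R"
  by (auto simp: nil_radical_iff rng_m_assoc rng_m_closed)

lemma nil_radical_l: "x \<in> nil_radical R \<Longrightarrow> s \<in> carrier R \<Longrightarrow> s \<otimes> x \<in> nil_radical R"
  by (auto simp: nil_radical_def rng_m_assoc[symmetric] rng_m_closed)

text \<open>Without an identity \<open>x\<close> need not lie in \<open>R x\<close>, so this left
  ideal may be smaller than the one generated by \<open>M\<close> and \<open>x\<close>. Modularity
  of \<open>M\<close> makes up for this in \<open>nil_radical_le_modular_maximal\<close>.\<close>

lemma left_ideal_sum:
  assumes M: "left_ideal M R" and x: "x \<in> carrier R"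
  shows "left_ideal {m \<oplus> r \<otimes> x |m r. m \<in> M \<and> r \<in> carrier R} R"
proof -
  interpret M: additive_subgroup M R using M by (simp add: left_ideal_def)
  let ?L = "{m \<oplus> r \<otimes> x |m r. m \<in> M \<and> r \<in> carrier R}"
  have "additive_subgroup ?L R"
  proof (rule additive_subgroupI')
    show "?L \<subseteq> carrier R"
    proof
      fix u assume "u \<in> ?L"
      then obtain m r where 1: "u = m \<oplus> r \<otimes> x" "m \<in> M" "r \<in> carrier R" by blast
      then show "u \<in> carrier R" using x M.a_Hcarr rng_m_closed by simp
    qed
    have "\<zero> = \<zero> \<oplus> \<zero> \<otimes> x" using x by simp
    then show "\<zero> \<in> ?L" using M.zero_closed zero_closed by blast
    show "u \<ominus> v \<in> ?L" if "u \<in> ?L" "v \<in> ?L" for u v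
    proof -
      obtain m r where 1: "u = m \<oplus> r \<otimes> x" "m \<in> M" "r \<in> carrier R" using \<open>u \<in> ?L\<close> by blast
      obtain m' r' where 2: "v = m' \<oplus> r' \<otimes> x" "m' \<in> M" "r' \<in> carrier R" using \<open>v \<in> ?L\<close> by blast
      have c: "m \<in> carrier R" "m' \<in> carrier R" using 1 2 M.a_Hcarr by auto
      have "u \<ominus> v = (m \<ominus> m') \<oplus> (r \<ominus> r') \<otimes> x"
        using 1 2 c x rng_m_closed by (simp add: a_minus_def rng_l_distr rng_l_minus minus_add a_ac)
      moreover have "m \<ominus> m' \<in> M"
        using 1 2 additive_subgroup_minus M.is_additive_subgroup by blast
      ultimately show ?thesis using 1 2 by blast
    qed
  qed
  moreover have "a \<otimes> u \<in> ?L" if "a \<in> carrier R" "u \<in> ?L" for a u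
  proof -
    obtain m r where 1: "u = m \<oplus> r \<otimes> x" "m \<in> M" "r \<in> carrier R" using \<open>u \<in> ?L\<close> by blast
    have c: "m \<in> carrier R" using 1 M.a_Hcarr by auto
    have "a \<otimes> u = a \<otimes> m \<oplus> (a \<otimes> r) \<otimes> x"
      using 1 c x that rng_m_closed by (simp add: rng_r_distr rng_m_assoc)
    moreover have "a \<otimes> m \<in> M" using M 1 that by (simp add: left_ideal_def)
    ultimately show ?thesis using 1 that rng_m_closed by blast
  qed
  ultimately show ?thesis unfolding left_ideal_def by blast
qed

text \<open>By maximality \<open>M + R x\<close> is \<open>M\<close> or \<open>R\<close>. In the
  first case the elements that \<open>R\<close> multiplies into \<open>M\<close> form a left ideal
  above \<open>M\<close>, which modularity keeps from being all of \<open>R\<close>. In the second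
  some nilpotent \<open>r x\<close> is a right identity modulo \<open>M\<close>, which would force
  \<open>M\<close> to be everything.\<close>

lemma nil_radical_le_modular_maximal:
  assumes M: "maximal_left_ideal M R" "modular_left_ideal M R" and x: "x \<in> nil_radical R"
  shows "x \<in> M"
proof -
  have xc: "x \<in> carrier R" using x by (simp add: nil_radical_def)
  have li: "left_ideal M R" and ne: "M \<noteq> carrier R"
    and max: "\<And>K. left_ideal K R \<Longrightarrow> M \<subseteq> K \<Longrightarrow> K = M \<or> K = carrier R"
    using M(1) by (simp_all add: maximal_left_ideal_def)
  interpret M: additive_subgroup M R using li by (simp add: left_ideal_def)
  have lM: "\<And>a m. a \<in> carrier R \<Longrightarrow> m \<in> M \<Longrightarrow> a \<otimes> m \<in> M" using li by (simp add: left_ideal_def)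
  note sub = additive_subgroup_minus[OF M.is_additive_subgroup]
  obtain e where e: "e \<in> carrier R" and mod: "\<And>a. a \<in> carrier R \<Longrightarrow> a \<ominus> a \<otimes> e \<in> M"
    using M(2) unfolding modular_left_ideal_def by blast
  have notin: "\<not> carrier R \<subseteq> M" using ne M.a_subset by auto
  let ?L = "{m \<oplus> r \<otimes> x |m r. m \<in> M \<and> r \<in> carrier R}"
  have incl: "M \<subseteq> ?L"
  proof
    fix m assume "m \<in> M"
    then have "m = m \<oplus> \<zero> \<otimes> x" using xc M.a_Hcarr by simp
    then show "m \<in> ?L" using \<open>m \<in> M\<close> by blast
  qed
  consider "?L = M" | "?L = carrier R" using max[OF left_ideal_sum[OF li xc] incl] by blast
  then show ?thesis
  proof cases
    case 1
    have Rx: "r \<otimes> x \<in> M" if "r \<in> carrier R" for r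
    proof -
      have "r \<otimes> x = \<zero> \<oplus> r \<otimes> x" using that xc rng_m_closed by simp
      then have "r \<otimes> x \<in> ?L" using that M.zero_closed by blast
      then show ?thesis using 1 by simp
    qed
    let ?M = "{y \<in> carrier R. \<forall>r\<in>carrier R. r \<otimes> y \<in> M}"
    have "left_ideal ?M R"
      unfolding left_ideal_def
    proof (intro conjI ballI)
      show "additive_subgroup ?M R"
        using M.zero_closed by (intro additive_subgroupI') (auto simp: rng_r_diff intro: sub)
    qed (auto simp: rng_m_closed rng_m_assoc[symmetric])
    moreover have "M \<subseteq> ?M" using M.a_subset lM by auto
    ultimately consider "?M = M" | "?M = carrier R" using max by blast
    then show ?thesis
    proof cases
      case 1
      then show ?thesis using Rx xc by blast
    next
      case 2
      have "a \<in> M" if a: "a \<in> carrier R" for a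
      proof -
        have "e \<in> ?M" using 2 e by auto
        then have "a \<otimes> e \<in> M" using a by auto
        then have "(a \<ominus> a \<otimes> e) \<oplus> a \<otimes> e \<in> M" using mod[OF a] M.a_closed by blast
        then show ?thesis using a e rng_m_closed diff_add_cancel by simp
      qed
      then show ?thesis using notin by blast
    qed
  next
    case 2
    then obtain m r where mr: "e = m \<oplus> r \<otimes> x" "m \<in> M" "r \<in> carrier R" using e by blast
    define n where "n = r \<otimes> x"
    have nc: "n \<in> carrier R" using mr xc rng_m_closed n_def by auto
    have mc: "m \<in> carrier R" using mr M.a_Hcarr by auto
    have modn: "a \<ominus> a \<otimes> n \<in> M" if a: "a \<in> carrier R" for a
    proof -
      have "a \<ominus> a \<otimes> n = (a \<ominus> a \<otimes> e) \<oplus> a \<otimes> m"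
        using a nc mc mr rng_m_closed unfolding n_def[symmetric]
        by (simp add: rng_r_distr a_minus_def minus_add a_ac)
          (simp add: a_assoc[symmetric] r_neg)
      then show ?thesis using mod[OF a] lM[OF a mr(2)] M.a_closed by simp
    qed
    \<comment> \<open>Right factors \<open>n\<close> can be stripped modulo \<open>M\<close>. From a
      vanishing power this leads down to \<open>n \<in> M\<close>, and then
      \<open>a \<otimes> n \<in> M\<close> gives \<open>a \<in> M\<close> for every
      \<open>a\<close>.\<close>
    have red: "a \<in> M" if a: "a \<in> carrier R" and "a \<otimes> n \<in> M" for a
      using M.a_closed[OF modn[OF a] that(2)] diff_add_cancel a nc rng_m_closed by simp
    obtain k where "npow R n k = \<zero>" using x mr n_def by (auto simp: nil_radical_def nilp_def)
    then have "npow R n k \<in> M" using M.zero_closed by simp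
    then have "n \<in> M"
    proof (induct k)
      case (Suc k)
      then show ?case using red[OF npow_closed[OF nc]] by simp
    qed simp
    then have "carrier R \<subseteq> M" using red lM by blast
    then show ?thesis using notin by simp
  qed
qed

lemma jacobson_additive_subgroup: "additive_subgroup (jacobson_radical R) R"
proof (rule additive_subgroupI')
  have s: "\<And>I. maximal_left_ideal I R \<Longrightarrow> additive_subgroup I R"
    by (simp add: maximal_left_ideal_def left_ideal_def)
  show "\<zero> \<in> jacobson_radical R"
    using s by (auto simp: jacobson_radical_def intro: additive_subgroup.zero_closed)
  show "x \<ominus> y \<in> jacobson_radical R" if "x \<in> jacobson_radical R" "y \<in> jacobson_radical R" for x y
    using that s by (auto simp: jacobson_radical_def intro: additive_subgroup_minus)
qed (auto simp: jacobson_radical_def)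

lemma jacobson_l: "a \<in> carrier R \<Longrightarrow> x \<in> jacobson_radical R \<Longrightarrow> a \<otimes> x \<in> jacobson_radical R"
  by (auto simp: jacobson_radical_def maximal_left_ideal_def left_ideal_def rng_m_closed)

text \<open>A left ideal of nilpotent elements satisfies the nil condition; the other inclusion is
  \<open>nil_radical_le_modular_maximal\<close>. The radical thus gets sums from one description and
  right multiples from the other.\<close>

lemma jacobson_eq_nil_radical:
  assumes "\<And>x. x \<in> jacobson_radical R \<Longrightarrow> nilp R x"
  shows "jacobson_radical R = nil_radical R"
proof
  show "jacobson_radical R \<subseteq> nil_radical R"
    using assms jacobson_l by (auto simp: nil_radical_def jacobson_radical_def)
  show "nil_radical R \<subseteq> jacobson_radical R"
    using nil_radical_le_modular_maximal by (auto simp: jacobson_radical_def nil_radical_def)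
qed

text \<open>The powers of \<open>x\<close> repeat, say from exponent \<open>i\<close> on with period
  \<open>d\<close>. The exponent \<open>i d\<close> is at least \<open>i\<close> and a multiple of
  \<open>d\<close>, so doubling it changes nothing.\<close>

lemma finite_idempotent_power:
  assumes "finite (carrier R)" "x \<in> carrier R"
  obtains k where "npow R x k \<otimes> npow R x k = npow R x k"
proof -
  \<comment> \<open>\<open>P n\<close> is the genuine \<open>n\<close>-th power for
    \<open>n \<ge> 1\<close>, so that exponents add.\<close>
  define P where "P n = npow R x (n - 1)" for n
  have P: "P (a + b) = P a \<otimes> P b" if "a \<ge> 1" "b \<ge> 1" for a b
  proof -
    have e: "a + b - 1 = Suc (a - 1 + (b - 1))" using that by simp
    show ?thesis unfolding P_def npow_mult[OF assms(2)] e ..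
  qed
  have "\<exists>i j. 1 \<le> i \<and> i < j \<and> P i = P j"
  proof (rule ccontr)
    assume "\<not> ?thesis"
    then have "P i \<noteq> P j" if "1 \<le> i" "i < j" for i j using that by blast
    then have "inj_on P {1..}" by (intro linorder_inj_onI') simp
    moreover have "P ` {1..} \<subseteq> carrier R" using assms by (auto simp: P_def)
    ultimately have "finite {1::nat..}" using assms(1) by (meson finite_subset inj_on_finite)
    then show False by (simp add: infinite_Ici)
  qed
  then obtain i j where ij: "1 \<le> i" "i < j" "P i = P j" by blast
  define d where "d = j - i"
  have i: "i \<ge> 1" "d \<ge> 1" "P i = P (i + d)" using ij by (simp_all add: d_def)
  have step: "P (m + d) = P m" if "m \<ge> i" for m
  proof (cases "m = i")
    case False
    then have "P (i + d + (m - i)) = P (i + (m - i))"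
      using that i P[of "i + d" "m - i"] P[of i "m - i"] by simp
    moreover have "i + d + (m - i) = m + d" "i + (m - i) = m" using that by simp_all
    ultimately show ?thesis by metis
  qed (use i in simp)
  have steps: "P (m + t * d) = P m" if "m \<ge> i" for m t
  proof (induct t)
    case (Suc t)
    then show ?case using step[of "m + t * d"] that by (simp add: add.assoc add.commute[of d])
  qed simp
  have "P (i * d + i * d) = P (i * d)" using steps[of "i * d" i] i by simp
  then have "P (i * d) \<otimes> P (i * d) = P (i * d)" using P[of "i * d" "i * d"] i by simp
  then show thesis unfolding P_def by (rule that)
qed

lemma nonnil_idempotent:
  assumes "finite (carrier R)" "x \<in> carrier R" "\<not> nilp R x"
  obtains k where "npow R x k \<otimes> npow R x k = npow R x k" "npow R x k \<noteq> \<zero>"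
  using finite_idempotent_power[OF assms(1,2)] assms(3) by (metis nilp_def)

end

section \<open>Orthogonal idempotents and their corners\<close>

definition orth_idempotents :: "('a, 'm) ring_scheme \<Rightarrow> 'a set \<Rightarrow> bool" where
  "orth_idempotents R E \<longleftrightarrow> E \<subseteq> carrier R - {\<zero>\<^bsub>R\<^esub>}
     \<and> (\<forall>e\<in>E. \<forall>f\<in>E. e \<otimes>\<^bsub>R\<^esub> f = (if e = f then e else \<zero>\<^bsub>R\<^esub>))"

context rng
begin

lemma rng_finsum_ldistr:
  "f \<in> A \<rightarrow> carrier R \<Longrightarrow> a \<in> carrier R \<Longrightarrow> finsum R f A \<otimes> a = (\<Oplus>i\<in>A. f i \<otimes> a)"
proof (induct A rule: infinite_finite_induct)
  case (insert x F)
  then show ?case by (simp add: Pi_iff rng_l_distr rng_m_closed)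
qed auto

lemma rng_finsum_rdistr:
  "f \<in> A \<rightarrow> carrier R \<Longrightarrow> a \<in> carrier R \<Longrightarrow> a \<otimes> finsum R f A = (\<Oplus>i\<in>A. a \<otimes> f i)"
proof (induct A rule: infinite_finite_induct)
  case (insert x F)
  then show ?case by (simp add: Pi_iff rng_r_distr rng_m_closed)
qed auto

end

text \<open>The nilpotency assumption is the form in which the nilpotency of \<open>J\<close>
  reaches \<open>R\<close>, through \<open>finite_nil_rngI\<close>.\<close>

locale finite_nil_rng = rng +
  assumes finite_carrier: "finite (carrier R)"
    and jacobson_nilp: "x \<in> jacobson_radical R \<Longrightarrow> nilp R x"
begin

lemma nil_radical_additive_subgroup: "additive_subgroup (nil_radical R) R"
  using jacobson_additive_subgroup jacobson_eq_nil_radical jacobson_nilp by simp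

end

text \<open>Maximality is in cardinality: this forbids both adding an idempotent orthogonal to
  \<open>E\<close> and splitting a member of \<open>E\<close> in two.\<close>

locale maximal_orth_idempotents = finite_nil_rng +
  fixes E
  assumes orth: "orth_idempotents R E"
    and maximal: "\<And>E'. orth_idempotents R E' \<Longrightarrow> card E' \<le> card E"
begin

definition corner :: "'a \<Rightarrow> 'a set" where
  "corner e = {x \<in> carrier R. e \<otimes> x = x \<and> x \<otimes> e = x}"

text \<open>An identity only modulo the radical: \<open>x \<ominus> idsum \<otimes> x\<close> and
  \<open>x \<ominus> x \<otimes> idsum\<close> are annihilated by \<open>E\<close> from one side,
  hence in the radical by \<open>annihilated_l_nil\<close> and
  \<open>annihilated_r_nil\<close>.\<close>

definition idsum :: 'a where
  "idsum = (\<Oplus>e\<in>E. e)"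

lemma E_carrier [simp]: "e \<in> E \<Longrightarrow> e \<in> carrier R"
  using orth by (auto simp: orth_idempotents_def)

lemma E_nonzero: "e \<in> E \<Longrightarrow> e \<noteq> \<zero>"
  using orth by (auto simp: orth_idempotents_def)

lemma E_mult: "e \<in> E \<Longrightarrow> f \<in> E \<Longrightarrow> e \<otimes> f = (if e = f then e else \<zero>)"
  using orth by (auto simp: orth_idempotents_def)

lemma finite_E: "finite E"
  by (rule finite_subset[OF _ finite_carrier]) auto

lemma idempotent_orth_zero:
  assumes f: "f \<in> carrier R" "f \<otimes> f = f" and "\<And>e. e \<in> E \<Longrightarrow> e \<otimes> f = \<zero>" "\<And>e. e \<in> E \<Longrightarrow> f \<otimes> e = \<zero>"
  shows "f = \<zero>"
proof (rule ccontr)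
  assume nz: "f \<noteq> \<zero>"
  then have "f \<notin> E" using assms by auto
  moreover have "orth_idempotents R (insert f E)"
    using assms nz \<open>f \<notin> E\<close> by (auto simp: orth_idempotents_def E_mult dest: E_nonzero)
  ultimately show False using maximal[of "insert f E"] finite_E by simp
qed

text \<open>Otherwise \<open>f\<close> and \<open>e \<ominus> f\<close> could replace
  \<open>e\<close>, giving an orthogonal set with one more element.\<close>

lemma idempotent_corner:
  assumes f: "f \<in> corner e" "f \<otimes> f = f" and e: "e \<in> E"
  shows "f = \<zero> \<or> f = e"
proof (rule ccontr)
  assume "\<not> ?thesis"
  then have nz: "f \<noteq> \<zero>" "f \<noteq> e" by auto
  have fc: "f \<in> carrier R" and ef: "e \<otimes> f = f" "f \<otimes> e = f" using f by (auto simp: corner_def)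
  define g where "g = e \<ominus> f"
  have gc: "g \<in> carrier R" using fc e by (simp add: g_def)
  have ee: "e \<otimes> e = e" using E_mult[OF e e] by simp
  have gm: "g \<otimes> f = \<zero>" "f \<otimes> g = \<zero>" "e \<otimes> g = g" "g \<otimes> e = g" "g \<otimes> g = g"
    using fc e ef f ee by (simp_all add: g_def rng_l_diff rng_r_diff diff_eq_zero)
  have gnz: "g \<noteq> \<zero>" using nz fc e by (simp add: g_def diff_eq_zero)
  have fg: "f \<noteq> g" using gm f nz by auto
  have o: "h \<otimes> x = \<zero>" "x \<otimes> h = \<zero>"
    if "x \<in> carrier R" "e \<otimes> x = x" "x \<otimes> e = x" "h \<in> E" "h \<noteq> e" for h x
  proof -
    show "h \<otimes> x = \<zero>" using that e E_mult[of h e] rng_m_assoc[of h e x] by simp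
    show "x \<otimes> h = \<zero>" using that e E_mult[of e h] rng_m_assoc[of x e h] by simp
  qed
  let ?E = "insert f (insert g (E - {e}))"
  have notin: "x \<notin> E - {e}" if "e \<otimes> x = x" "x \<noteq> \<zero>" for x
  proof
    assume "x \<in> E - {e}"
    then have "e \<otimes> x = \<zero>" using E_mult[OF e, of x] by auto
    then show False using that by simp
  qed
  note notin = notin[OF ef(1) nz(1)] notin[OF gm(3) gnz]
  note of = o[OF fc ef] and og = o[OF gc gm(3,4)]
  have "u \<otimes> v = (if u = v then u else \<zero>)" if uv: "u \<in> ?E" "v \<in> ?E" for u v
  proof -
    have ne: "f \<noteq> h" "g \<noteq> h" if "h \<in> E" "h \<noteq> e" for h using that notin by auto
    consider "u = f" | "u = g" | "u \<in> E" "u \<noteq> e" using uv by blast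
    then show ?thesis
    proof cases
      case 1
      consider "v = f" | "v = g" | "v \<in> E" "v \<noteq> e" using uv by blast
      then show ?thesis
      proof cases
        case 3
        then show ?thesis unfolding 1 using of(2)[OF 3] ne(1)[OF 3] by simp
      qed (use 1 f(2) gm(2) fg in simp_all)
    next
      case 2
      consider "v = f" | "v = g" | "v \<in> E" "v \<noteq> e" using uv by blast
      then show ?thesis
      proof cases
        case 3
        then show ?thesis unfolding 2 using og(2)[OF 3] ne(2)[OF 3] by simp
      qed (use 2 gm(1,5) fg in simp_all)
    next
      case 3
      consider "v = f" | "v = g" | "v \<in> E" "v \<noteq> e" using uv by blast
      then show ?thesis
      proof cases
        case 1
        then show ?thesis using of(1)[OF 3] ne(1)[OF 3] by simp
      next
        case 2
        then show ?thesis using og(1)[OF 3] ne(2)[OF 3] by simp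
      qed (use 3 E_mult in simp)
    qed
  qed
  moreover have "?E \<subseteq> carrier R - {\<zero>}"
    using fc gc nz gnz orth by (auto simp: orth_idempotents_def)
  ultimately have "orth_idempotents R ?E" by (simp add: orth_idempotents_def)
  then have "card ?E \<le> card E" by (rule maximal)
  moreover have "f \<notin> insert g (E - {e})" using fg notin by blast
  then have "card ?E = Suc (Suc (card (E - {e})))"
    using notin finite_E by (simp only: card_insert_disjoint finite_insert finite_Diff simp_thms)
  moreover have "card E = Suc (card (E - {e}))" by (rule card.remove[OF finite_E e])
  ultimately show False by simp
qed

text \<open>Some power of \<open>x\<close> is a nonzero idempotent of the corner, hence equal to
  \<open>e\<close>. Splitting one factor \<open>x\<close> off its square leaves the inverse.\<close>

lemma corner_unit:
  assumes e: "e \<in> E" and x: "x \<in> corner e" "\<not> nilp R x"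
  shows "\<exists>y\<in>corner e. y \<otimes> x = e"
proof -
  have xc: "x \<in> carrier R" "e \<otimes> x = x" "x \<otimes> e = x" using x by (auto simp: corner_def)
  have pc: "npow R x k \<in> corner e" for k
    using xc e by (simp add: corner_def npow_l npow_r)
  obtain k where k: "npow R x k \<otimes> npow R x k = npow R x k" "npow R x k \<noteq> \<zero>"
    using nonnil_idempotent[OF finite_carrier xc(1) x(2)] .
  then have "npow R x k = e" using idempotent_corner[OF pc _ e] by blast
  then have "npow R x (Suc (k + k)) = e" using npow_mult[OF xc(1), of k k] k by simp
  then show ?thesis using pc[of "k + k"] by auto
qed

text \<open>If \<open>r x\<close> is not nilpotent, neither is the corner element
  \<open>e r x\<close>, since \<open>nilp_swap\<close> moves \<open>e\<close> to the right, where
  \<open>x\<close> absorbs it; \<open>corner_unit\<close> then applies. Here \<open>x\<close> may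
  lie in any \<open>f R e\<close>, not only in the corner.\<close>

lemma left_inverse:
  assumes e: "e \<in> E" and x: "x \<in> carrier R" "x \<otimes> e = x" "x \<notin> nil_radical R"
  shows "\<exists>y\<in>carrier R. y \<otimes> x = e \<and> e \<otimes> y = y"
proof -
  obtain r where r: "r \<in> carrier R" "\<not> nilp R (r \<otimes> x)" using x by (auto simp: nil_radical_def)
  have ec: "e \<in> carrier R" and ee: "e \<otimes> e = e" using e E_mult by auto
  let ?w = "e \<otimes> (r \<otimes> x)"
  have wc: "?w \<in> corner e"
    using ec ee r x rng_m_closed by (simp add: corner_def rng_m_assoc[symmetric])
      (simp add: rng_m_assoc rng_m_closed)
  have "\<not> nilp R ?w"
  proof
    assume "nilp R ?w"
    then have "nilp R ((r \<otimes> x) \<otimes> e)" using nilp_swap ec r x rng_m_closed by simp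
    then show False using r x ec by (simp add: rng_m_assoc)
  qed
  then obtain z where z: "z \<in> corner e" "z \<otimes> ?w = e" using corner_unit[OF e wc] by blast
  have zc: "z \<in> carrier R" "e \<otimes> z = z" "z \<otimes> e = z" using z by (auto simp: corner_def)
  have "z \<otimes> ?w = (z \<otimes> e) \<otimes> r \<otimes> x" using rng_m_assoc[of z e "r \<otimes> x"] rng_m_assoc[of z r x] zc ec r x rng_m_closed by simp
  then have "(z \<otimes> r) \<otimes> x = e" using zc z by simp
  moreover have "e \<otimes> (z \<otimes> r) = z \<otimes> r" using zc ec r by (simp add: rng_m_assoc[symmetric])
  ultimately show ?thesis using zc r rng_m_closed by blast
qed

section \<open>The part of the ring annihilated by all idempotents\<close>

lemma idsum_closed [simp]: "idsum \<in> carrier R"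
  unfolding idsum_def by (rule finsum_closed) auto

lemma E_idsum: "e \<in> E \<Longrightarrow> e \<otimes> idsum = e" "e \<in> E \<Longrightarrow> idsum \<otimes> e = e"
proof -
  assume e: "e \<in> E"
  have "e \<otimes> idsum = (\<Oplus>f\<in>E. e \<otimes> f)" unfolding idsum_def using e by (intro rng_finsum_rdistr) auto
  also have "\<dots> = (\<Oplus>f\<in>E. if e = f then f else \<zero>)" using e by (intro finsum_cong') (auto simp: E_mult)
  also have "\<dots> = e" using finite_E e by (intro finsum_singleton) auto
  finally show "e \<otimes> idsum = e" .
  have "idsum \<otimes> e = (\<Oplus>f\<in>E. f \<otimes> e)" unfolding idsum_def using e by (intro rng_finsum_ldistr) auto
  also have "\<dots> = (\<Oplus>f\<in>E. if e = f then f else \<zero>)" using e by (intro finsum_cong') (auto simp: E_mult)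
  also have "\<dots> = e" using finite_E e by (intro finsum_singleton) auto
  finally show "idsum \<otimes> e = e" .
qed

lemma idsum_null_l:
  assumes "x \<in> carrier R" "\<And>e. e \<in> E \<Longrightarrow> e \<otimes> x = \<zero>"
  shows "idsum \<otimes> x = \<zero>"
proof -
  have "idsum \<otimes> x = (\<Oplus>f\<in>E. f \<otimes> x)" unfolding idsum_def using assms by (intro rng_finsum_ldistr) auto
  also have "\<dots> = (\<Oplus>f\<in>E. \<zero>)" using assms by (intro finsum_cong') auto
  finally show ?thesis by simp
qed

lemma idsum_null_r:
  assumes "x \<in> carrier R" "\<And>e. e \<in> E \<Longrightarrow> x \<otimes> e = \<zero>"
  shows "x \<otimes> idsum = \<zero>"
proof -
  have "x \<otimes> idsum = (\<Oplus>f\<in>E. x \<otimes> f)" unfolding idsum_def using assms by (intro rng_finsum_rdistr) auto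
  also have "\<dots> = (\<Oplus>f\<in>E. \<zero>)" using assms by (intro finsum_cong') auto
  finally show ?thesis by simp
qed

text \<open>Were \<open>x r\<close> not nilpotent, one of its powers \<open>f\<close> would be a
  nonzero idempotent annihilated by \<open>E\<close> on the left. Correcting it on the right gives
  \<open>g\<close>, orthogonal to \<open>E\<close> on both sides and so zero. Then
  \<open>f = f idsum\<close>, whence \<open>f = f (idsum f) = \<zero>\<close>.\<close>

lemma annihilated_l_nil:
  assumes x: "x \<in> carrier R" and ex: "\<And>e. e \<in> E \<Longrightarrow> e \<otimes> x = \<zero>"
  shows "x \<in> nil_radical R"
proof (rule ccontr)
  assume "x \<notin> nil_radical R"
  then obtain r where r: "r \<in> carrier R" "\<not> nilp R (x \<otimes> r)" using x by (auto simp: nil_radical_iff)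
  have xr: "x \<otimes> r \<in> carrier R" using x r rng_m_closed by simp
  have exr: "e \<otimes> (x \<otimes> r) = \<zero>" if "e \<in> E" for e
    using that ex x r by (simp add: rng_m_assoc[symmetric])
  obtain k where k: "npow R (x \<otimes> r) k \<otimes> npow R (x \<otimes> r) k = npow R (x \<otimes> r) k"
    "npow R (x \<otimes> r) k \<noteq> \<zero>"
    using nonnil_idempotent[OF finite_carrier xr r(2)] .
  define f where "f = npow R (x \<otimes> r) k"
  have f: "f \<in> carrier R" "f \<otimes> f = f" "f \<noteq> \<zero>" using k xr by (simp_all add: f_def)
  have ef: "e \<otimes> f = \<zero>" if "e \<in> E" for e unfolding f_def using that exr xr by (intro npow_l0) auto
  have sf: "idsum \<otimes> f = \<zero>" using f ef by (intro idsum_null_l) auto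
  define g where "g = f \<ominus> f \<otimes> idsum"
  have fs: "f \<otimes> idsum \<in> carrier R" using f rng_m_closed by simp
  have "g = \<zero>"
  proof (rule idempotent_orth_zero)
    show "g \<in> carrier R" using f fs by (simp add: g_def)
    show "g \<otimes> e = \<zero>" if "e \<in> E" for e
      using f fs that E_idsum rng_m_closed by (simp add: g_def rng_l_diff rng_m_assoc)
    show "e \<otimes> g = \<zero>" if "e \<in> E" for e
      using f fs that ef by (simp add: g_def rng_r_diff rng_m_assoc[symmetric])
    have "f \<otimes> g = g" using f fs by (simp add: g_def rng_r_diff rng_m_assoc[symmetric])
    moreover have "idsum \<otimes> g = \<zero>" using f fs sf by (simp add: g_def rng_r_diff rng_m_assoc[symmetric])
    moreover have "g \<otimes> g = f \<otimes> g \<ominus> f \<otimes> (idsum \<otimes> g)"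
      using f fs unfolding g_def by (simp add: rng_l_diff rng_m_assoc)
    ultimately show "g \<otimes> g = g" using f fs by (simp add: g_def)
  qed
  then have "f = f \<otimes> idsum" using f fs by (simp add: g_def diff_eq_zero)
  then have "f \<otimes> f = f \<otimes> (idsum \<otimes> f)" using f by (metis idsum_closed rng_m_assoc)
  then show False using f sf by simp
qed

text \<open>The mirror image of \<open>annihilated_l_nil\<close>, with \<open>r x\<close> for
  \<open>x r\<close> and the correction on the left.\<close>

lemma annihilated_r_nil:
  assumes x: "x \<in> carrier R" and xe: "\<And>e. e \<in> E \<Longrightarrow> x \<otimes> e = \<zero>"
  shows "x \<in> nil_radical R"
proof (rule ccontr)
  assume "x \<notin> nil_radical R"
  then obtain r where r: "r \<in> carrier R" "\<not> nilp R (r \<otimes> x)" using x by (auto simp: nil_radical_def)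
  have rx: "r \<otimes> x \<in> carrier R" using x r rng_m_closed by simp
  have rxe: "(r \<otimes> x) \<otimes> e = \<zero>" if "e \<in> E" for e
    using that xe x r by (simp add: rng_m_assoc)
  obtain k where k: "npow R (r \<otimes> x) k \<otimes> npow R (r \<otimes> x) k = npow R (r \<otimes> x) k"
    "npow R (r \<otimes> x) k \<noteq> \<zero>"
    using nonnil_idempotent[OF finite_carrier rx r(2)] .
  define f where "f = npow R (r \<otimes> x) k"
  have f: "f \<in> carrier R" "f \<otimes> f = f" "f \<noteq> \<zero>" using k rx by (simp_all add: f_def)
  have fe: "f \<otimes> e = \<zero>" if "e \<in> E" for e unfolding f_def using that rxe rx by (intro npow_r0) auto
  have fs: "f \<otimes> idsum = \<zero>" using f fe by (intro idsum_null_r) auto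
  define g where "g = f \<ominus> idsum \<otimes> f"
  have sf: "idsum \<otimes> f \<in> carrier R" using f rng_m_closed by simp
  have "g = \<zero>"
  proof (rule idempotent_orth_zero)
    show "g \<in> carrier R" using f sf by (simp add: g_def)
    show "g \<otimes> e = \<zero>" if "e \<in> E" for e
      using f sf that fe by (simp add: g_def rng_l_diff rng_m_assoc)
    show "e \<otimes> g = \<zero>" if "e \<in> E" for e
      using f sf that E_idsum rng_m_closed by (simp add: g_def rng_r_diff rng_m_assoc[symmetric])
    have "g \<otimes> f = g" using f sf by (simp add: g_def rng_l_diff rng_m_assoc)
    moreover have "g \<otimes> idsum = \<zero>" using f sf fs by (simp add: g_def rng_l_diff rng_m_assoc)
    moreover have "g \<otimes> g = g \<otimes> f \<ominus> (g \<otimes> idsum) \<otimes> f"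
      using f sf unfolding g_def by (simp add: rng_r_diff rng_m_assoc)
    ultimately show "g \<otimes> g = g" using f sf by (simp add: g_def)
  qed
  then have "f = idsum \<otimes> f" using f sf by (simp add: g_def diff_eq_zero)
  then have "f \<otimes> f = (f \<otimes> idsum) \<otimes> f" using f by (metis idsum_closed rng_m_assoc)
  then show False using f fs by simp
qed

section \<open>The residue division ring of a corner\<close>

abbreviation corner_ring :: "'a \<Rightarrow> 'a ring" where
  "corner_ring e \<equiv> \<lparr>carrier = corner e, monoid.mult = monoid.mult R, one = e, zero = \<zero>, add = add R\<rparr>"

lemma corner_carrier: "x \<in> corner e \<Longrightarrow> x \<in> carrier R"
  by (simp add: corner_def)

lemma ring_corner_ring:
  assumes e: "e \<in> E"
  shows "ring (corner_ring e)"
proof (rule ringI)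
  have ee: "e \<otimes> e = e" using E_mult[OF e e] by simp
  show "abelian_group (corner_ring e)"
  proof (rule abelian_groupI)
    fix x assume x: "x \<in> carrier (corner_ring e)"
    then have "\<ominus> x \<in> corner e" "\<ominus> x \<oplus> x = \<zero>"
      using e by (auto simp: corner_def rng_l_minus rng_r_minus l_neg)
    then show "\<exists>y\<in>carrier (corner_ring e). y \<oplus>\<^bsub>corner_ring e\<^esub> x = \<zero>\<^bsub>corner_ring e\<^esub>" by auto
  qed (use e in \<open>auto simp: corner_def rng_l_distr rng_r_distr a_ac\<close>)
  show "Group.monoid (corner_ring e)"
  proof (rule monoidI)
    fix x y assume xy: "x \<in> carrier (corner_ring e)" "y \<in> carrier (corner_ring e)"
    then have c: "x \<in> carrier R" "y \<in> carrier R" "e \<otimes> x = x" "y \<otimes> e = y" by (auto simp: corner_def)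
    show "x \<otimes>\<^bsub>corner_ring e\<^esub> y \<in> carrier (corner_ring e)"
      using rng_m_assoc[of e x y] rng_m_assoc[of x y e] c e rng_m_closed by (simp add: corner_def)
  qed (use e ee in \<open>auto simp: corner_def rng_m_assoc\<close>)
qed (auto simp: corner_def rng_l_distr rng_r_distr)

text \<open>Modulo its part of the radical the corner is a finite division ring, hence generated by
  two elements. Lifts of these suffice because the error of lifting lies in the radical, which
  \<open>T\<close> contains.\<close>

lemma corner_two_generated:
  assumes e: "e \<in> E"
  shows "\<exists>a\<in>corner e. \<exists>b\<in>corner e. \<forall>T. subrng T R \<and> a \<in> T \<and> b \<in> T \<and> nil_radical R \<subseteq> T
    \<longrightarrow> corner e \<subseteq> T"
proof -
  let ?S = "corner_ring e" and ?N = "nil_radical R"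
  interpret S: ring ?S using ring_corner_ring[OF e] .
  interpret N: additive_subgroup ?N R by (rule nil_radical_additive_subgroup)
  have ec: "e \<in> carrier R" and ee: "e \<otimes> e = e" using e E_mult by auto
  have minus: "x \<ominus>\<^bsub>?S\<^esub> y = x \<ominus> y" if "x \<in> corner e" "y \<in> corner e" for x y
  proof -
    have "\<ominus>\<^bsub>?S\<^esub> y = \<ominus> y"
      using that e S.minus_equality[of "\<ominus> y" y]
      by (auto simp: corner_def rng_l_minus rng_r_minus l_neg)
    then show ?thesis by (simp add: a_minus_def)
  qed
  define I where "I = ?N \<inter> corner e"
  have "ideal I ?S"
  proof (rule idealI)
    show "ring ?S" ..
    have "additive_subgroup I ?S"
    proof (rule S.additive_subgroupI')
      show "I \<subseteq> carrier ?S" "\<zero>\<^bsub>?S\<^esub> \<in> I"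
        using N.zero_closed S.zero_closed by (auto simp: I_def)
      show "x \<ominus>\<^bsub>?S\<^esub> y \<in> I" if "x \<in> I" "y \<in> I" for x y
        using that minus S.minus_closed[of x y] additive_subgroup_minus[OF N.is_additive_subgroup]
        by (auto simp: I_def)
    qed
    then show "subgroup I (add_monoid ?S)" by (rule additive_subgroup.a_subgroup)
    show "x \<otimes>\<^bsub>?S\<^esub> a \<in> I" "a \<otimes>\<^bsub>?S\<^esub> x \<in> I" if "a \<in> I" "x \<in> carrier ?S" for a x
      using that S.m_closed[of x a] S.m_closed[of a x] nil_radical_l nil_radical_r corner_carrier
      by (auto simp: I_def)
  qed
  then interpret I: ideal I ?S .
  define D where "D = ?S Quot I"
  let ?q = "\<lambda>x. I +>\<^bsub>?S\<^esub> x"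
  interpret D: ring D unfolding D_def by (rule I.quotient_is_ring)
  interpret q: ring_hom_ring ?S D ?q unfolding D_def by (rule I.rcos_ring_hom_ring)
  have Dc: "carrier D = ?q ` corner e"
    by (auto simp: D_def FactRing_def A_RCOSETS_def' image_def)
  have qeq: "?q x = ?q y \<longleftrightarrow> x \<ominus> y \<in> I" if "x \<in> corner e" "y \<in> corner e" for x y
    using S.quotient_eq_iff_same_a_r_cos[OF I.is_ideal, of x y] that minus by simp
  have qz: "?q x = \<zero>\<^bsub>D\<^esub> \<longleftrightarrow> x \<in> I" if "x \<in> corner e" for x
    using qeq[OF that, of \<zero>] S.zero_closed q.hom_zero that corner_carrier by simp
  have enI: "e \<notin> ?N"
  proof
    assume "e \<in> ?N"
    then obtain k where "npow R e k = \<zero>" using nil_radical_nilp nilp_def by metis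
    moreover have "npow R e k = e" by (induct k) (auto simp: ee)
    ultimately show False using E_nonzero[OF e] by simp
  qed
  \<comment> \<open>The inverse is again outside \<open>I\<close>, so it has a left inverse of its
    own; comparing the two makes inverses two-sided.\<close>
  have linv: "\<exists>y\<in>corner e. y \<otimes> x = e \<and> y \<notin> I" if "x \<in> corner e" "x \<notin> I" for x
  proof -
    have x: "x \<in> carrier R" "e \<otimes> x = x" "x \<otimes> e = x" "x \<notin> ?N" using that by (auto simp: corner_def I_def)
    then obtain y where y: "y \<in> carrier R" "y \<otimes> x = e" "e \<otimes> y = y" using left_inverse[OF e] by blast
    have "y \<otimes> e \<in> corner e" using y ec ee rng_m_closed
      by (simp add: corner_def rng_m_assoc) (simp add: rng_m_assoc[symmetric])
    moreover have 1: "(y \<otimes> e) \<otimes> x = e" using y ec x rng_m_assoc[of y e x] by simp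
    moreover have "y \<otimes> e \<notin> I" using nil_radical_r[of "y \<otimes> e" x] 1 x enI by (auto simp: I_def)
    ultimately show ?thesis by blast
  qed
  have units: "Units D = carrier D - {\<zero>\<^bsub>D\<^esub>}"
  proof
    have one: "\<one>\<^bsub>D\<^esub> \<noteq> \<zero>\<^bsub>D\<^esub>"
      using qz[of e] q.hom_one enI S.one_closed by (simp add: I_def)
    have "\<zero>\<^bsub>D\<^esub> \<notin> Units D"
      using one D.Units_r_inv[of "\<zero>\<^bsub>D\<^esub>"] D.l_null[OF D.Units_inv_closed[of "\<zero>\<^bsub>D\<^esub>"]] by metis
    then show "Units D \<subseteq> carrier D - {\<zero>\<^bsub>D\<^esub>}"
      using D.Units_closed by blast
    show "carrier D - {\<zero>\<^bsub>D\<^esub>} \<subseteq> Units D"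
    proof
      fix X assume X: "X \<in> carrier D - {\<zero>\<^bsub>D\<^esub>}"
      then have "X \<in> ?q ` corner e" using Dc by blast
      then obtain x where x0: "X = ?q x" "x \<in> corner e" by (rule imageE)
      then have x: "x \<in> corner e" "X = ?q x" "x \<notin> I" using X qz[OF x0(2)] by simp_all
      obtain y where y: "y \<in> corner e" "y \<otimes> x = e" "y \<notin> I" using linv x by blast
      obtain z where z: "z \<in> corner e" "z \<otimes> y = e" using linv y by blast
      have "z = z \<otimes> (y \<otimes> x)" using y z by (simp add: corner_def)
      also have "\<dots> = (z \<otimes> y) \<otimes> x" using rng_m_assoc[of z y x] x y z corner_carrier by simp
      also have "\<dots> = x" using x z by (simp add: corner_def)
      finally have xy: "x \<otimes> y = e" using z by simp
      have yD: "?q y \<in> carrier D" using y Dc by blast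
      have "?q y \<otimes>\<^bsub>D\<^esub> X = \<one>\<^bsub>D\<^esub>" "X \<otimes>\<^bsub>D\<^esub> ?q y = \<one>\<^bsub>D\<^esub>"
        using q.hom_mult[of y x] q.hom_mult[of x y] q.hom_one x y xy by simp_all
      then show "X \<in> Units D" using X yD unfolding Units_def by blast
    qed
  qed
  have "finite (corner e)" using finite_subset[OF _ finite_carrier] corner_carrier by blast
  then have "finite (carrier D)" unfolding Dc by (rule finite_imageI)
  then have div: "finite_division_ring D"
    using units D.ring_axioms by (simp only: finite_division_ring_def finite_division_ring_axioms_def)
  obtain A B where AB: "A \<in> carrier D" "B \<in> carrier D"
    and gen: "\<forall>T. subrng T D \<and> A \<in> T \<and> B \<in> T \<longrightarrow> carrier D \<subseteq> T"
    using finite_division_ring.two_generated[OF div] by (elim bexE)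
  obtain a b where ab: "a \<in> corner e" "A = ?q a" "b \<in> corner e" "B = ?q b" using AB unfolding Dc by (elim imageE)
  have "corner e \<subseteq> T" if T: "subrng T R" "a \<in> T" "b \<in> T" "?N \<subseteq> T" for T
  proof
    fix x assume x: "x \<in> corner e"
    have addT: "additive_subgroup T R" and mT: "\<And>u v. u \<in> T \<Longrightarrow> v \<in> T \<Longrightarrow> u \<otimes> v \<in> T"
      using T by (auto simp: subrng_def)
    interpret T: additive_subgroup T R by fact
    let ?T = "?q ` (T \<inter> corner e)"
    have "additive_subgroup ?T D"
    proof (rule D.additive_subgroupI')
      show "?T \<subseteq> carrier D" using Dc by auto
      have "\<zero>\<^bsub>D\<^esub> = ?q \<zero>" using q.hom_zero by simp
      moreover have "\<zero> \<in> T \<inter> corner e" using T.zero_closed S.zero_closed by simp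
      ultimately show "\<zero>\<^bsub>D\<^esub> \<in> ?T" by blast
      fix X Y assume "X \<in> ?T" "Y \<in> ?T"
      then obtain u v where uv: "u \<in> T" "u \<in> corner e" "X = ?q u" "v \<in> T" "v \<in> corner e" "Y = ?q v"
        by (elim imageE IntE)
      then have "X \<ominus>\<^bsub>D\<^esub> Y = ?q (u \<ominus> v)"
        using minus[of u v] q.hom_a_inv[of v] q.hom_add[of u "\<ominus>\<^bsub>?S\<^esub> v"] S.a_inv_closed[of v]
        by (simp add: a_minus_def)
      moreover have "u \<ominus> v \<in> T \<inter> corner e"
        using uv additive_subgroup_minus[OF addT] S.minus_closed[of u v] minus[of u v] by simp
      ultimately show "X \<ominus>\<^bsub>D\<^esub> Y \<in> ?T" by blast
    qed
    moreover have "X \<otimes>\<^bsub>D\<^esub> Y \<in> ?T" if XY: "X \<in> ?T" "Y \<in> ?T" for X Y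
    proof -
      obtain u v where uv: "u \<in> T" "u \<in> corner e" "X = ?q u" "v \<in> T" "v \<in> corner e" "Y = ?q v"
        using XY by (elim imageE IntE)
      then have "X \<otimes>\<^bsub>D\<^esub> Y = ?q (u \<otimes> v)" using q.hom_mult[of u v] by simp
      moreover have "u \<otimes> v \<in> T \<inter> corner e" using uv mT S.m_closed[of u v] by simp
      ultimately show ?thesis by blast
    qed
    ultimately have "subrng ?T D" unfolding subrng_def by blast
    moreover have "A \<in> ?T" "B \<in> ?T" using ab T by simp_all
    ultimately have "carrier D \<subseteq> ?T" using gen by simp
    moreover have "?q x \<in> carrier D" using x Dc by blast
    ultimately have "?q x \<in> ?T" by blast
    then obtain t where t: "?q x = ?q t" "t \<in> T" "t \<in> corner e" by (elim imageE IntE)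
    then have "x \<ominus> t \<in> I" using qeq[OF x t(3)] by simp
    then have "x \<ominus> t \<in> T" using T(4) by (auto simp: I_def)
    then have "(x \<ominus> t) \<oplus> t \<in> T" using t T.a_closed by blast
    then show "x \<in> T" using x t corner_carrier by (simp add: diff_add_cancel)
  qed
  then show ?thesis using ab by blast
qed

end

section \<open>Generation modulo the radical\<close>

text \<open>For a set \<open>E\<close> of nonzero idempotents, the label \<open>\<zero>\<close>
  means that all of \<open>E\<close> annihilates \<open>x\<close>. It stands for the components of
  \<open>1 - idsum\<close>, so that no identity has to be adjoined.\<close>

definition homogeneous :: "('a, 'm) ring_scheme \<Rightarrow> 'a set \<Rightarrow> 'a set" where
  "homogeneous R E = {x \<in> carrier R.
     (\<exists>f\<in>insert \<zero>\<^bsub>R\<^esub> E. \<forall>e\<in>E. e \<otimes>\<^bsub>R\<^esub> x = (if e = f then x else \<zero>\<^bsub>R\<^esub>)) \<and>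
     (\<exists>f\<in>insert \<zero>\<^bsub>R\<^esub> E. \<forall>e\<in>E. x \<otimes>\<^bsub>R\<^esub> e = (if e = f then x else \<zero>\<^bsub>R\<^esub>))}"

context maximal_orth_idempotents
begin

lemma idsum_mult_l: "x \<in> carrier R \<Longrightarrow> idsum \<otimes> x = (\<Oplus>e\<in>E. e \<otimes> x)"
  unfolding idsum_def by (intro rng_finsum_ldistr) auto

lemma idsum_mult_r: "x \<in> carrier R \<Longrightarrow> x \<otimes> idsum = (\<Oplus>e\<in>E. x \<otimes> e)"
  unfolding idsum_def by (intro rng_finsum_rdistr) auto

lemma E_assoc_l: "e \<in> E \<Longrightarrow> f \<in> E \<Longrightarrow> x \<in> carrier R \<Longrightarrow> e \<otimes> (f \<otimes> x) = (if e = f then f \<otimes> x else \<zero>)"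
  using rng_m_assoc[of e f x] E_mult[of e f] by (cases "e = f") simp_all

lemma E_assoc_r: "e \<in> E \<Longrightarrow> f \<in> E \<Longrightarrow> x \<in> carrier R \<Longrightarrow> (x \<otimes> f) \<otimes> e = (if e = f then x \<otimes> f else \<zero>)"
  using rng_m_assoc[of x f e] E_mult[of f e] by (cases "e = f") simp_all

lemma peirce_remainder_l:
  assumes "x \<in> carrier R" "e \<in> E"
  shows "e \<otimes> (x \<ominus> idsum \<otimes> x) = \<zero>"
  using assms E_idsum(1)[of e] rng_m_assoc[of e idsum x] rng_m_closed by (simp add: rng_r_diff)

lemma peirce_remainder_r:
  assumes "x \<in> carrier R" "e \<in> E"
  shows "(x \<ominus> x \<otimes> idsum) \<otimes> e = \<zero>"
  using assms E_idsum(2)[of e] rng_m_assoc[of x idsum e] rng_m_closed by (simp add: rng_l_diff)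

text \<open>Splitting \<open>x\<close> into \<open>x - idsum x\<close> and the elements
  \<open>e x\<close>, and each piece likewise on the right, stays inside \<open>B\<close>. With
  \<open>B\<close> the ring or its radical, additive generators can be chosen homogeneous.\<close>

lemma homogeneous_spans:
  assumes B: "additive_subgroup B R" "\<And>e x. e \<in> E \<Longrightarrow> x \<in> B \<Longrightarrow> e \<otimes> x \<in> B \<and> x \<otimes> e \<in> B"
    and K: "additive_subgroup K R" "B \<inter> homogeneous R E \<subseteq> K"
  shows "B \<subseteq> K"
proof
  interpret B: additive_subgroup B R by fact
  interpret K: additive_subgroup K R by fact
  let ?hl = "\<lambda>f x. \<forall>e\<in>E. e \<otimes> x = (if e = f then x else \<zero>)"
  let ?hr = "\<lambda>f x. \<forall>e\<in>E. x \<otimes> e = (if e = f then x else \<zero>)"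
  have hom: "y \<in> K" if y: "y \<in> B" and f: "f \<in> insert \<zero> E" "?hl f y" for f y
  proof -
    have yc: "y \<in> carrier R" using y by simp
    have closed: "z \<in> K" if "z \<in> B" "?hl f z" "g \<in> insert \<zero> E" "?hr g z" for g z
    proof -
      have "z \<in> homogeneous R E"
        unfolding homogeneous_def using that f(1) B.a_Hcarr[OF that(1)] by blast
      then show ?thesis using K(2) that by blast
    qed
    have ye: "y \<otimes> e \<in> K" if "e \<in> E" for e
    proof (rule closed)
      show "y \<otimes> e \<in> B" using B(2) y that by blast
      show "?hl f (y \<otimes> e)" using f yc that by (auto simp: rng_m_assoc[symmetric])
      show "?hr e (y \<otimes> e)" using yc that by (simp add: E_assoc_r)
    qed (use that in simp)
    have "(\<Oplus>e\<in>E. y \<otimes> e) \<in> B" using B y by (intro additive_subgroup_finsum) auto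
    then have sB: "y \<otimes> idsum \<in> B" using yc by (simp add: idsum_mult_r)
    have "y \<ominus> y \<otimes> idsum \<in> K"
    proof (rule closed)
      show "y \<ominus> y \<otimes> idsum \<in> B" using y sB B(1) additive_subgroup_minus by blast
      show "?hl f (y \<ominus> y \<otimes> idsum)"
        using f yc by (auto simp: rng_r_diff rng_m_closed rng_m_assoc[symmetric])
      show "?hr \<zero> (y \<ominus> y \<otimes> idsum)"
        using peirce_remainder_r[OF yc] E_nonzero by auto
    qed simp
    moreover have "y \<otimes> idsum \<in> K"
      using ye yc K(1) by (simp add: idsum_mult_r) (intro additive_subgroup_finsum, auto)
    ultimately have "(y \<ominus> y \<otimes> idsum) \<oplus> y \<otimes> idsum \<in> K" by (rule K.a_closed)
    then show ?thesis using yc by (simp add: diff_add_cancel rng_m_closed)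
  qed
  fix x assume x: "x \<in> B"
  then have xc: "x \<in> carrier R" by simp
  have ex: "e \<otimes> x \<in> K" if "e \<in> E" for e
  proof (rule hom)
    show "?hl e (e \<otimes> x)" using that xc by (simp add: E_assoc_l)
  qed (use that x B(2) in auto)
  have "(\<Oplus>e\<in>E. e \<otimes> x) \<in> B" using B x by (intro additive_subgroup_finsum) auto
  then have sB: "idsum \<otimes> x \<in> B" using xc by (simp add: idsum_mult_l)
  have "x \<ominus> idsum \<otimes> x \<in> K"
  proof (rule hom)
    show "x \<ominus> idsum \<otimes> x \<in> B" using x sB B(1) additive_subgroup_minus by blast
    show "?hl \<zero> (x \<ominus> idsum \<otimes> x)"
      using peirce_remainder_l[OF xc] E_nonzero by auto
  qed simp
  moreover have "idsum \<otimes> x \<in> K"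
    using ex xc K(1) by (simp add: idsum_mult_l) (intro additive_subgroup_finsum, auto)
  ultimately have "(x \<ominus> idsum \<otimes> x) \<oplus> idsum \<otimes> x \<in> K" by (rule K.a_closed)
  then show "x \<in> K" using xc by (simp add: diff_add_cancel rng_m_closed)
qed

text \<open>Orthogonality kills all other terms. One element can thus store an independent entry for
  each pair of idempotents, recoverable in any subring that also contains \<open>E\<close>.\<close>

lemma peirce_component_sum:
  assumes t: "\<And>g h. g \<in> E \<Longrightarrow> h \<in> E \<Longrightarrow> t g h \<in> carrier R \<and> g \<otimes> t g h = t g h \<and> t g h \<otimes> h = t g h"
    and e: "e \<in> E" and f: "f \<in> E"
  shows "e \<otimes> (\<Oplus>g\<in>E. \<Oplus>h\<in>E. t g h) \<otimes> f = t e f"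
proof -
  define s where "s g = (\<Oplus>h\<in>E. t g h)" for g
  have sc: "s g \<in> carrier R" if "g \<in> E" for g
    unfolding s_def using t that by (intro finsum_closed) auto
  have gs: "g \<otimes> s g = s g" if "g \<in> E" for g
  proof -
    have "g \<otimes> s g = (\<Oplus>h\<in>E. g \<otimes> t g h)" unfolding s_def using t that by (intro rng_finsum_rdistr) auto
    also have "\<dots> = s g" unfolding s_def using t that by (intro finsum_cong') auto
    finally show ?thesis .
  qed
  have "e \<otimes> (\<Oplus>g\<in>E. s g) = (\<Oplus>g\<in>E. e \<otimes> s g)" using sc e by (intro rng_finsum_rdistr) auto
  also have "\<dots> = (\<Oplus>g\<in>E. if e = g then s g else \<zero>)"
  proof (intro finsum_cong')
    fix g assume "g \<in> E"
    then show "e \<otimes> s g = (if e = g then s g else \<zero>)" using E_assoc_l[OF e, of g "s g"] gs sc by simp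
  qed (use sc in auto)
  also have "\<dots> = s e" using finite_E e sc by (intro finsum_singleton) auto
  finally have 1: "e \<otimes> (\<Oplus>g\<in>E. s g) = s e" .
  have "s e \<otimes> f = (\<Oplus>h\<in>E. t e h \<otimes> f)" unfolding s_def using t e f by (intro rng_finsum_ldistr) auto
  also have "\<dots> = (\<Oplus>h\<in>E. if f = h then t e h else \<zero>)"
  proof (intro finsum_cong')
    fix h assume "h \<in> E"
    then show "t e h \<otimes> f = (if f = h then t e h else \<zero>)"
      using E_assoc_r[OF f, of h "t e h"] t[OF e, of h] by simp
  qed (use t e in auto)
  also have "\<dots> = t e f" using finite_E e f t by (intro finsum_singleton) auto
  finally show ?thesis using 1 by (simp add: s_def)
qed

text \<open>
  Each corner is generated, modulo the radical, by two elements \<open>a\<^sub>e\<close> and \<open>b\<^sub>e\<close>, and each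
  \<open>e R f\<close> with \<open>e \<noteq> f\<close> lies in the radical or is \<open>(e R e) u\<close> for any of its elements \<open>u\<close> outside the
  radical. Since the components of an element can be cut out with the idempotents, all \<open>a\<^sub>e\<close> and
  \<open>u\<close> can be packed into one element \<open>c\<close>, and all \<open>b\<^sub>e\<close> into another one.
\<close>

lemma generated_mod_radical:
  "\<exists>b\<in>carrier R. \<exists>c\<in>carrier R. \<forall>T. subrng T R \<and> E \<subseteq> T \<and> b \<in> T \<and> c \<in> T \<and> nil_radical R \<subseteq> T
     \<longrightarrow> carrier R \<subseteq> T"
proof -
  let ?N = "nil_radical R"
  define P where "P e ab \<longleftrightarrow> fst ab \<in> corner e \<and> snd ab \<in> corner e \<and>
      (\<forall>T. subrng T R \<and> fst ab \<in> T \<and> snd ab \<in> T \<and> ?N \<subseteq> T \<longrightarrow> corner e \<subseteq> T)" for e ab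
  have ex: "\<exists>ab. P e ab" if e: "e \<in> E" for e
  proof -
    obtain a b where "a \<in> corner e" "b \<in> corner e"
      "\<forall>T. subrng T R \<and> a \<in> T \<and> b \<in> T \<and> ?N \<subseteq> T \<longrightarrow> corner e \<subseteq> T"
      using corner_two_generated[OF e] by (elim bexE)
    then have "P e (a, b)" by (simp add: P_def)
    then show ?thesis ..
  qed
  define F where "F e = (SOME ab. P e ab)" for e
  have PF: "P e (F e)" if "e \<in> E" for e unfolding F_def by (rule someI_ex[OF ex[OF that]])
  define a b where "a e = fst (F e)" and "b e = snd (F e)" for e
  have ab: "a e \<in> corner e" "b e \<in> corner e" if "e \<in> E" for e
    using PF[OF that] unfolding P_def a_def b_def by blast+
  have gen: "corner e \<subseteq> T" if "e \<in> E" "subrng T R" "a e \<in> T" "b e \<in> T" "?N \<subseteq> T" for e T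
    using PF[OF that(1)] that(2-) unfolding P_def a_def b_def by simp
  define U where "U e f = {x \<in> carrier R. e \<otimes> x = x \<and> x \<otimes> f = x \<and> x \<notin> ?N}" for e f
  \<comment> \<open>Diagonal entries hold the first corner generator, off-diagonal ones an element
    outside the radical. The default \<open>\<zero>\<close> occurs when the whole component lies in
    the radical and so in \<open>T\<close>.\<close>
  define t where "t e f = (if e = f then a e else if U e f = {} then \<zero> else SOME x. x \<in> U e f)" for e f
  have tU: "t e f \<in> U e f" if "e \<noteq> f" "U e f \<noteq> {}" for e f
    using that someI_ex[of "\<lambda>x. x \<in> U e f"] by (auto simp: t_def)
  have t: "t e f \<in> carrier R \<and> e \<otimes> t e f = t e f \<and> t e f \<otimes> f = t e f" if "e \<in> E" "f \<in> E" for e f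
  proof (cases "e = f \<or> U e f = {}")
    case True
    then show ?thesis using ab(1)[of e] that by (auto simp: t_def corner_def)
  next
    case False
    then show ?thesis using tU[of e f] by (auto simp: U_def)
  qed
  define s where "s e f = (if e = f then b e else \<zero>)" for e f
  have s: "s e f \<in> carrier R \<and> e \<otimes> s e f = s e f \<and> s e f \<otimes> f = s e f" if "e \<in> E" "f \<in> E" for e f
    using ab(2)[of e] that by (auto simp: s_def corner_def)
  define C where "C = (\<Oplus>g\<in>E. \<Oplus>h\<in>E. t g h)"
  define B where "B = (\<Oplus>g\<in>E. \<Oplus>h\<in>E. s g h)"
  have CB: "C \<in> carrier R" "B \<in> carrier R"
    unfolding C_def B_def using s t by (auto intro!: finsum_closed)
  have "carrier R \<subseteq> T" if T: "subrng T R" "E \<subseteq> T" "B \<in> T" "C \<in> T" "?N \<subseteq> T" for T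
  proof
    have addT: "additive_subgroup T R" and mT: "\<And>u v. u \<in> T \<Longrightarrow> v \<in> T \<Longrightarrow> u \<otimes> v \<in> T"
      using T(1) by (auto simp: subrng_def)
    interpret T: additive_subgroup T R by fact
    have tT: "t e f \<in> T" if "e \<in> E" "f \<in> E" for e f
      using peirce_component_sum[of t, OF t that] mT[OF mT[of e C], of f] that T by (auto simp: C_def)
    have sT: "s e f \<in> T" if "e \<in> E" "f \<in> E" for e f
      using peirce_component_sum[of s, OF s that] mT[OF mT[of e B], of f] that T by (auto simp: B_def)
    have cornerT: "corner e \<subseteq> T" if e: "e \<in> E" for e
      using gen[OF e T(1) _ _ T(5)] tT[OF e e] sT[OF e e] by (simp add: t_def s_def)
    have comp: "x \<in> T" if e: "e \<in> E" and f: "f \<in> E" and x: "x \<in> carrier R" "e \<otimes> x = x" "x \<otimes> f = x"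
      for e f x
    proof (cases "e = f")
      case True
      then show ?thesis using cornerT[OF e] x by (auto simp: corner_def)
    next
      case ef: False
      show ?thesis
      proof (cases "U e f = {}")
        case True
        then show ?thesis using x T(5) by (auto simp: U_def)
      next
        case False
        define u where "u = t e f"
        have u: "u \<in> carrier R" "e \<otimes> u = u" "u \<otimes> f = u" "u \<notin> ?N"
          using tU[OF ef False] by (auto simp: u_def U_def)
        obtain y where y: "y \<in> carrier R" "y \<otimes> u = f" "f \<otimes> y = y" using left_inverse[OF f u(1,3,4)] by blast
        \<comment> \<open>Since \<open>y u = f\<close>, this gives \<open>w u = x\<close>, and the
          factor \<open>e\<close> puts \<open>w\<close> into the corner of \<open>e\<close>.\<close>
        define w where "w = x \<otimes> (y \<otimes> e)"
        have ec: "e \<in> carrier R" "e \<otimes> e = e" using e E_mult by auto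
        have ye: "y \<otimes> e \<in> carrier R" using y ec rng_m_closed by simp
        have "w \<otimes> u = x \<otimes> (y \<otimes> (e \<otimes> u))" using x y u ec rng_m_closed by (simp add: w_def rng_m_assoc)
        also have "\<dots> = x" using x y u by simp
        finally have wu: "w \<otimes> u = x" .
        have "w \<in> carrier R" using x ye rng_m_closed by (simp add: w_def)
        moreover have "e \<otimes> w = w" using x ye ec by (simp add: w_def rng_m_assoc[symmetric])
        moreover have "w \<otimes> e = w" using x y ec rng_m_closed by (simp add: w_def rng_m_assoc)
        ultimately have "w \<in> T" using cornerT[OF e] by (auto simp: corner_def)
        then show ?thesis using mT[of w u] wu tT[OF e f] by (simp add: u_def)
      qed
    qed
    fix x assume x: "x \<in> carrier R"
    \<comment> \<open>\<open>x\<close> is the sum of \<open>x - y\<close>,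
      \<open>y - y idsum\<close> and \<open>y idsum\<close>. The first two are annihilated by
      \<open>E\<close> from one side and so lie in the radical; the third is a sum of Peirce
      components.\<close>
    define y where "y = idsum \<otimes> x"
    have yc: "y \<in> carrier R" using x rng_m_closed by (simp add: y_def)
    have yi: "y \<otimes> idsum \<in> carrier R" using yc rng_m_closed by simp
    have "x \<ominus> y \<in> T"
      using annihilated_l_nil[of "x \<ominus> y"] peirce_remainder_l[OF x] x yc T(5) by (auto simp: y_def)
    moreover have "y \<ominus> y \<otimes> idsum \<in> T"
      using annihilated_r_nil[of "y \<ominus> y \<otimes> idsum"] peirce_remainder_r[OF yc] yc yi T(5) by auto
    moreover have "y \<otimes> idsum \<in> T"
    proof -
      have exf: "e \<otimes> x \<otimes> f \<in> T" if "e \<in> E" "f \<in> E" for e f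
        using that x rng_m_closed E_assoc_r[of f f "e \<otimes> x"] E_assoc_l[of e e "x \<otimes> f"]
        by (intro comp[OF that]) (auto simp: rng_m_assoc)
      have "y \<otimes> f \<in> T" if f: "f \<in> E" for f
      proof -
        have "y \<otimes> f = (\<Oplus>e\<in>E. e \<otimes> x \<otimes> f)"
          unfolding y_def idsum_mult_l[OF x] using x f rng_m_closed by (intro rng_finsum_ldistr) auto
        also have "\<dots> \<in> T" using exf f by (intro additive_subgroup_finsum[OF addT]) auto
        finally show ?thesis .
      qed
      then show ?thesis unfolding idsum_mult_r[OF yc] by (intro additive_subgroup_finsum[OF addT]) auto
    qed
    ultimately have "(x \<ominus> y) \<oplus> ((y \<ominus> y \<otimes> idsum) \<oplus> y \<otimes> idsum) \<in> T" by (intro T.a_closed)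
    then show "x \<in> T" using x yc yi by (simp add: diff_add_cancel)
  qed
  then show ?thesis using CB by blast
qed

end

lemma (in finite_nil_rng) maximal_orth_idempotents_exist:
  "\<exists>E. maximal_orth_idempotents R E"
proof -
  let ?F = "{E. orth_idempotents R E}"
  have "?F \<subseteq> Pow (carrier R)" by (auto simp: orth_idempotents_def)
  then have fin: "finite (card ` ?F)" using finite_carrier by (meson finite_Pow_iff finite_imageI finite_subset)
  have "{} \<in> ?F" by (simp add: orth_idempotents_def)
  then have "Max (card ` ?F) \<in> card ` ?F" using fin by (intro Max_in) auto
  then obtain E where "orth_idempotents R E" "card E = Max (card ` ?F)" by auto
  then have "maximal_orth_idempotents R E"
    using fin by unfold_locales auto
  then show ?thesis ..
qed

section \<open>Coordinates over a subgroup\<close>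

primrec lincomb :: "('a, 'm) ring_scheme \<Rightarrow> (nat \<Rightarrow> nat) \<Rightarrow> (nat \<Rightarrow> 'a) \<Rightarrow> nat \<Rightarrow> 'a" where
  "lincomb R c ys 0 = \<zero>\<^bsub>R\<^esub>"
| "lincomb R c ys (Suc k) = lincomb R c ys k \<oplus>\<^bsub>R\<^esub> [c k] \<cdot>\<^bsub>R\<^esub> ys k"

text \<open>Coordinates consist of numbers and an element of \<open>J\<close> and do not mention
  \<open>R\<close>, so one vector can be read in two different rings.\<close>

definition val :: "('a, 'm) ring_scheme \<Rightarrow> ('b \<Rightarrow> 'a) \<Rightarrow> (nat \<Rightarrow> 'a) \<Rightarrow> nat \<Rightarrow> (nat \<Rightarrow> nat) \<times> 'b \<Rightarrow> 'a" where
  "val R \<phi> ys m x = lincomb R (fst x) ys m \<oplus>\<^bsub>R\<^esub> \<phi> (snd x)"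

lemma lincomb_cong:
  "(\<And>i. i < m \<Longrightarrow> c i = c' i) \<Longrightarrow> (\<And>i. i < m \<Longrightarrow> ys i = ys' i) \<Longrightarrow> lincomb R c ys m = lincomb R c' ys' m"
  by (induct m) auto

context abelian_group
begin

lemma lincomb_closed [simp]:
  "(\<And>i. i < m \<Longrightarrow> ys i \<in> carrier G) \<Longrightarrow> lincomb G c ys m \<in> carrier G"
  by (induct m) auto

lemma lincomb_add:
  "(\<And>i. i < m \<Longrightarrow> ys i \<in> carrier G) \<Longrightarrow>
    lincomb G (\<lambda>i. c i + d i) ys m = lincomb G c ys m \<oplus> lincomb G d ys m"
proof (induct m)
  case (Suc m)
  then show ?case by (simp add: add.nat_pow_mult[symmetric] a_ac)
qed simp

lemma lincomb_zero: "(\<And>i. i < m \<Longrightarrow> ys i \<in> carrier G) \<Longrightarrow> lincomb G (\<lambda>i. 0) ys m = \<zero>"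
  by (induct m) auto

lemma lincomb_single:
  assumes "\<And>i. i < m \<Longrightarrow> ys i \<in> carrier G" "k < m"
  shows "lincomb G (\<lambda>i. if i = k then 1 else 0) ys m = ys k"
  using assms
proof (induct m)
  case (Suc m)
  show ?case
  proof (cases "k = m")
    case True
    then have "lincomb G (\<lambda>i. if i = k then 1 else 0) ys m = lincomb G (\<lambda>i. 0) ys m"
      by (intro lincomb_cong) auto
    then show ?thesis using True Suc by (simp add: lincomb_zero)
  next
    case False
    then show ?thesis using Suc by simp
  qed
qed simp

end

section \<open>Additive homomorphisms and reduction of coordinates\<close>

lemma hom_add_pow:
  assumes "abelian_group G" "abelian_group H" "h \<in> hom (add_monoid G) (add_monoid H)" "x \<in> carrier G"
  shows "h ([(k::nat)] \<cdot>\<^bsub>G\<^esub> x) = [k] \<cdot>\<^bsub>H\<^esub> h x"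
proof -
  interpret G: abelian_group G by fact
  interpret H: abelian_group H by fact
  interpret h: group_hom "add_monoid G" "add_monoid H" h
    using assms G.a_group H.a_group by (simp add: group_hom_def group_hom_axioms_def)
  show ?thesis using assms(4) h.hom_nat_pow[of x k] by (simp add: add_pow_def)
qed

lemma hom_add_zero:
  assumes "abelian_group G" "abelian_group H" "h \<in> hom (add_monoid G) (add_monoid H)"
  shows "h \<zero>\<^bsub>G\<^esub> = \<zero>\<^bsub>H\<^esub>"
  using hom_one[OF assms(3)] assms(1,2)[THEN abelian_group.a_group] by simp

lemma hom_add_minus:
  assumes "abelian_group G" "abelian_group H" "h \<in> hom (add_monoid G) (add_monoid H)"
    "x \<in> carrier G" "y \<in> carrier G"
  shows "h (x \<ominus>\<^bsub>G\<^esub> y) = h x \<ominus>\<^bsub>H\<^esub> h y"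
proof -
  interpret G: abelian_group G by fact
  interpret H: abelian_group H by fact
  interpret h: group_hom "add_monoid G" "add_monoid H" h
    using assms G.a_group H.a_group by (simp add: group_hom_def group_hom_axioms_def)
  show ?thesis using assms(4,5) h.hom_inv[of y] h.hom_mult[of x "\<ominus>\<^bsub>G\<^esub> y"]
    by (simp add: a_minus_def a_inv_def[symmetric])
qed

lemma hom_lincomb:
  assumes "abelian_group G" "abelian_group H" "h \<in> hom (add_monoid G) (add_monoid H)"
    and "\<And>i. i < m \<Longrightarrow> ys i \<in> carrier G"
  shows "h (lincomb G c ys m) = lincomb H c (\<lambda>i. h (ys i)) m"
  using assms(4)
proof (induct m)
  case 0
  then show ?case using hom_add_zero[OF assms(1-3)] by simp
next
  case (Suc m)
  interpret G: abelian_group G by fact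
  have "h (lincomb G c ys m \<oplus>\<^bsub>G\<^esub> [c m] \<cdot>\<^bsub>G\<^esub> ys m) = h (lincomb G c ys m) \<oplus>\<^bsub>H\<^esub> h ([c m] \<cdot>\<^bsub>G\<^esub> ys m)"
    using assms(3) Suc.prems by (auto simp: hom_def)
  then show ?case using Suc hom_add_pow[OF assms(1-3)] by simp
qed

definition coords :: "nat \<Rightarrow> nat \<Rightarrow> 'b ring \<Rightarrow> ((nat \<Rightarrow> nat) \<times> 'b) set" where
  "coords p m J = ({..<m} \<rightarrow>\<^sub>E {..<p}) \<times> carrier J"

lemma card_coords: "card (coords p m J) = p ^ m * card (carrier J)"
  by (simp add: coords_def card_cartesian_product card_PiE)

lemma finite_coords: "finite (carrier J) \<Longrightarrow> finite (coords p m J)"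
  by (simp add: coords_def finite_PiE)

text \<open>Carrying: when \<open>p\<close> times \<open>ys i\<close> is
  \<open>\<phi> (js i)\<close>, the quotient of a digit by \<open>p\<close> moves into the
  \<open>J\<close> part. The rule depends on \<open>js\<close> but not on the ring.\<close>

definition reduce :: "nat \<Rightarrow> nat \<Rightarrow> 'b ring \<Rightarrow> (nat \<Rightarrow> 'b) \<Rightarrow> (nat \<Rightarrow> nat) \<times> 'b \<Rightarrow> (nat \<Rightarrow> nat) \<times> 'b" where
  "reduce p m J js x =
     (restrict (\<lambda>i. fst x i mod p) {..<m}, lincomb J (\<lambda>i. fst x i div p) js m \<oplus>\<^bsub>J\<^esub> snd x)"

locale coordinates = R: abelian_group R + J: abelian_group J
  for R :: "'a ring" and J :: "'b ring" +
  fixes \<phi> :: "'b \<Rightarrow> 'a" and ys :: "nat \<Rightarrow> 'a" and js :: "nat \<Rightarrow> 'b" and p m :: nat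
  assumes hom: "\<phi> \<in> hom (add_monoid J) (add_monoid R)"
    and ys: "i < m \<Longrightarrow> ys i \<in> carrier R"
    and js: "i < m \<Longrightarrow> js i \<in> carrier J"
    and p_ys: "i < m \<Longrightarrow> [p] \<cdot>\<^bsub>R\<^esub> ys i = \<phi> (js i)"
    and p_pos: "p > 0"
begin

lemma phi_closed [simp]: "j \<in> carrier J \<Longrightarrow> \<phi> j \<in> carrier R"
  using hom by (auto simp: hom_def)

lemma phi_add: "j \<in> carrier J \<Longrightarrow> k \<in> carrier J \<Longrightarrow> \<phi> (j \<oplus>\<^bsub>J\<^esub> k) = \<phi> j \<oplus>\<^bsub>R\<^esub> \<phi> k"
  using hom by (auto simp: hom_def)

lemma phi_zero: "\<phi> \<zero>\<^bsub>J\<^esub> = \<zero>\<^bsub>R\<^esub>"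
  by (rule hom_add_zero[OF _ _ hom]) unfold_locales

lemma val_closed: "snd x \<in> carrier J \<Longrightarrow> val R \<phi> ys m x \<in> carrier R"
  using ys by (simp add: val_def)

lemma reduce_coords:
  assumes "snd x \<in> carrier J"
  shows "reduce p m J js x \<in> coords p m J"
  using assms p_pos js by (auto simp: reduce_def coords_def)

lemma val_reduce:
  assumes "snd x \<in> carrier J"
  shows "val R \<phi> ys m (reduce p m J js x) = val R \<phi> ys m x"
proof -
  define c where "c = fst x"
  have "lincomb R c ys k = lincomb R (\<lambda>i. c i mod p) ys k \<oplus>\<^bsub>R\<^esub> lincomb R (\<lambda>i. c i div p) (\<lambda>i. \<phi> (js i)) k"
    if "k \<le> m" for k
    using that
  proof (induct k)
    case (Suc k)
    then have k: "k < m" by simp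
    have "[c k] \<cdot>\<^bsub>R\<^esub> ys k = [(c k mod p + p * (c k div p))] \<cdot>\<^bsub>R\<^esub> ys k" by simp
    also have "\<dots> = [(c k mod p)] \<cdot>\<^bsub>R\<^esub> ys k \<oplus>\<^bsub>R\<^esub> [(c k div p)] \<cdot>\<^bsub>R\<^esub> ([p] \<cdot>\<^bsub>R\<^esub> ys k)"
      using ys[OF k] by (simp only: R.add.nat_pow_mult R.add.nat_pow_pow)
    finally have "[c k] \<cdot>\<^bsub>R\<^esub> ys k = [(c k mod p)] \<cdot>\<^bsub>R\<^esub> ys k \<oplus>\<^bsub>R\<^esub> [(c k div p)] \<cdot>\<^bsub>R\<^esub> \<phi> (js k)"
      using p_ys[OF k] by simp
    moreover have "\<And>i. i < k \<Longrightarrow> ys i \<in> carrier R" "\<And>i. i < k \<Longrightarrow> \<phi> (js i) \<in> carrier R"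
      using k ys js by auto
    ultimately show ?case using Suc k ys js by (simp add: R.a_ac)
  qed simp
  from this[of m] have "lincomb R c ys m \<oplus>\<^bsub>R\<^esub> \<phi> (snd x)
      = lincomb R (\<lambda>i. c i mod p) ys m \<oplus>\<^bsub>R\<^esub> (\<phi> (lincomb J (\<lambda>i. c i div p) js m) \<oplus>\<^bsub>R\<^esub> \<phi> (snd x))"
    using hom_lincomb[OF J.abelian_group_axioms R.abelian_group_axioms hom js, of m] assms ys js
    by (simp add: R.a_assoc)
  moreover have "lincomb R (restrict (\<lambda>i. c i mod p) {..<m}) ys m = lincomb R (\<lambda>i. c i mod p) ys m"
    by (intro lincomb_cong) auto
  ultimately show ?thesis
    using assms js by (simp add: val_def reduce_def c_def phi_add)
qed

lemma val_add:
  assumes "snd x \<in> carrier J" "snd y \<in> carrier J"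
  shows "val R \<phi> ys m x \<oplus>\<^bsub>R\<^esub> val R \<phi> ys m y
    = val R \<phi> ys m (\<lambda>i. fst x i + fst y i, snd x \<oplus>\<^bsub>J\<^esub> snd y)"
  using assms ys by (simp add: val_def R.lincomb_add phi_add R.a_ac)

lemma val_phi: "j \<in> carrier J \<Longrightarrow> val R \<phi> ys m (\<lambda>i. 0, j) = \<phi> j"
  using ys by (simp add: val_def R.lincomb_zero)

lemma val_ys: "k < m \<Longrightarrow> val R \<phi> ys m (\<lambda>i. if i = k then 1 else 0, \<zero>\<^bsub>J\<^esub>) = ys k"
  using ys R.lincomb_single[of m ys k] by (simp add: val_def phi_zero)

text \<open>
  The values at vectors with arbitrary natural number entries form a submonoid, hence a subgroup
  because \<open>R\<close> is finite; entries are then brought below \<open>p\<close> with \<open>val_reduce\<close>.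
\<close>

lemma val_onto:
  assumes fin: "finite (carrier R)"
    and gen: "\<And>K. additive_subgroup K R \<Longrightarrow> \<phi> ` carrier J \<subseteq> K \<Longrightarrow> ys ` {..<m} \<subseteq> K \<Longrightarrow> carrier R \<subseteq> K"
  shows "val R \<phi> ys m ` coords p m J = carrier R"
proof
  show "val R \<phi> ys m ` coords p m J \<subseteq> carrier R"
    using val_closed by (auto simp: coords_def)
  let ?K = "val R \<phi> ys m ` {x. snd x \<in> carrier J}"
  have plus: "u \<oplus>\<^bsub>R\<^esub> v \<in> ?K" if uv: "u \<in> ?K" "v \<in> ?K" for u v
  proof -
    obtain x y where xy: "u = val R \<phi> ys m x" "snd x \<in> carrier J" "v = val R \<phi> ys m y" "snd y \<in> carrier J"
      using uv by auto
    then have "u \<oplus>\<^bsub>R\<^esub> v = val R \<phi> ys m (\<lambda>i. fst x i + fst y i, snd x \<oplus>\<^bsub>J\<^esub> snd y)"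
      using val_add by simp
    then show ?thesis using xy by auto
  qed
  have Kc: "?K \<subseteq> carrier R" using val_closed by auto
  have zero: "\<zero>\<^bsub>R\<^esub> \<in> ?K" using val_phi[of "\<zero>\<^bsub>J\<^esub>"] phi_zero by (metis J.zero_closed image_eqI mem_Collect_eq snd_conv)
  have mult: "[(k::nat)] \<cdot>\<^bsub>R\<^esub> u \<in> ?K" if "u \<in> ?K" for k u
    using that zero plus by (induct k) auto
  have "additive_subgroup ?K R"
  proof (rule R.additive_subgroupI'[OF Kc zero])
    fix u v assume uv: "u \<in> ?K" "v \<in> ?K"
    then have vc: "v \<in> carrier R" using Kc by auto
    have pos: "card (carrier R) > 0" using fin vc card_gt_0_iff by blast
    have "[(card (carrier R) - 1)] \<cdot>\<^bsub>R\<^esub> v \<oplus>\<^bsub>R\<^esub> v = [Suc (card (carrier R) - 1)] \<cdot>\<^bsub>R\<^esub> v" using vc by simp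
    also have "\<dots> = \<zero>\<^bsub>R\<^esub>"
      using pos R.add.pow_order_eq_1[OF vc] by (simp add: order_def del: R.add.nat_pow_Suc)
    finally have "\<ominus>\<^bsub>R\<^esub> v = [(card (carrier R) - 1)] \<cdot>\<^bsub>R\<^esub> v" using vc by (simp add: R.minus_equality)
    then show "u \<ominus>\<^bsub>R\<^esub> v \<in> ?K" using plus[OF uv(1) mult[OF uv(2)]] by (simp add: a_minus_def)
  qed
  moreover have "\<phi> ` carrier J \<subseteq> ?K"
  proof (rule image_subsetI)
    fix j assume "j \<in> carrier J"
    then show "\<phi> j \<in> ?K" using val_phi[of j] by (intro image_eqI[of _ _ "(\<lambda>i. 0, j)"]) auto
  qed
  moreover have "ys ` {..<m} \<subseteq> ?K"
  proof (rule image_subsetI)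
    fix k assume "k \<in> {..<m}"
    then show "ys k \<in> ?K"
      using val_ys[of k] by (intro image_eqI[of _ _ "(\<lambda>i. if i = k then 1 else 0, \<zero>\<^bsub>J\<^esub>)"]) auto
  qed
  ultimately have "carrier R \<subseteq> ?K" by (rule gen)
  also have "?K \<subseteq> val R \<phi> ys m ` coords p m J"
  proof (rule image_subsetI)
    fix x :: "(nat \<Rightarrow> nat) \<times> 'b" assume "x \<in> {x. snd x \<in> carrier J}"
    then show "val R \<phi> ys m x \<in> val R \<phi> ys m ` coords p m J"
      using val_reduce[of x] reduce_coords[of x] by (intro image_eqI[of _ _ "reduce p m J js x"]) auto
  qed
  finally show "carrier R \<subseteq> val R \<phi> ys m ` coords p m J" .
qed

end

text \<open>Every step up from a subgroup by one generator multiplies the order by at least \<open>p\<close>.\<close>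

lemma (in abelian_group) prime_power_generators:
  assumes p: "Factorial_Ring.prime (p::nat)" and fin: "finite (carrier G)" and n: "card (carrier G) = p ^ n"
    and H: "H \<subseteq> carrier G"
  shows "additive_subgroup B G \<Longrightarrow> card B = p ^ r \<Longrightarrow> r + d = n
    \<Longrightarrow> (\<And>K. additive_subgroup K G \<Longrightarrow> B \<subseteq> K \<Longrightarrow> H \<subseteq> K \<Longrightarrow> carrier G \<subseteq> K)
    \<Longrightarrow> \<exists>ys::nat \<Rightarrow> 'a. (\<forall>i<d. ys i \<in> H)
      \<and> (\<forall>K. additive_subgroup K G \<and> B \<subseteq> K \<and> ys ` {..<d} \<subseteq> K \<longrightarrow> carrier G \<subseteq> K)"
proof (induct d arbitrary: B r rule: less_induct)
  case (less d)
  interpret B: additive_subgroup B G by fact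
  have p1: "p > 1" using p prime_gt_1_nat by blast
  show ?case
  proof (cases "d = 0")
    case True
    then have "B = carrier G" using less.prems n fin B.a_subset by (intro card_subset_eq) auto
    then show ?thesis using True by auto
  next
    case False
    then have "p ^ r < p ^ n" using less.prems p1 by (intro power_strict_increasing) auto
    then have "\<not> carrier G \<subseteq> B" using less.prems(2) n B.a_subset by (metis nat_neq_iff subset_antisym)
    then obtain h where h: "h \<in> H" "h \<notin> B" using less.prems(4)[OF less.prems(1)] by blast
    define B' where "B' = generate (add_monoid G) (insert h B)"
    have sub: "subgroup B' (add_monoid G)"
      unfolding B'_def using h H B.a_subset by (intro add.generate_is_subgroup) auto
    then have B': "additive_subgroup B' G" by (rule additive_subgroup.intro)
    have incl: "insert h B \<subseteq> B'" unfolding B'_def by (auto intro: generate.incl)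
    have B'c: "B' \<subseteq> carrier G" using additive_subgroup.a_subset[OF B'] .
    then have finB': "finite B'" using fin finite_subset by blast
    have "card B' dvd p ^ n"
      using group.lagrange[OF a_group sub] n by (simp add: order_def) (metis dvd_triv_right)
    then obtain r' where r': "r' \<le> n" "card B' = p ^ r'"
      using p divides_primepow_nat by blast
    have "B \<subset> B'" using incl h by blast
    then have "card B < card B'" by (rule psubset_card_mono[OF finB'])
    then have "p ^ r < p ^ r'" unfolding less.prems(2) r'(2) .
    then have rr: "r < r'" by (rule power_less_imp_less_exp[OF p1])
    define d' where "d' = n - r'"
    have d': "d' < d" "r' + d' = n" using less.prems(3) rr r' by (auto simp: d'_def)
    have "carrier G \<subseteq> K" if "additive_subgroup K G" "B' \<subseteq> K" "H \<subseteq> K" for K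
      using less.prems(4)[of K] that incl by blast
    from less.hyps[OF d'(1) B' r'(2) d'(2) this]
    obtain ys :: "nat \<Rightarrow> 'a" where ys: "\<forall>i<d'. ys i \<in> H"
      "\<forall>K. additive_subgroup K G \<and> B' \<subseteq> K \<and> ys ` {..<d'} \<subseteq> K \<longrightarrow> carrier G \<subseteq> K" by blast
    \<comment> \<open>Adding \<open>h\<close> may raise the exponent by more than one, so
      \<open>d'\<close> can be less than \<open>d - 1\<close>. All indices from \<open>d'\<close> on
      are filled with \<open>h\<close>.\<close>
    define zs where "zs i = (if i < d' then ys i else h)" for i
    have "carrier G \<subseteq> K" if K: "additive_subgroup K G" "B \<subseteq> K" "zs ` {..<d} \<subseteq> K" for K
    proof -
      have zK: "zs i \<in> K" if "i < d" for i using K(3) that by blast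
      have "h \<in> K" using zK[of d'] d' by (simp add: zs_def)
      then have "B' \<subseteq> K" unfolding B'_def
        using K additive_subgroup.a_subgroup[OF K(1)] by (intro add.generate_subgroup_incl) auto
      moreover have "ys ` {..<d'} \<subseteq> K"
      proof (rule image_subsetI)
        fix i assume "i \<in> {..<d'}"
        then show "ys i \<in> K" using zK[of i] d' by (simp add: zs_def)
      qed
      ultimately show ?thesis using ys(2) K(1) by blast
    qed
    moreover have "\<forall>i<d. zs i \<in> H" using ys(1) h by (simp add: zs_def)
    ultimately show ?thesis by blast
  qed
qed

section \<open>Rings with the same presentation are isomorphic\<close>

lemma rng_iso_trans:
  assumes "h \<in> rng_iso R S" "k \<in> rng_iso S T"
  shows "k \<circ> h \<in> rng_iso R T"
proof -
  have h: "h \<in> hom R S" "h \<in> hom (add_monoid R) (add_monoid S)" "bij_betw h (carrier R) (carrier S)"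
    and k: "k \<in> hom S T" "k \<in> hom (add_monoid S) (add_monoid T)" "bij_betw k (carrier S) (carrier T)"
    using assms by (simp_all add: rng_iso_def)
  show ?thesis
    using hom_compose[OF h(1) k(1)] hom_compose[OF h(2) k(2)] bij_betw_trans[OF h(3) k(3)]
    by (simp add: rng_iso_def)
qed

lemma rng_iso_inv_into:
  assumes h: "h \<in> rng_iso R S"
    and closed: "\<And>x y. x \<in> carrier R \<Longrightarrow> y \<in> carrier R \<Longrightarrow> x \<otimes>\<^bsub>R\<^esub> y \<in> carrier R"
      "\<And>x y. x \<in> carrier R \<Longrightarrow> y \<in> carrier R \<Longrightarrow> x \<oplus>\<^bsub>R\<^esub> y \<in> carrier R"
  shows "inv_into (carrier R) h \<in> rng_iso S R"
proof -
  let ?k = "inv_into (carrier R) h"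
  have bij: "bij_betw h (carrier R) (carrier S)" using h by (simp add: rng_iso_def)
  then have im: "h ` carrier R = carrier S" and inj: "inj_on h (carrier R)" by (auto simp: bij_betw_def)
  have kc: "?k y \<in> carrier R" "h (?k y) = y" if "y \<in> carrier S" for y
    using that im by (auto intro: inv_into_into f_inv_into_f)
  have "?k (y \<otimes>\<^bsub>S\<^esub> z) = ?k y \<otimes>\<^bsub>R\<^esub> ?k z" if "y \<in> carrier S" "z \<in> carrier S" for y z
  proof -
    have "h (?k y \<otimes>\<^bsub>R\<^esub> ?k z) = y \<otimes>\<^bsub>S\<^esub> z" using h kc that by (simp add: rng_iso_def hom_def)
    then show ?thesis using inv_into_f_f[OF inj closed(1)[OF kc(1) kc(1), OF that]] by simp
  qed
  moreover have "?k (y \<oplus>\<^bsub>S\<^esub> z) = ?k y \<oplus>\<^bsub>R\<^esub> ?k z" if "y \<in> carrier S" "z \<in> carrier S" for y z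
  proof -
    have "h (?k y \<oplus>\<^bsub>R\<^esub> ?k z) = y \<oplus>\<^bsub>S\<^esub> z" using h kc that by (simp add: rng_iso_def hom_def)
    then show ?thesis using inv_into_f_f[OF inj closed(2)[OF kc(1) kc(1), OF that]] by simp
  qed
  ultimately show ?thesis
    using kc bij_betw_inv_into[OF bij] by (auto simp: rng_iso_def hom_def)
qed

text \<open>
  The generators are \<open>ys 0, \<dots>, ys (m - 1)\<close> followed by \<open>zs 0, \<dots>, zs (n - m - 1)\<close>, the latter
  in \<open>J\<close>. The rows \<open>T 0\<close> and \<open>T 1\<close> are their left and right Peirce labels, elements of \<open>E\<close> or \<open>\<zero>\<close>;
  \<open>T (2 + k)\<close> and \<open>T (4 + k)\<close> are their products with the \<open>k\<close>-th of the two ring generators \<open>w\<close>.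
\<close>

locale presentation = finite_nil_rng R + J: rng J
  for R :: "'a ring" (structure) and J :: "'b ring" +
  fixes \<phi> :: "'b \<Rightarrow> 'a" and ys :: "nat \<Rightarrow> 'a" and E :: "'a set" and p m n :: nat
    and js zs :: "nat \<Rightarrow> 'b" and T :: "nat \<Rightarrow> nat \<Rightarrow> (nat \<Rightarrow> nat) \<times> 'b" and w :: "nat \<Rightarrow> (nat \<Rightarrow> nat) \<times> 'b"
  assumes phi: "\<phi> \<in> rng_iso J (jacobson_radical_rng R)"
    and p_pos: "p > 0" and mn: "m \<le> n"
    and js: "\<And>i. i < m \<Longrightarrow> js i \<in> carrier J"
    and zs: "\<And>i. i < n - m \<Longrightarrow> zs i \<in> carrier J"
    and ys: "\<And>i. i < m \<Longrightarrow> ys i \<in> carrier R"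
    and T: "\<And>k i. k < 6 \<Longrightarrow> i < n \<Longrightarrow> T k i \<in> coords p m J"
    and w: "\<And>k. k < 2 \<Longrightarrow> w k \<in> coords p m J"
    and p_ys: "\<And>i. i < m \<Longrightarrow> [p] \<cdot> ys i = \<phi> (js i)"
    and bij: "bij_betw (val R \<phi> ys m) (coords p m J) (carrier R)"
    and E: "\<And>e. e \<in> E \<Longrightarrow> e \<in> carrier R \<and> e \<otimes> e = e \<and> e \<noteq> \<zero>"
    and T0: "\<And>i. i < n \<Longrightarrow> val R \<phi> ys m (T 0 i) \<in> insert \<zero> E"
      "\<And>i e. i < n \<Longrightarrow> e \<in> E \<Longrightarrow> e \<otimes> (if i < m then ys i else \<phi> (zs (i - m)))
        = (if e = val R \<phi> ys m (T 0 i) then (if i < m then ys i else \<phi> (zs (i - m))) else \<zero>)"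
    and T1: "\<And>i. i < n \<Longrightarrow> val R \<phi> ys m (T 1 i) \<in> insert \<zero> E"
      "\<And>i e. i < n \<Longrightarrow> e \<in> E \<Longrightarrow> (if i < m then ys i else \<phi> (zs (i - m))) \<otimes> e
        = (if e = val R \<phi> ys m (T 1 i) then (if i < m then ys i else \<phi> (zs (i - m))) else \<zero>)"
    and Tl: "\<And>i k. i < n \<Longrightarrow> k < 2 \<Longrightarrow> val R \<phi> ys m (w k) \<otimes> (if i < m then ys i else \<phi> (zs (i - m)))
        = val R \<phi> ys m (T (2 + k) i)"
    and Tr: "\<And>i k. i < n \<Longrightarrow> k < 2 \<Longrightarrow> (if i < m then ys i else \<phi> (zs (i - m))) \<otimes> val R \<phi> ys m (w k)
        = val R \<phi> ys m (T (4 + k) i)"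
    and spans: "\<And>K. additive_subgroup K R \<Longrightarrow>
        (\<And>i. i < n \<Longrightarrow> (if i < m then ys i else \<phi> (zs (i - m))) \<in> K) \<Longrightarrow> carrier R \<subseteq> K"
    and generates: "\<And>K. subrng K R \<Longrightarrow> E \<subseteq> K \<Longrightarrow> (\<And>k. k < 2 \<Longrightarrow> val R \<phi> ys m (w k) \<in> K) \<Longrightarrow>
        jacobson_radical R \<subseteq> K \<Longrightarrow> carrier R \<subseteq> K"
begin

abbreviation "v \<equiv> val R \<phi> ys m"

definition g :: "nat \<Rightarrow> 'a" where
  "g i = (if i < m then ys i else \<phi> (zs (i - m)))"

lemma jac_carrier: "x \<in> jacobson_radical R \<Longrightarrow> x \<in> carrier R"
  by (simp add: jacobson_radical_def)

lemma phi_hom: "\<phi> \<in> hom (add_monoid J) (add_monoid R)"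
  using phi jac_carrier by (auto simp: rng_iso_def hom_def jacobson_radical_rng_def)

lemma phi_mult: "x \<in> carrier J \<Longrightarrow> y \<in> carrier J \<Longrightarrow> \<phi> (x \<otimes>\<^bsub>J\<^esub> y) = \<phi> x \<otimes> \<phi> y"
  using phi by (auto simp: rng_iso_def hom_def jacobson_radical_rng_def)

lemma phi_image: "\<phi> ` carrier J = jacobson_radical R"
  using phi by (auto simp: rng_iso_def bij_betw_def jacobson_radical_rng_def)

lemma coordinates: "coordinates R J \<phi> ys js p m"
  using phi_hom ys js p_ys p_pos by unfold_locales auto

lemma phi_closed: "j \<in> carrier J \<Longrightarrow> \<phi> j \<in> carrier R"
  using phi_image jac_carrier by auto

lemma g_closed [simp]: "i < n \<Longrightarrow> g i \<in> carrier R"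
  using ys[of i] phi_closed[OF zs[of "i - m"]] by (auto simp: g_def)

lemma v_closed [simp]: "c \<in> coords p m J \<Longrightarrow> v c \<in> carrier R"
  using bij by (auto simp: bij_betw_def)

lemma spans': "additive_subgroup K R \<Longrightarrow> (\<And>i. i < n \<Longrightarrow> g i \<in> K) \<Longrightarrow> carrier R \<subseteq> K"
  using spans by (simp add: g_def)

text \<open>An \<open>e\<close> that is no label would annihilate all generators, hence all of
  \<open>R\<close> including itself. So \<open>E\<close> needs no code of its own: the row
  \<open>T 0\<close> determines it.\<close>

lemma idempotent_is_label:
  assumes e: "e \<in> E"
  shows "\<exists>i<n. v (T 0 i) = e"
proof (rule ccontr)
  assume "\<not> ?thesis"
  then have z: "e \<otimes> g i = \<zero>" if "i < n" for i using T0(2)[OF that e] that by (auto simp: g_def)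
  have ec: "e \<in> carrier R" "e \<otimes> e = e" "e \<noteq> \<zero>" using E[OF e] by auto
  have "additive_subgroup {x \<in> carrier R. e \<otimes> x = \<zero>} R"
    using ec by (intro additive_subgroupI') (auto simp: rng_r_diff)
  then have "carrier R \<subseteq> {x \<in> carrier R. e \<otimes> x = \<zero>}" by (rule spans') (simp add: z)
  then show False using ec by auto
qed

end

text \<open>
  The elements \<open>a\<close> with \<open>\<theta> (a x) = \<theta> a \<theta> x\<close> and \<open>\<theta> (x a) = \<theta> x \<theta> a\<close> for all \<open>x\<close> form a subring. It
  contains the generators modulo the radical, for which this is recorded by the tables \<open>T\<close>,
  and then the radical as well.
\<close>

lemma presentation_unique:
  assumes "presentation R J \<phi> ys E p m n js zs T w" and "presentation S J \<psi> us F p m n js zs T w"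
  shows "rng_isomorphic R S"
proof -
  interpret R: presentation R J \<phi> ys E p m n js zs T w by fact
  interpret S: presentation S J \<psi> us F p m n js zs T w by fact
  interpret CR: coordinates R J \<phi> ys js p m by (rule R.coordinates)
  interpret CS: coordinates S J \<psi> us js p m by (rule S.coordinates)
  let ?C = "coords p m J"
  define \<theta> where "\<theta> x = S.v (inv_into ?C R.v x)" for x
  have injv: "inj_on R.v ?C" and imv: "R.v ` ?C = carrier R" using R.bij unfolding bij_betw_def by blast+
  have \<theta>v: "\<theta> (R.v c) = S.v c" if "c \<in> ?C" for c unfolding \<theta>_def inv_into_f_f[OF injv that] ..
  \<comment> \<open>Carrying is the same in both rings, so \<open>\<theta>\<close> respects
    unreduced vectors too. Additivity needs this, as sums of digits may reach
    \<open>p\<close>.\<close>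
  have \<theta>val: "\<theta> (R.v x) = S.v x" if "snd x \<in> carrier J" for x
    using \<theta>v[OF CR.reduce_coords[OF that]] unfolding CR.val_reduce[OF that] CS.val_reduce[OF that] .
  have Csnd: "snd c \<in> carrier J" if "c \<in> ?C" for c using that unfolding coords_def mem_Times_iff by blast
  have bij: "bij_betw \<theta> (carrier R) (carrier S)"
    unfolding \<theta>_def using bij_betw_trans[OF bij_betw_inv_into[OF R.bij] S.bij] unfolding comp_def .
  then have inj: "inj_on \<theta> (carrier R)" and \<theta>c: "\<And>x. x \<in> carrier R \<Longrightarrow> \<theta> x \<in> carrier S"
    unfolding bij_betw_def by blast+
  have add: "\<theta> (x \<oplus>\<^bsub>R\<^esub> y) = \<theta> x \<oplus>\<^bsub>S\<^esub> \<theta> y" if xy: "x \<in> carrier R" "y \<in> carrier R" for x y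
  proof -
    obtain c where c: "x = R.v c" "c \<in> ?C" using xy(1) imv by (metis imageE)
    obtain d where d: "y = R.v d" "d \<in> ?C" using xy(2) imv by (metis imageE)
    have "x \<oplus>\<^bsub>R\<^esub> y = R.v (\<lambda>i. fst c i + fst d i, snd c \<oplus>\<^bsub>J\<^esub> snd d)"
      unfolding c d using CR.val_add Csnd c d by simp
    then have "\<theta> (x \<oplus>\<^bsub>R\<^esub> y) = S.v (\<lambda>i. fst c i + fst d i, snd c \<oplus>\<^bsub>J\<^esub> snd d)"
      using \<theta>val[of "(\<lambda>i. fst c i + fst d i, snd c \<oplus>\<^bsub>J\<^esub> snd d)"] Csnd c d by simp
    also have "\<dots> = \<theta> x \<oplus>\<^bsub>S\<^esub> \<theta> y"
      using CS.val_add[of c d] Csnd \<theta>v c d by simp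
    finally show ?thesis .
  qed
  have hom: "\<theta> \<in> hom (add_monoid R) (add_monoid S)" using add \<theta>c by (auto simp: hom_def)
  note gR = R.abelian_group_axioms and gS = S.abelian_group_axioms
  have \<theta>0: "\<theta> \<zero>\<^bsub>R\<^esub> = \<zero>\<^bsub>S\<^esub>" by (rule hom_add_zero[OF gR gS hom])
  have minus: "\<theta> (x \<ominus>\<^bsub>R\<^esub> y) = \<theta> x \<ominus>\<^bsub>S\<^esub> \<theta> y" if "x \<in> carrier R" "y \<in> carrier R" for x y
    by (rule hom_add_minus[OF gR gS hom that])
  have \<theta>\<phi>: "\<theta> (\<phi> j) = \<psi> j" if "j \<in> carrier J" for j
    using \<theta>val[of "(\<lambda>i. 0, j)"] CR.val_phi[OF that] CS.val_phi[OF that] that by simp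
  have \<theta>ys: "\<theta> (ys k) = us k" if "k < m" for k
    using \<theta>val[of "(\<lambda>i. if i = k then 1 else 0, \<zero>\<^bsub>J\<^esub>)"] CR.val_ys[OF that] CS.val_ys[OF that] by simp
  have \<theta>g: "\<theta> (R.g i) = S.g i" if "i < n" for i
    using \<theta>ys \<theta>\<phi> R.zs[of "i - m"] that by (auto simp: R.g_def S.g_def)
  have \<theta>T: "\<theta> (R.v (T k i)) = S.v (T k i)" if "k < 6" "i < n" for k i by (rule \<theta>v[OF R.T[OF that]])
  have \<theta>w: "\<theta> (R.v (w k)) = S.v (w k)" if "k < 2" for k by (rule \<theta>v[OF R.w[OF that]])
  \<comment> \<open>For fixed \<open>a\<close> the solutions \<open>x\<close> form an additive
    subgroup, so the generators suffice.\<close>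
  have left: "\<theta> (a \<otimes>\<^bsub>R\<^esub> x) = \<theta> a \<otimes>\<^bsub>S\<^esub> \<theta> x"
    if a: "a \<in> carrier R" and x: "x \<in> carrier R"
      and eq: "\<And>i. i < n \<Longrightarrow> \<theta> (a \<otimes>\<^bsub>R\<^esub> R.g i) = \<theta> a \<otimes>\<^bsub>S\<^esub> S.g i" for a x
  proof -
    let ?K = "{x \<in> carrier R. \<theta> (a \<otimes>\<^bsub>R\<^esub> x) = \<theta> a \<otimes>\<^bsub>S\<^esub> \<theta> x}"
    have "additive_subgroup ?K R"
      using a \<theta>0 \<theta>c minus R.rng_m_closed
      by (intro R.additive_subgroupI') (auto simp: R.rng_r_diff S.rng_r_diff)
    then have "carrier R \<subseteq> ?K" using eq \<theta>g by (intro R.spans') auto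
    then show ?thesis using x by blast
  qed
  have right: "\<theta> (x \<otimes>\<^bsub>R\<^esub> a) = \<theta> x \<otimes>\<^bsub>S\<^esub> \<theta> a"
    if a: "a \<in> carrier R" and x: "x \<in> carrier R"
      and eq: "\<And>i. i < n \<Longrightarrow> \<theta> (R.g i \<otimes>\<^bsub>R\<^esub> a) = S.g i \<otimes>\<^bsub>S\<^esub> \<theta> a" for a x
  proof -
    let ?K = "{x \<in> carrier R. \<theta> (x \<otimes>\<^bsub>R\<^esub> a) = \<theta> x \<otimes>\<^bsub>S\<^esub> \<theta> a}"
    have "additive_subgroup ?K R"
      using a \<theta>0 \<theta>c minus R.rng_m_closed
      by (intro R.additive_subgroupI') (auto simp: R.rng_l_diff S.rng_l_diff)
    then have "carrier R \<subseteq> ?K" using eq \<theta>g by (intro R.spans') auto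
    then show ?thesis using x by blast
  qed
  define G where "G = {a \<in> carrier R. \<forall>x\<in>carrier R.
    \<theta> (a \<otimes>\<^bsub>R\<^esub> x) = \<theta> a \<otimes>\<^bsub>S\<^esub> \<theta> x \<and> \<theta> (x \<otimes>\<^bsub>R\<^esub> a) = \<theta> x \<otimes>\<^bsub>S\<^esub> \<theta> a}"
  have Gc: "a \<in> carrier R" if "a \<in> G" for a using that by (simp add: G_def)
  have Gm: "\<theta> (a \<otimes>\<^bsub>R\<^esub> x) = \<theta> a \<otimes>\<^bsub>S\<^esub> \<theta> x" "\<theta> (x \<otimes>\<^bsub>R\<^esub> a) = \<theta> x \<otimes>\<^bsub>S\<^esub> \<theta> a"
    if "a \<in> G" "x \<in> carrier R" for a x using that by (simp_all add: G_def)
  have GI: "a \<in> G" if "a \<in> carrier R" "\<And>i. i < n \<Longrightarrow> \<theta> (a \<otimes>\<^bsub>R\<^esub> R.g i) = \<theta> a \<otimes>\<^bsub>S\<^esub> S.g i"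
    "\<And>i. i < n \<Longrightarrow> \<theta> (R.g i \<otimes>\<^bsub>R\<^esub> a) = S.g i \<otimes>\<^bsub>S\<^esub> \<theta> a" for a
    unfolding G_def using that left[of a] right[of a] by blast
  have Gadd: "additive_subgroup G R"
  proof (rule R.additive_subgroupI')
    show "\<zero>\<^bsub>R\<^esub> \<in> G" using \<theta>0 \<theta>c by (simp add: G_def)
    fix a b assume ab: "a \<in> G" "b \<in> G"
    show "a \<ominus>\<^bsub>R\<^esub> b \<in> G"
      unfolding G_def using ab[THEN Gc] Gm[OF ab(1)] Gm[OF ab(2)] minus \<theta>c R.rng_m_closed
      by (simp add: R.rng_l_diff R.rng_r_diff S.rng_l_diff S.rng_r_diff)
  qed (use Gc in auto)
  have Gmult: "a \<otimes>\<^bsub>R\<^esub> b \<in> G" if ab: "a \<in> G" "b \<in> G" for a b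
  proof -
    have c: "a \<in> carrier R" "b \<in> carrier R" using ab Gc by auto
    have "\<theta> (a \<otimes>\<^bsub>R\<^esub> b \<otimes>\<^bsub>R\<^esub> x) = \<theta> (a \<otimes>\<^bsub>R\<^esub> b) \<otimes>\<^bsub>S\<^esub> \<theta> x" if "x \<in> carrier R" for x
      using that c Gm(1)[OF ab(1), of "b \<otimes>\<^bsub>R\<^esub> x"] Gm(1)[OF ab(2), of x] Gm(1)[OF ab(1), of b] \<theta>c
      by (simp add: R.rng_m_assoc R.rng_m_closed S.rng_m_assoc)
    moreover have "\<theta> (x \<otimes>\<^bsub>R\<^esub> (a \<otimes>\<^bsub>R\<^esub> b)) = \<theta> x \<otimes>\<^bsub>S\<^esub> \<theta> (a \<otimes>\<^bsub>R\<^esub> b)" if "x \<in> carrier R" for x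
      using that c Gm(2)[OF ab(2), of "x \<otimes>\<^bsub>R\<^esub> a"] Gm(2)[OF ab(1), of x] Gm(1)[OF ab(1), of b] \<theta>c
        R.rng_m_assoc[of x a b] S.rng_m_assoc[of "\<theta> x" "\<theta> a" "\<theta> b"] by (simp add: R.rng_m_closed)
    ultimately show ?thesis using c R.rng_m_closed by (simp add: G_def)
  qed
  interpret GG: additive_subgroup G R by (rule Gadd)
  have EG: "e \<in> G" if e: "e \<in> E" for e
  proof (rule GI)
    have ec: "e \<in> carrier R" "e \<noteq> \<zero>\<^bsub>R\<^esub>" using R.E[OF e] by auto
    then show "e \<in> carrier R" by simp
    have "\<theta> e \<noteq> \<zero>\<^bsub>S\<^esub>" using inj_onD[OF inj, of e "\<zero>\<^bsub>R\<^esub>"] ec \<theta>0 by auto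
    obtain i where i: "i < n" "R.v (T 0 i) = e" using R.idempotent_is_label[OF e] by blast
    \<comment> \<open>Nothing relates \<open>F\<close> to \<open>E\<close> beforehand:
      \<open>\<theta> e\<close> is a nonzero label in \<open>S\<close> and therefore belongs to
      \<open>F\<close>.\<close>
    have "\<theta> e = S.v (T 0 i)" using \<theta>T[of 0 i] i by simp
    then have \<theta>e: "\<theta> e \<in> F" using S.T0(1)[OF i(1)] \<open>\<theta> e \<noteq> \<zero>\<^bsub>S\<^esub>\<close> by auto
    \<comment> \<open>By injectivity of \<open>\<theta>\<close>, the elements \<open>e\<close> and
      \<open>\<theta> e\<close> agree with corresponding labels simultaneously, hence act alike on
      corresponding generators.\<close>
    have lab: "e = R.v (T k i) \<longleftrightarrow> \<theta> e = S.v (T k i)" if "k < 6" "i < n" for k i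
      using \<theta>T[OF that] inj_on_eq_iff[OF inj ec(1) R.v_closed[OF R.T[OF that]]] by simp
    fix i assume i: "i < n"
    show "\<theta> (e \<otimes>\<^bsub>R\<^esub> R.g i) = \<theta> e \<otimes>\<^bsub>S\<^esub> S.g i"
      using R.T0(2)[OF i e] S.T0(2)[OF i \<theta>e] lab[OF _ i, of 0] \<theta>g[OF i] \<theta>0
      unfolding R.g_def[symmetric] S.g_def[symmetric] by simp
    show "\<theta> (R.g i \<otimes>\<^bsub>R\<^esub> e) = S.g i \<otimes>\<^bsub>S\<^esub> \<theta> e"
      using R.T1(2)[OF i e] S.T1(2)[OF i \<theta>e] lab[OF _ i, of 1] \<theta>g[OF i] \<theta>0
      unfolding R.g_def[symmetric] S.g_def[symmetric] by simp
  qed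
  have wG: "R.v (w k) \<in> G" if k: "k < 2" for k
  proof (rule GI)
    show "R.v (w k) \<in> carrier R" using R.w[OF k] by simp
    fix i assume i: "i < n"
    show "\<theta> (R.v (w k) \<otimes>\<^bsub>R\<^esub> R.g i) = \<theta> (R.v (w k)) \<otimes>\<^bsub>S\<^esub> S.g i"
      using R.Tl[OF i k] S.Tl[OF i k] \<theta>T[of "2 + k" i] \<theta>w[OF k] i k
      unfolding R.g_def[symmetric] S.g_def[symmetric] by simp
    show "\<theta> (R.g i \<otimes>\<^bsub>R\<^esub> R.v (w k)) = S.g i \<otimes>\<^bsub>S\<^esub> \<theta> (R.v (w k))"
      using R.Tr[OF i k] S.Tr[OF i k] \<theta>T[of "4 + k" i] \<theta>w[OF k] i k
      unfolding R.g_def[symmetric] S.g_def[symmetric] by simp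
  qed
  let ?N = "jacobson_radical R"
  interpret N: additive_subgroup ?N R by (rule R.jacobson_additive_subgroup)
  have Nr: "x \<otimes>\<^bsub>R\<^esub> y \<in> ?N" if "x \<in> ?N" "y \<in> carrier R" for x y
    using that R.nil_radical_r R.jacobson_eq_nil_radical R.jacobson_nilp by simp
  have Nl: "y \<otimes>\<^bsub>R\<^esub> x \<in> ?N" if "x \<in> ?N" "y \<in> carrier R" for x y
    using that by (rule R.jacobson_l[rotated])
  \<comment> \<open>\<open>G\<close> plus the radical is a subring because the radical is two-sided.
    Containing \<open>E\<close>, both \<open>w k\<close> and the radical, it is all of
    \<open>R\<close>.\<close>
  let ?K = "{a \<oplus>\<^bsub>R\<^esub> x |a x. a \<in> G \<and> x \<in> ?N}"
  have KI: "a \<oplus>\<^bsub>R\<^esub> x \<in> ?K" if "a \<in> G" "x \<in> ?N" for a x using that by blast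
  have subK: "additive_subgroup ?K R"
  proof (rule R.additive_subgroupI')
    show "?K \<subseteq> carrier R" using Gc by auto
    show "\<zero>\<^bsub>R\<^esub> \<in> ?K" using KI[OF GG.zero_closed N.zero_closed] by simp
    fix u v assume "u \<in> ?K" "v \<in> ?K"
    then obtain a x b y where uv: "u = a \<oplus>\<^bsub>R\<^esub> x" "a \<in> G" "x \<in> ?N" "v = b \<oplus>\<^bsub>R\<^esub> y" "b \<in> G" "y \<in> ?N"
      by blast
    have "u \<ominus>\<^bsub>R\<^esub> v = (a \<ominus>\<^bsub>R\<^esub> b) \<oplus>\<^bsub>R\<^esub> (x \<ominus>\<^bsub>R\<^esub> y)"
      using uv Gc by (simp add: a_minus_def R.minus_add R.a_ac)
    moreover have "a \<ominus>\<^bsub>R\<^esub> b \<in> G" "x \<ominus>\<^bsub>R\<^esub> y \<in> ?N"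
      using uv R.additive_subgroup_minus[OF Gadd] R.additive_subgroup_minus[OF R.jacobson_additive_subgroup]
      by auto
    ultimately show "u \<ominus>\<^bsub>R\<^esub> v \<in> ?K" using KI by simp
  qed
  have "subrng ?K R"
    unfolding subrng_def
  proof (intro conjI ballI)
    fix u v assume "u \<in> ?K" "v \<in> ?K"
    then obtain a x b y where uv: "u = a \<oplus>\<^bsub>R\<^esub> x" "a \<in> G" "x \<in> ?N" "v = b \<oplus>\<^bsub>R\<^esub> y" "b \<in> G" "y \<in> ?N"
      by blast
    have c: "a \<in> carrier R" "b \<in> carrier R" "x \<in> carrier R" "y \<in> carrier R" using uv Gc by auto
    have "u \<otimes>\<^bsub>R\<^esub> v = a \<otimes>\<^bsub>R\<^esub> b \<oplus>\<^bsub>R\<^esub> (a \<otimes>\<^bsub>R\<^esub> y \<oplus>\<^bsub>R\<^esub> x \<otimes>\<^bsub>R\<^esub> (b \<oplus>\<^bsub>R\<^esub> y))"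
      unfolding uv using c R.rng_m_closed by (simp add: R.rng_l_distr R.rng_r_distr R.a_ac)
    moreover have "a \<otimes>\<^bsub>R\<^esub> y \<oplus>\<^bsub>R\<^esub> x \<otimes>\<^bsub>R\<^esub> (b \<oplus>\<^bsub>R\<^esub> y) \<in> ?N" using uv c Nl Nr by simp
    ultimately show "u \<otimes>\<^bsub>R\<^esub> v \<in> ?K" using KI Gmult uv by simp
  qed (rule subK)
  moreover have GK: "a \<in> ?K" if "a \<in> G" for a using KI[OF that N.zero_closed] Gc[OF that] by simp
  moreover have "x \<in> ?K" if "x \<in> ?N" for x using KI[OF GG.zero_closed that] that by simp
  ultimately have "carrier R \<subseteq> ?K" using EG wG by (intro R.generates) auto
  then have split: "\<exists>a\<in>G. \<exists>y\<in>?N. x = a \<oplus>\<^bsub>R\<^esub> y" if "x \<in> carrier R" for x using that by blast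
  \<comment> \<open>Products inside the radical agree because both are computed in \<open>J\<close>.
    Splitting the second factor, then the first, extends this to all products.\<close>
  have NN: "\<theta> (x \<otimes>\<^bsub>R\<^esub> y) = \<theta> x \<otimes>\<^bsub>S\<^esub> \<theta> y" if xy: "x \<in> ?N" "y \<in> ?N" for x y
  proof -
    obtain i where i: "x = \<phi> i" "i \<in> carrier J" using xy R.phi_image by blast
    obtain j where j: "y = \<phi> j" "j \<in> carrier J" using xy R.phi_image by blast
    show ?thesis using i j R.phi_mult[of i j] S.phi_mult[of i j] \<theta>\<phi> R.J.rng_m_closed by metis
  qed
  have NR: "\<theta> (x \<otimes>\<^bsub>R\<^esub> y) = \<theta> x \<otimes>\<^bsub>S\<^esub> \<theta> y" if x: "x \<in> ?N" and y: "y \<in> carrier R" for x y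
  proof -
    obtain a z where az: "a \<in> G" "z \<in> ?N" "y = a \<oplus>\<^bsub>R\<^esub> z" using split[OF y] by blast
    have c: "a \<in> carrier R" "x \<in> carrier R" "z \<in> carrier R" using az x Gc by auto
    then show ?thesis
      using Gm(2)[OF az(1), of x] NN[OF x az(2)] add \<theta>c R.rng_m_closed az(3)
      by (simp add: R.rng_r_distr S.rng_r_distr)
  qed
  have "\<theta> (x \<otimes>\<^bsub>R\<^esub> y) = \<theta> x \<otimes>\<^bsub>S\<^esub> \<theta> y" if x: "x \<in> carrier R" and y: "y \<in> carrier R" for x y
  proof -
    obtain a z where az: "a \<in> G" "z \<in> ?N" "x = a \<oplus>\<^bsub>R\<^esub> z" using split[OF x] by blast
    have c: "a \<in> carrier R" "z \<in> carrier R" using az Gc by auto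
    then show ?thesis
      using Gm(1)[OF az(1) y] NR[OF az(2) y] add \<theta>c R.rng_m_closed az(3) y
      by (simp add: R.rng_l_distr S.rng_l_distr)
  qed
  then have "\<theta> \<in> rng_iso R S" using hom bij \<theta>c by (simp add: rng_iso_def hom_def Pi_iff)
  then show ?thesis unfolding rng_isomorphic_def by blast
qed

section \<open>Existence of presentations\<close>

lemma (in rng) abelian_group_jacobson: "abelian_group (jacobson_radical_rng R)"
proof -
  interpret N: additive_subgroup "jacobson_radical R" R by (rule jacobson_additive_subgroup)
  show ?thesis
  proof (rule abelian_groupI)
    fix x assume "x \<in> carrier (jacobson_radical_rng R)"
    then have x: "x \<in> jacobson_radical R" by (simp add: jacobson_radical_rng_def)
    then have "\<ominus> x \<in> jacobson_radical R" "\<ominus> x \<oplus> x = \<zero>" by (simp_all add: l_neg)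
    then show "\<exists>y\<in>carrier (jacobson_radical_rng R).
        y \<oplus>\<^bsub>jacobson_radical_rng R\<^esub> x = \<zero>\<^bsub>jacobson_radical_rng R\<^esub>"
      by (auto simp: jacobson_radical_rng_def)
  qed (auto simp: jacobson_radical_rng_def a_ac)
qed

lemma finite_nil_rngI:
  assumes R: "rng R" "finite (carrier R)" and J: "rng J" "nilpotent_rng J"
    and iso: "rng_isomorphic (jacobson_radical_rng R) J"
  shows "finite_nil_rng R"
proof -
  interpret R: rng R by fact
  interpret J: rng J by fact
  obtain h where h: "h \<in> rng_iso (jacobson_radical_rng R) J" using iso unfolding rng_isomorphic_def by blast
  have hadd: "h \<in> hom (add_monoid (jacobson_radical_rng R)) (add_monoid J)"
    and bij: "bij_betw h (jacobson_radical R) (carrier J)"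
    and hm: "\<And>x y. x \<in> jacobson_radical R \<Longrightarrow> y \<in> jacobson_radical R \<Longrightarrow> h (x \<otimes>\<^bsub>R\<^esub> y) = h x \<otimes>\<^bsub>J\<^esub> h y"
    using h by (simp_all add: rng_iso_def jacobson_radical_rng_def hom_def)
  have h0: "h \<zero>\<^bsub>R\<^esub> = \<zero>\<^bsub>J\<^esub>"
    using hom_add_zero[OF R.abelian_group_jacobson J.abelian_group_axioms hadd]
    by (simp add: jacobson_radical_rng_def)
  have zero: "\<zero>\<^bsub>R\<^esub> \<in> jacobson_radical R"
    by (rule additive_subgroup.zero_closed[OF R.jacobson_additive_subgroup])
  obtain m where m: "m \<ge> 1" "\<And>x xs. set (x # xs) \<subseteq> carrier J \<Longrightarrow> length (x # xs) = m \<Longrightarrow>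
      foldl (\<otimes>\<^bsub>J\<^esub>) x xs = \<zero>\<^bsub>J\<^esub>"
    using J(2) unfolding nilpotent_rng_def by blast
  have "nilp R x" if x: "x \<in> jacobson_radical R" for x
  proof -
    have xc: "x \<in> carrier R" using x by (simp add: jacobson_radical_def)
    have hx: "h x \<in> carrier J" using bij x by (auto simp: bij_betw_def)
    have pj: "npow R x k \<in> jacobson_radical R" for k
      using x xc R.jacobson_l R.npow_closed by (induct k) auto
    have "h (npow R x k) = npow J (h x) k" for k
      using x pj hm by (induct k) auto
    \<comment> \<open>\<open>npow\<close> with exponent \<open>m - 1\<close> has \<open>m\<close>
      factors.\<close>
    moreover have "npow J (h x) (m - 1) = \<zero>\<^bsub>J\<^esub>"
      unfolding npow_foldl using m hx by (intro m(2)) auto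
    ultimately have "h (npow R x (m - 1)) = h \<zero>\<^bsub>R\<^esub>" using h0 by simp
    then have "npow R x (m - 1) = \<zero>\<^bsub>R\<^esub>"
      using bij pj zero by (meson bij_betw_def inj_onD)
    then show ?thesis by (auto simp: nilp_def)
  qed
  then show ?thesis using R by (simp add: finite_nil_rng_def finite_nil_rng_axioms_def)
qed

lemma presentation_exists:
  fixes R :: "'a ring" and J :: "'b ring"
  assumes R: "finite_nil_rng R" and J: "rng J" and p: "Factorial_Ring.prime p"
    and n: "card (carrier R) = p ^ n" and r: "card (carrier J) = p ^ r" "r \<le> n"
    and phi: "\<phi> \<in> rng_iso J (jacobson_radical_rng R)"
  shows "\<exists>ys E js zs T w. presentation R J \<phi> ys E p (n - r) n js zs T w
    \<and> js \<in> {..<n - r} \<rightarrow>\<^sub>E carrier J \<and> zs \<in> {..<r} \<rightarrow>\<^sub>E carrier J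
    \<and> T \<in> {..<6} \<rightarrow>\<^sub>E ({..<n} \<rightarrow>\<^sub>E coords p (n - r) J) \<and> w \<in> {..<2} \<rightarrow>\<^sub>E coords p (n - r) J"
proof -
  interpret R: finite_nil_rng R by fact
  interpret J: rng J by fact
  define m where "m = n - r"
  have nm: "n - m = r" "m \<le> n" "r + m = n" using r by (auto simp: m_def)
  have p1: "p > 1" using p prime_gt_1_nat by blast
  let ?N = "jacobson_radical R" and ?C = "coords p m J"
  interpret N: additive_subgroup ?N R by (rule R.jacobson_additive_subgroup)
  have nil: "?N = nil_radical R" using R.jacobson_eq_nil_radical R.jacobson_nilp by blast
  have phom: "\<phi> \<in> hom (add_monoid J) (add_monoid R)"
    using phi N.a_subset by (auto simp: rng_iso_def hom_def jacobson_radical_rng_def)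
  have bijphi: "bij_betw \<phi> (carrier J) ?N"
    using phi by (simp add: rng_iso_def jacobson_radical_rng_def)
  then have im: "\<phi> ` carrier J = ?N" and injphi: "inj_on \<phi> (carrier J)" by (simp_all add: bij_betw_def)
  have cardN: "card ?N = p ^ r" using bij_betw_same_card[OF bijphi] r by simp
  have finJ: "finite (carrier J)" by (rule card_ge_0_finite) (use r(1) p1 in simp)
  obtain E where "maximal_orth_idempotents R E" using R.maximal_orth_idempotents_exist by blast
  then interpret M: maximal_orth_idempotents R E .
  let ?H = "homogeneous R E"
  \<comment> \<open>The power \<open>(p s x)^(n+1)\<close> contains the factor
    \<open>p^(n+1)\<close>, while \<open>p^n\<close> kills \<open>R\<close>. So \<open>p\<close>
    times a generator has a preimage in \<open>J\<close>, which becomes \<open>js\<close>.\<close>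
  have pN: "[p] \<cdot>\<^bsub>R\<^esub> x \<in> ?N" if x: "x \<in> carrier R" for x
  proof -
    have pm: "y \<otimes>\<^bsub>R\<^esub> [(k::nat)] \<cdot>\<^bsub>R\<^esub> z = [k] \<cdot>\<^bsub>R\<^esub> (y \<otimes>\<^bsub>R\<^esub> z)"
      "[(k::nat)] \<cdot>\<^bsub>R\<^esub> y \<otimes>\<^bsub>R\<^esub> z = [k] \<cdot>\<^bsub>R\<^esub> (y \<otimes>\<^bsub>R\<^esub> z)"
      if "y \<in> carrier R" "z \<in> carrier R" for k y z
      using that by (induct k) (simp_all add: R.rng_r_distr R.rng_l_distr R.rng_m_closed)
    have pp: "npow R ([p] \<cdot>\<^bsub>R\<^esub> y) k = [(p ^ Suc k)] \<cdot>\<^bsub>R\<^esub> npow R y k" if "y \<in> carrier R" for y k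
    proof (induct k)
      case (Suc k)
      then show ?case using that pm R.rng_m_closed by (simp add: R.add.nat_pow_pow mult.commute mult.left_commute)
    qed (use that in simp)
    have "nilp R (s \<otimes>\<^bsub>R\<^esub> [p] \<cdot>\<^bsub>R\<^esub> x)" if s: "s \<in> carrier R" for s
    proof -
      let ?y = "s \<otimes>\<^bsub>R\<^esub> x"
      have y: "?y \<in> carrier R" using s x R.rng_m_closed by simp
      have o: "[(p ^ n)] \<cdot>\<^bsub>R\<^esub> npow R ?y n = \<zero>\<^bsub>R\<^esub>"
        using R.add.pow_order_eq_1[of "npow R ?y n"] y n by (simp add: order_def)
      have "[(p ^ Suc n)] \<cdot>\<^bsub>R\<^esub> npow R ?y n = [p] \<cdot>\<^bsub>R\<^esub> ([(p ^ n)] \<cdot>\<^bsub>R\<^esub> npow R ?y n)"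
        using y by (simp add: R.add.nat_pow_pow mult.commute)
      then have "npow R ([p] \<cdot>\<^bsub>R\<^esub> ?y) n = \<zero>\<^bsub>R\<^esub>" using pp[OF y] o by simp
      then show ?thesis using pm(1)[OF s x] unfolding nilp_def by metis
    qed
    then show ?thesis unfolding nil using x by (simp add: nil_radical_def)
  qed
  have Hc: "?H \<subseteq> carrier R" by (auto simp: homogeneous_def)
  have Nlr: "e \<otimes>\<^bsub>R\<^esub> x \<in> ?N \<and> x \<otimes>\<^bsub>R\<^esub> e \<in> ?N" if "e \<in> E" "x \<in> ?N" for e x
    using that unfolding nil by (simp add: R.nil_radical_l R.nil_radical_r)
  have carr: "additive_subgroup (carrier R) R" by (rule R.additive_subgroupI') simp_all
  have spanR: "carrier R \<subseteq> K" if K: "additive_subgroup K R" "?N \<subseteq> K" "?H \<subseteq> K" for K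
  proof (rule M.homogeneous_spans[OF carr _ K(1)])
    show "carrier R \<inter> ?H \<subseteq> K" using K(3) by blast
  qed (simp add: R.rng_m_closed)
  have "\<exists>ys::nat \<Rightarrow> 'a. (\<forall>i<m. ys i \<in> ?H) \<and>
      (\<forall>K. additive_subgroup K R \<and> ?N \<subseteq> K \<and> ys ` {..<m} \<subseteq> K \<longrightarrow> carrier R \<subseteq> K)"
    by (rule R.prime_power_generators[OF p R.finite_carrier n Hc N.is_additive_subgroup cardN nm(3)])
      (rule spanR)
  then obtain ys :: "nat \<Rightarrow> 'a" where ys: "\<forall>i<m. ys i \<in> ?H"
    "\<forall>K. additive_subgroup K R \<and> ?N \<subseteq> K \<and> ys ` {..<m} \<subseteq> K \<longrightarrow> carrier R \<subseteq> K"
    by (elim exE conjE)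
  have ysH: "ys i \<in> ?H" if "i < m" for i using ys(1) that by simp
  have ysgen: "carrier R \<subseteq> K" if "additive_subgroup K R" "?N \<subseteq> K" "ys ` {..<m} \<subseteq> K" for K
    using ys(2) that by simp
  have ysc: "ys i \<in> carrier R" if "i < m" for i using ysH[OF that] Hc by blast
  \<comment> \<open>The radical gets homogeneous generators by the same order argument, carried out
    in \<open>J\<close> from the zero subgroup of order \<open>p^0\<close>.\<close>
  let ?HJ = "{u \<in> carrier J. \<phi> u \<in> ?H}"
  have J0: "additive_subgroup {\<zero>\<^bsub>J\<^esub>} J" by (intro J.additive_subgroupI') auto
  have imsub: "additive_subgroup (\<phi> ` K) R" if K: "additive_subgroup K J" for K
  proof -
    interpret K: additive_subgroup K J by fact
    have mi: "\<phi> (u \<ominus>\<^bsub>J\<^esub> v) = \<phi> u \<ominus>\<^bsub>R\<^esub> \<phi> v" if "u \<in> K" "v \<in> K" for u v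
      using hom_add_minus[OF J.abelian_group_axioms R.abelian_group_axioms phom] that by simp
    show ?thesis
    proof (rule R.additive_subgroupI')
      show "\<phi> ` K \<subseteq> carrier R" using im N.a_subset K.a_subset by blast
      show "\<zero>\<^bsub>R\<^esub> \<in> \<phi> ` K"
        using hom_add_zero[OF J.abelian_group_axioms R.abelian_group_axioms phom] K.zero_closed
        by (metis imageI)
      fix x y assume "x \<in> \<phi> ` K" "y \<in> \<phi> ` K"
      then obtain u v where uv: "u \<in> K" "x = \<phi> u" "v \<in> K" "y = \<phi> v" by (elim imageE)
      have "u \<ominus>\<^bsub>J\<^esub> v \<in> K" using J.additive_subgroup_minus[OF K] uv by blast
      then show "x \<ominus>\<^bsub>R\<^esub> y \<in> \<phi> ` K" unfolding uv(2,4) mi[OF uv(1,3), symmetric] by (rule imageI)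
    qed
  qed
  have spanJ: "carrier J \<subseteq> K" if K: "additive_subgroup K J" "{\<zero>\<^bsub>J\<^esub>} \<subseteq> K" "?HJ \<subseteq> K" for K
  proof -
    have "?N \<inter> ?H \<subseteq> \<phi> ` K"
    proof
      fix x assume x: "x \<in> ?N \<inter> ?H"
      then obtain u where "u \<in> carrier J" "x = \<phi> u" using im by blast
      then show "x \<in> \<phi> ` K" using x K(3) by blast
    qed
    then have "\<phi> ` carrier J \<subseteq> \<phi> ` K"
      unfolding im using Nlr by (intro M.homogeneous_spans[OF N.is_additive_subgroup _ imsub[OF K(1)]])
    then show ?thesis
      using inj_on_image_mem_iff[OF injphi _ additive_subgroup.a_subset[OF K(1)]] by blast
  qed
  have HJ: "?HJ \<subseteq> carrier J" "card {\<zero>\<^bsub>J\<^esub>} = p ^ 0" "0 + r = r" by auto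
  have "\<exists>zs::nat \<Rightarrow> 'b. (\<forall>i<r. zs i \<in> ?HJ) \<and>
      (\<forall>K. additive_subgroup K J \<and> {\<zero>\<^bsub>J\<^esub>} \<subseteq> K \<and> zs ` {..<r} \<subseteq> K \<longrightarrow> carrier J \<subseteq> K)"
    by (rule J.prime_power_generators[OF p finJ r(1) HJ(1) J0 HJ(2,3)]) (rule spanJ)
  then obtain zs :: "nat \<Rightarrow> 'b" where zs: "\<forall>i<r. zs i \<in> ?HJ"
    "\<forall>K. additive_subgroup K J \<and> {\<zero>\<^bsub>J\<^esub>} \<subseteq> K \<and> zs ` {..<r} \<subseteq> K \<longrightarrow> carrier J \<subseteq> K"
    by (elim exE conjE)
  have zsH: "zs i \<in> ?HJ" if "i < r" for i using zs(1) that by simp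
  have zsgen: "carrier J \<subseteq> K" if "additive_subgroup K J" "{\<zero>\<^bsub>J\<^esub>} \<subseteq> K" "zs ` {..<r} \<subseteq> K" for K
    using zs(2) that by simp
  define js where "js = (\<lambda>i\<in>{..<m}. inv_into (carrier J) \<phi> ([p] \<cdot>\<^bsub>R\<^esub> ys i))"
  have js: "js i \<in> carrier J" "\<phi> (js i) = [p] \<cdot>\<^bsub>R\<^esub> ys i" if "i < m" for i
    using pN[OF ysc[OF that]] that unfolding im[symmetric]
    by (simp_all add: js_def inv_into_into f_inv_into_f)
  interpret co: coordinates R J \<phi> ys js p m
  proof unfold_locales
    show "\<phi> \<in> hom (add_monoid J) (add_monoid R)" by (rule phom)
    show "p > 0" using p1 by simp
  qed (simp_all add: ysc js)
  let ?v = "val R \<phi> ys m"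
  have vim: "?v ` ?C = carrier R"
  proof (rule co.val_onto[OF R.finite_carrier])
    fix K assume "additive_subgroup K R" "\<phi> ` carrier J \<subseteq> K" "ys ` {..<m} \<subseteq> K"
    then show "carrier R \<subseteq> K" unfolding im by (rule ysgen)
  qed
  have cardC: "card ?C = p ^ n" using r(1) nm by (simp add: card_coords power_add[symmetric] add.commute)
  \<comment> \<open>A map onto \<open>R\<close> from a set of the same size \<open>p^n\<close> is
    injective: coordinates are unique.\<close>
  have "inj_on ?v ?C"
    using vim cardC n finite_coords[OF finJ] by (intro eq_card_imp_inj_on) auto
  then have bij: "bij_betw ?v ?C (carrier R)" using vim by (simp add: bij_betw_def)
  define c where "c x = inv_into ?C ?v x" for x
  have c: "c x \<in> ?C" "?v (c x) = x" if "x \<in> carrier R" for x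
    using that unfolding vim[symmetric] c_def by (rule inv_into_into, rule f_inv_into_f)
  \<comment> \<open>Restricted to the index range, as \<open>js\<close> is: codes have to range over
    a finite set of functions.\<close>
  define zs' where "zs' = (\<lambda>i\<in>{..<r}. zs i)"
  define g where "g i = (if i < m then ys i else \<phi> (zs' (i - m)))" for i
  have gH: "g i \<in> ?H" if "i < n" for i
  proof (cases "i < m")
    case False
    then have "i - m < r" using that nm by simp
    then show ?thesis using False zsH[of "i - m"] by (simp add: g_def zs'_def)
  qed (simp add: g_def ysH)
  have gc: "g i \<in> carrier R" if "i < n" for i using gH[OF that] Hc by blast
  obtain b d where bd: "b \<in> carrier R" "d \<in> carrier R"
    and gen: "\<forall>K. subrng K R \<and> E \<subseteq> K \<and> b \<in> K \<and> d \<in> K \<and> nil_radical R \<subseteq> K \<longrightarrow> carrier R \<subseteq> K"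
    using M.generated_mod_radical by (elim bexE)
  define bb where "bb k = (if k = 0 then b else d)" for k :: nat
  define lab where "lab i = (SOME f. f \<in> insert \<zero>\<^bsub>R\<^esub> E \<and>
    (\<forall>e\<in>E. e \<otimes>\<^bsub>R\<^esub> g i = (if e = f then g i else \<zero>\<^bsub>R\<^esub>)))" for i
  define rab where "rab i = (SOME f. f \<in> insert \<zero>\<^bsub>R\<^esub> E \<and>
    (\<forall>e\<in>E. g i \<otimes>\<^bsub>R\<^esub> e = (if e = f then g i else \<zero>\<^bsub>R\<^esub>)))" for i
  have gH': "(\<exists>f\<in>insert \<zero>\<^bsub>R\<^esub> E. \<forall>e\<in>E. e \<otimes>\<^bsub>R\<^esub> g i = (if e = f then g i else \<zero>\<^bsub>R\<^esub>))
      \<and> (\<exists>f\<in>insert \<zero>\<^bsub>R\<^esub> E. \<forall>e\<in>E. g i \<otimes>\<^bsub>R\<^esub> e = (if e = f then g i else \<zero>\<^bsub>R\<^esub>))" if "i < n" for i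
    using gH[OF that] by (simp only: homogeneous_def mem_Collect_eq simp_thms)
  have lab: "lab i \<in> insert \<zero>\<^bsub>R\<^esub> E \<and> (\<forall>e\<in>E. e \<otimes>\<^bsub>R\<^esub> g i = (if e = lab i then g i else \<zero>\<^bsub>R\<^esub>))" if "i < n" for i
    unfolding lab_def by (rule someI_ex[OF conjunct1[OF gH'[OF that], unfolded Bex_def]])
  have rab: "rab i \<in> insert \<zero>\<^bsub>R\<^esub> E \<and> (\<forall>e\<in>E. g i \<otimes>\<^bsub>R\<^esub> e = (if e = rab i then g i else \<zero>\<^bsub>R\<^esub>))" if "i < n" for i
    unfolding rab_def by (rule someI_ex[OF conjunct2[OF gH'[OF that], unfolded Bex_def]])
  define t where "t k i = (if k = 0 then lab i else if k = 1 then rab i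
    else if k < 4 then bb (k - 2) \<otimes>\<^bsub>R\<^esub> g i else g i \<otimes>\<^bsub>R\<^esub> bb (k - 4))" for k i :: nat
  have tc: "t k i \<in> carrier R" if "i < n" for k i
    using lab[OF that] rab[OF that] gc[OF that] bd R.rng_m_closed by (auto simp: t_def bb_def)
  define T where "T = (\<lambda>k\<in>{..<6}. \<lambda>i\<in>{..<n}. c (t k i))"
  define w where "w = (\<lambda>k\<in>{..<2}. c (bb k))"
  have vT: "?v (T k i) = t k i" if "k < 6" "i < n" for k i
    using that c(2)[OF tc[OF that(2)]] by (simp add: T_def)
  have bbc: "bb k \<in> carrier R" for k using bd by (simp add: bb_def)
  have vw: "?v (w k) = bb k" if "k < 2" for k
    using that c(2)[OF bbc] by (simp add: w_def)
  have spans: "carrier R \<subseteq> K" if K: "additive_subgroup K R" and gK: "\<And>i. i < n \<Longrightarrow> g i \<in> K" for K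
  proof -
    interpret K: additive_subgroup K R by fact
    let ?L = "{u \<in> carrier J. \<phi> u \<in> K}"
    have "additive_subgroup ?L J"
    proof (rule J.additive_subgroupI')
      show "\<zero>\<^bsub>J\<^esub> \<in> ?L" using co.phi_zero K.zero_closed by simp
      show "u \<ominus>\<^bsub>J\<^esub> v \<in> ?L" if "u \<in> ?L" "v \<in> ?L" for u v
        using hom_add_minus[OF J.abelian_group_axioms R.abelian_group_axioms phom, of u v]
          R.additive_subgroup_minus[OF K] that by auto
    qed auto
    moreover have "zs ` {..<r} \<subseteq> ?L"
    proof (rule image_subsetI)
      fix i assume "i \<in> {..<r}"
      then show "zs i \<in> ?L" using gK[of "i + m"] zsH[of i] nm by (simp add: g_def zs'_def)
    qed
    ultimately have "carrier J \<subseteq> ?L"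
      using co.phi_zero K.zero_closed by (intro zsgen) auto
    then have "?N \<subseteq> K" unfolding im[symmetric] by blast
    moreover have "ys ` {..<m} \<subseteq> K"
    proof (rule image_subsetI)
      fix i assume "i \<in> {..<m}"
      then show "ys i \<in> K" using gK[of i] nm by (simp add: g_def)
    qed
    ultimately show ?thesis using ysgen K by blast
  qed
  have mem: "js \<in> {..<m} \<rightarrow>\<^sub>E carrier J" "zs' \<in> {..<r} \<rightarrow>\<^sub>E carrier J"
    "T \<in> {..<6} \<rightarrow>\<^sub>E ({..<n} \<rightarrow>\<^sub>E ?C)" "w \<in> {..<2} \<rightarrow>\<^sub>E ?C"
    using js zsH c(1)[OF tc] c(1)[OF bbc] unfolding T_def w_def zs'_def
    by (auto simp: js_def)
  have "presentation R J \<phi> ys E p m n js zs' T w"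
  proof (intro presentation.intro presentation_axioms.intro, unfold g_def[symmetric])
    fix i e assume i: "i < n" and e: "e \<in> E"
    show "e \<otimes>\<^bsub>R\<^esub> g i = (if e = ?v (T 0 i) then g i else \<zero>\<^bsub>R\<^esub>)"
      using lab[OF i] e vT[OF _ i, of 0] by (simp add: t_def)
    show "g i \<otimes>\<^bsub>R\<^esub> e = (if e = ?v (T 1 i) then g i else \<zero>\<^bsub>R\<^esub>)"
      using rab[OF i] e vT[OF _ i, of 1] by (simp add: t_def)
  next
    fix i assume i: "i < n"
    show "?v (T 0 i) \<in> insert \<zero>\<^bsub>R\<^esub> E" "?v (T 1 i) \<in> insert \<zero>\<^bsub>R\<^esub> E"
      using lab[OF i] rab[OF i] vT[OF _ i, of 0] vT[OF _ i, of 1] by (simp_all add: t_def)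
  next
    fix i k :: nat assume i: "i < n" and k: "k < 2"
    show "?v (w k) \<otimes>\<^bsub>R\<^esub> g i = ?v (T (2 + k) i)" "g i \<otimes>\<^bsub>R\<^esub> ?v (w k) = ?v (T (4 + k) i)"
      using vT[OF _ i, of "2 + k"] vT[OF _ i, of "4 + k"] vw[OF k] k by (simp_all add: t_def)
  next
    fix e assume "e \<in> E"
    then show "e \<in> carrier R \<and> e \<otimes>\<^bsub>R\<^esub> e = e \<and> e \<noteq> \<zero>\<^bsub>R\<^esub>" using M.E_mult[of e e] M.E_nonzero by simp
  next
    fix K assume K: "subrng K R" "E \<subseteq> K" "\<And>k. k < 2 \<Longrightarrow> ?v (w k) \<in> K" "?N \<subseteq> K"
    have "b \<in> K" "d \<in> K" using K(3)[of 0] K(3)[of 1] vw by (simp_all add: bb_def)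
    then show "carrier R \<subseteq> K" using gen K nil by simp
  next
    show "finite_nil_rng R" "rng J" by fact+
    fix i assume "i < n - m"
    then show "zs' i \<in> carrier J" using zsH[of i] nm by (simp add: zs'_def)
  next
    fix K assume "additive_subgroup K R" "\<And>i. i < n \<Longrightarrow> g i \<in> K"
    then show "carrier R \<subseteq> K" by (rule spans)
  qed (use phi p1 nm js ysc mem bij in \<open>auto simp: PiE_iff\<close>)
  then show ?thesis using mem unfolding m_def by blast
qed

section \<open>Counting\<close>

text \<open>The code \<open>f\<close> need not be constant on classes. Equal codes force
  \<open>P\<close>, so a class is determined by the code of any one of its members.\<close>

lemma card_quotient_le:
  assumes sym: "\<And>x y. x \<in> A \<Longrightarrow> y \<in> A \<Longrightarrow> P x y \<Longrightarrow> P y x"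
    and trans: "\<And>x y z. x \<in> A \<Longrightarrow> y \<in> A \<Longrightarrow> z \<in> A \<Longrightarrow> P x y \<Longrightarrow> P y z \<Longrightarrow> P x z"
    and W: "finite W" and f: "\<And>x. x \<in> A \<Longrightarrow> f x \<in> W"
    and eq: "\<And>x y. x \<in> A \<Longrightarrow> y \<in> A \<Longrightarrow> f x = f y \<Longrightarrow> P x y"
  shows "finite (A // {(x, y). x \<in> A \<and> y \<in> A \<and> P x y}) \<and> card (A // {(x, y). x \<in> A \<and> y \<in> A \<and> P x y}) \<le> card W"
proof -
  let ?r = "{(x, y). x \<in> A \<and> y \<in> A \<and> P x y}"
  let ?h = "\<lambda>c. ?r `` {SOME x. x \<in> A \<and> f x = c}"
  have "A // ?r \<subseteq> ?h ` W"
  proof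
    fix X assume "X \<in> A // ?r"
    then obtain x where x: "x \<in> A" "X = ?r `` {x}" by (rule quotientE)
    define y where "y = (SOME y. y \<in> A \<and> f y = f x)"
    have y: "y \<in> A" "f y = f x" using someI[of "\<lambda>y. y \<in> A \<and> f y = f x" x] x by (auto simp: y_def)
    have "P x y" "P y x" using eq x y by auto
    then have "X = ?r `` {y}" using x y sym trans by blast
    then show "X \<in> ?h ` W" unfolding y_def using f[OF x(1)] by (intro image_eqI[of _ _ "f x"])
  qed
  then show ?thesis
    using W by (meson card_image_le card_mono finite_imageI finite_subset le_trans)
qed

lemma counting_bound_exponent:
  "\<exists>C::real. \<forall>q m :: nat. Factorial_Ring.prime q \<and> 1 \<le> m \<longrightarrow>
     (\<exists>e::real. \<bar>e\<bar> \<le> C * (real m)\<^sup>2 \<and> real (m * q ^ (7 * m\<^sup>2 + 9 * m + 2)) = real q powr e)"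
\<comment> \<open>From \<open>m < 2^m \<le> q^m\<close> the factor \<open>m\<close> adds at most
  \<open>m\<close> to the exponent, and \<open>m + 7 m^2 + 9 m + 2\<close> is at most
  \<open>(1 + 7 + 9 + 2) m^2\<close>.\<close>
proof (rule exI[of _ 19], intro allI impI)
  fix q m :: nat
  assume qm: "Factorial_Ring.prime q \<and> 1 \<le> m"
  then have q: "real q > 1" and m: "real m \<ge> 1" using prime_gt_1_nat[of q] by auto
  define k where "k = 7 * m\<^sup>2 + 9 * m + 2"
  let ?e = "log (real q) (real m) + real k"
  have "m < 2 ^ m" by (rule less_exp)
  also have "\<dots> \<le> q ^ m" using q by (intro power_mono) auto
  finally have "real m < real (q ^ m)" by (simp only: of_nat_less_iff)
  then have "real m \<le> real q powr real m" using q by (simp add: powr_realpow)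
  then have "log (real q) (real m) \<le> real m" using q m by (simp add: log_le_iff)
  moreover have "log (real q) (real m) \<ge> 0" using q m by simp
  moreover have "real m \<le> (real m)\<^sup>2" using m by (simp add: power2_eq_square)
  moreover have "real k = 7 * (real m)\<^sup>2 + 9 * real m + 2" by (simp add: k_def)
  ultimately have "\<bar>?e\<bar> \<le> 19 * (real m)\<^sup>2" using m by linarith
  moreover have "real (m * q ^ k) = real q powr ?e"
    using q m by (simp add: powr_add powr_realpow)
  ultimately show "\<exists>e::real. \<bar>e\<bar> \<le> 19 * (real m)\<^sup>2
      \<and> real (m * q ^ (7 * m\<^sup>2 + 9 * m + 2)) = real q powr e"
    unfolding k_def by blast
qed

theorem theorem3p5:
  fixes p r n :: nat and J :: "'b ring"
  assumes "prime p" and "r \<le> n" and "1 \<le> n"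
    and "rng J" and "nilpotent_rng J" and "finite (carrier J)" and "order J = p ^ r"
  shows "finite (rng_iso_classes (rngs_with_radical (p ^ n) J :: 'a ring set))
       \<and> card (rng_iso_classes (rngs_with_radical (p ^ n) J :: 'a ring set))
           \<le> n * p ^ (7 * n\<^sup>2 + 9 * n + 2)
       \<and> (\<exists>C::real. \<forall>q m :: nat. prime q \<and> 1 \<le> m \<longrightarrow>
            (\<exists>e::real. \<bar>e\<bar> \<le> C * (real m)\<^sup>2
               \<and> real (m * q ^ (7 * m\<^sup>2 + 9 * m + 2)) = real q powr e))"
proof -
  let ?A = "rngs_with_radical (p ^ n) J :: 'a ring set"
  define m where "m = n - r"
  have mr: "r + m = n" using assms(2) by (simp add: m_def)
  let ?C = "coords p m J"
  let ?W = "({..<m} \<rightarrow>\<^sub>E carrier J) \<times> ({..<r} \<rightarrow>\<^sub>E carrier J)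
    \<times> ({..<6::nat} \<rightarrow>\<^sub>E ({..<n} \<rightarrow>\<^sub>E ?C)) \<times> ({..<2::nat} \<rightarrow>\<^sub>E ?C)"
  have cardJ: "card (carrier J) = p ^ r" using assms(7) by (simp add: order_def)
  have cardC: "card ?C = p ^ n" using cardJ mr by (simp add: card_coords power_add[symmetric] add.commute)
  have finW: "finite ?W" using assms(6) finite_coords[OF assms(6)] by (intro finite_cartesian_product finite_PiE) auto
  \<comment> \<open>Each entry of \<open>js\<close> and \<open>zs\<close> costs \<open>r\<close>
    digits; each entry of the six rows of \<open>T\<close> and each of the two \<open>w k\<close>
    costs \<open>n\<close> digits.\<close>
  have "card ?W = (p ^ r) ^ m * ((p ^ r) ^ r * (((p ^ n) ^ n) ^ 6 * (p ^ n) ^ 2))"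
    by (simp add: card_cartesian_product card_PiE cardJ cardC)
  also have "\<dots> = p ^ (r * m + r * r + 6 * n * n + 2 * n)"
    by (simp add: power_mult[symmetric] power_add[symmetric] algebra_simps)
  also have "\<dots> \<le> p ^ (7 * n\<^sup>2 + 9 * n + 2)"
  proof (rule power_increasing)
    have "r * m + r * r = r * n" using mr by (simp add: distrib_left[symmetric] add.commute)
    also have "\<dots> \<le> n * n" using assms(2) by simp
    finally show "r * m + r * r + 6 * n * n + 2 * n \<le> 7 * n\<^sup>2 + 9 * n + 2"
      by (simp add: power2_eq_square)
  qed (use prime_ge_1_nat[OF assms(1)] in simp)
  also have "\<dots> \<le> n * p ^ (7 * n\<^sup>2 + 9 * n + 2)" using assms(3) by simp
  finally have cardW: "card ?W \<le> n * p ^ (7 * n\<^sup>2 + 9 * n + 2)" .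
  \<comment> \<open>The map \<open>\<phi>\<close>, the generators \<open>ys\<close> and the
    idempotents belong to the individual ring and are quantified away; two rings only have to share
    the code.\<close>
  define Q where "Q R c \<longleftrightarrow> (\<exists>\<phi> ys E. case c of (js, zs, T, w) \<Rightarrow> presentation R J \<phi> ys E p m n js zs T w)"
    for R :: "'a ring" and c
  have ex: "\<exists>c. c \<in> ?W \<and> Q R c" if R: "R \<in> ?A" for R
  proof -
    have R': "rng R" "finite (carrier R)" "card (carrier R) = p ^ n"
      and iso: "rng_isomorphic (jacobson_radical_rng R) J"
      using R by (simp_all add: rngs_with_radical_def order_def)
    interpret R: finite_nil_rng R by (rule finite_nil_rngI[OF R'(1,2) assms(4,5) iso])
    interpret N: additive_subgroup "jacobson_radical R" R by (rule R.jacobson_additive_subgroup)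
    obtain h where "h \<in> rng_iso (jacobson_radical_rng R) J" using iso unfolding rng_isomorphic_def by blast
    then have "inv_into (carrier (jacobson_radical_rng R)) h \<in> rng_iso J (jacobson_radical_rng R)"
    proof (rule rng_iso_inv_into)
      fix x y assume "x \<in> carrier (jacobson_radical_rng R)" "y \<in> carrier (jacobson_radical_rng R)"
      then have xy: "x \<in> jacobson_radical R" "y \<in> jacobson_radical R" by (simp_all add: jacobson_radical_rng_def)
      have "x \<otimes>\<^bsub>R\<^esub> y \<in> jacobson_radical R" by (rule R.jacobson_l[OF N.a_Hcarr[OF xy(1)] xy(2)])
      then show "x \<otimes>\<^bsub>jacobson_radical_rng R\<^esub> y \<in> carrier (jacobson_radical_rng R)"
        by (simp add: jacobson_radical_rng_def)
      have "x \<oplus>\<^bsub>R\<^esub> y \<in> jacobson_radical R" by (rule N.a_closed[OF xy])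
      then show "x \<oplus>\<^bsub>jacobson_radical_rng R\<^esub> y \<in> carrier (jacobson_radical_rng R)"
        by (simp add: jacobson_radical_rng_def)
    qed
    from presentation_exists[OF R.finite_nil_rng_axioms assms(4,1) R'(3) cardJ assms(2) this, folded m_def]
    obtain ys E js zs T w
      where pres: "presentation R J (inv_into (carrier (jacobson_radical_rng R)) h) ys E p m n js zs T w"
        and mem: "js \<in> {..<m} \<rightarrow>\<^sub>E carrier J" "zs \<in> {..<r} \<rightarrow>\<^sub>E carrier J"
          "T \<in> {..<6} \<rightarrow>\<^sub>E ({..<n} \<rightarrow>\<^sub>E ?C)" "w \<in> {..<2} \<rightarrow>\<^sub>E ?C"
      by (elim exE conjE)
    have "(js, zs, T, w) \<in> ?W" by (intro SigmaI mem)
    moreover have "Q R (js, zs, T, w)" unfolding Q_def prod.case by (intro exI) (rule pres)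
    ultimately show ?thesis by (intro exI conjI)
  qed
  define f where "f R = (SOME c. c \<in> ?W \<and> Q R c)" for R
  have f: "f R \<in> ?W" "Q R (f R)" if "R \<in> ?A" for R
    using someI_ex[OF ex[OF that]] unfolding f_def by (rule conjunct1, rule conjunct2)
  have rngA: "rng R" if "R \<in> ?A" for R using that by (simp add: rngs_with_radical_def)
  have "finite (?A // {(R, S). R \<in> ?A \<and> S \<in> ?A \<and> rng_isomorphic R S})
      \<and> card (?A // {(R, S). R \<in> ?A \<and> S \<in> ?A \<and> rng_isomorphic R S}) \<le> card ?W"
  proof (rule card_quotient_le[where f = f])
    show "finite ?W" by (rule finW)
    show "f R \<in> ?W" if "R \<in> ?A" for R by (rule f(1)[OF that])
    show "rng_isomorphic S R" if RS: "R \<in> ?A" "S \<in> ?A" "rng_isomorphic R S" for R S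
    proof -
      interpret R: rng R by (rule rngA[OF RS(1)])
      obtain h where "h \<in> rng_iso R S" using RS(3) unfolding rng_isomorphic_def by blast
      then have "inv_into (carrier R) h \<in> rng_iso S R"
        by (rule rng_iso_inv_into) (simp_all add: R.rng_m_closed)
      then show ?thesis unfolding rng_isomorphic_def by blast
    qed
    show "rng_isomorphic R T" if RST: "rng_isomorphic R S" "rng_isomorphic S T" for R S T :: "'a ring"
    proof -
      obtain h where h: "h \<in> rng_iso R S" using RST(1) unfolding rng_isomorphic_def by blast
      obtain k where k: "k \<in> rng_iso S T" using RST(2) unfolding rng_isomorphic_def by blast
      show ?thesis using rng_iso_trans[OF h k] unfolding rng_isomorphic_def by blast
    qed
    show "rng_isomorphic R S" if RS: "R \<in> ?A" "S \<in> ?A" "f R = f S" for R S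
    proof -
      obtain js zs T w where c: "f R = (js, zs, T, w)" by (cases "f R")
      obtain \<phi> ys E where 1: "presentation R J \<phi> ys E p m n js zs T w"
        using f(2)[OF RS(1)] unfolding c Q_def prod.case by (elim exE)
      obtain \<psi> us F where 2: "presentation S J \<psi> us F p m n js zs T w"
        using f(2)[OF RS(2)] unfolding RS(3)[symmetric] c Q_def prod.case by (elim exE)
      show ?thesis by (rule presentation_unique[OF 1 2])
    qed
  qed
  then show ?thesis
    using cardW counting_bound_exponent unfolding rng_iso_classes_def by (meson le_trans)
qed

end
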